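(* Let $X_1,\dots,X_\ell$ be independent real random variables such that for each $j=1,\dots,\ell$ $$\lim_{z\to\infty}z^{\alpha_j}(\ln z)^{-k_j}P\{\pm X_j>z\}=c_j^\pm ,$$ where $\alpha_j\in(0,2)$, $k_j\ge 0$, $c_j^\pm\ge 0$ and $c_j^++c_j^->0$. Let $F(x_1,\dots,x_\ell)=\sum_{\theta\in\Theta}h_\theta g_\theta(x_1,\dots,x_\ell)$ be a polynomial, where $\Theta$ is a finite set of multi-indices $\theta=(\sigma_1,\dots,\sigma_\ell)$ of nonnegative integers with at least one $\theta\in\Theta$ nonzero, $g_\theta(x)=x_1^{\sigma_1}\cdots x_\ell^{\sigma_\ell}$ and $h_\theta\ne0$ for all $\theta\in\Theta$. Let $m=|\Theta|$ and view $\mathbf Z=\{g_\theta(X_1,\dots,X_\ell)\}_{\theta\in\Theta}$ as a random vector in $\mathbb R^m$. Let $\alpha_*,k_*,\Theta_*$ be as defined in the context and $m_*=|\Theta_*|$. (i) There is a measure $\nu$ on the unit sphere $S^{m-1}$ with $\nu(S^{m-1})>0$ such that for every $W\in\mathcal W$ (bounded continuous functions on $\mathbb R^m$ as in the context) $$\lim_{z\to\infty}z^{\alpha_*}(\ln z)^{-k_*}E\Big[W\Big(\frac{\mathbf Z}{z}\Big)\Big]=\int_0^\infty\int_{S^{m-1}}W(rs)\,\frac{\nu(ds)\,dr}{r^{1+\alpha_*}} .$$ Moreover, let $R^{m_*}$ denote any $m_*$-dimensional linear subspace of $\mathbb R^m$ containing the support of the distribution of the random vector $\{g^*_\theta(X_1,\dots,X_\ell)\}_{\theta\in\Theta}$,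 where $g^*_\theta=g_\theta$ if $\theta\in\Theta_*$ and $g^*_\theta\equiv0$ if $\theta\in\Theta\setminus\Theta_*$. Then $\nu\big(S^{m-1}\setminus(R^{m_*}\cap S^{m-1})\big)=0$. (ii) The polynomial $Y=F(X_1,\dots,X_\ell)$ satisfies $$\lim_{z\to\infty}z^{\alpha_*}(\ln z)^{-k_*}P\{\pm Y>z\}=c_F^\pm$$ for some $c_F^\pm\ge0$ with $c_F^++c_F^->0$.
   Context: $\mathcal W$ denotes the space of bounded continuous functions $W:\mathbb R^m\to\mathbb R$ satisfying $|W(x)|\le C|x|^2(1+|x|^2)^{-1}$ for some constant $C>0$. For $\theta=(\sigma_1,\dots,\sigma_\ell)$ (with the convention $\alpha_j/0=+\infty$), put $\alpha(\theta)=\min_{1\le j\le\ell}\frac{\alpha_j}{\sigma_j}$, $J(\theta)=\{j:\frac{\alpha_j}{\sigma_j}=\alpha(\theta)\}$, $p(\theta)=|J(\theta)|$, $k(\theta)=p(\theta)-1+\sum_{j\in J(\theta)}k_j$. Further $\alpha_*=\min_{\theta\in\Theta}\alpha(\theta)$, $k_*=\max_{\theta\in\Theta:\,\alpha(\theta)=\alpha_*}k(\theta)$ and $\Theta_*=\{\theta\in\Theta:\alpha(\theta)=\alpha_*,\ k(\theta)=k_*\}$. *)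

theory Defs
  imports "HOL-Probability.Probability"
begin

text \<open>
  The variables are indexed by a finite type \<open>'l\<close> (so \<open>CARD('l)\<close> is the number of variables), and a
  multi-index is a function \<open>'l \<Rightarrow> nat\<close>.
\<close>

definition monomial_fun :: "('l::finite \<Rightarrow> nat) \<Rightarrow> ('l \<Rightarrow> real) \<Rightarrow> real" where
  "monomial_fun \<theta> x = (\<Prod>j\<in>UNIV. x j ^ \<theta> j)"

definition polynomial_fun ::
    "('l::finite \<Rightarrow> nat) set \<Rightarrow> (('l \<Rightarrow> nat) \<Rightarrow> real) \<Rightarrow> ('l \<Rightarrow> real) \<Rightarrow> real" where
  "polynomial_fun \<Theta> h x = (\<Sum>\<theta>\<in>\<Theta>. h \<theta> * monomial_fun \<theta> x)"

text \<open>
  The quotients \<open>\<alpha>\<^sub>j / \<sigma>\<^sub>j\<close> live in the extended reals because of the convention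
  \<open>\<alpha>\<^sub>j / 0 = \<infinity>\<close>; for the zero multi-index this gives \<open>\<alpha>(0) = \<infinity>\<close>.
\<close>

definition tail_ratio :: "('l \<Rightarrow> real) \<Rightarrow> ('l \<Rightarrow> nat) \<Rightarrow> 'l \<Rightarrow> ereal" where
  "tail_ratio \<alpha> \<theta> j = (if \<theta> j = 0 then \<infinity> else ereal (\<alpha> j / real (\<theta> j)))"

definition alpha_index :: "('l::finite \<Rightarrow> real) \<Rightarrow> ('l \<Rightarrow> nat) \<Rightarrow> ereal" where
  "alpha_index \<alpha> \<theta> = Min (range (tail_ratio \<alpha> \<theta>))"

definition J_index :: "('l::finite \<Rightarrow> real) \<Rightarrow> ('l \<Rightarrow> nat) \<Rightarrow> 'l set" where
  "J_index \<alpha> \<theta> = {j. tail_ratio \<alpha> \<theta> j = alpha_index \<alpha> \<theta>}"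

definition p_index :: "('l::finite \<Rightarrow> real) \<Rightarrow> ('l \<Rightarrow> nat) \<Rightarrow> nat" where
  "p_index \<alpha> \<theta> = card (J_index \<alpha> \<theta>)"

definition k_index :: "('l::finite \<Rightarrow> real) \<Rightarrow> ('l \<Rightarrow> real) \<Rightarrow> ('l \<Rightarrow> nat) \<Rightarrow> real" where
  "k_index \<alpha> k \<theta> = real (p_index \<alpha> \<theta>) - 1 + (\<Sum>j\<in>J_index \<alpha> \<theta>. k j)"

definition alpha_star :: "('l::finite \<Rightarrow> real) \<Rightarrow> ('l \<Rightarrow> nat) set \<Rightarrow> ereal" where
  "alpha_star \<alpha> \<Theta> = Min (alpha_index \<alpha> ` \<Theta>)"

definition k_star :: "('l::finite \<Rightarrow> real) \<Rightarrow> ('l \<Rightarrow> real) \<Rightarrow> ('l \<Rightarrow> nat) set \<Rightarrow> real" where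
  "k_star \<alpha> k \<Theta> = Max (k_index \<alpha> k ` {\<theta>\<in>\<Theta>. alpha_index \<alpha> \<theta> = alpha_star \<alpha> \<Theta>})"

definition Theta_star ::
    "('l::finite \<Rightarrow> real) \<Rightarrow> ('l \<Rightarrow> real) \<Rightarrow> ('l \<Rightarrow> nat) set \<Rightarrow> ('l \<Rightarrow> nat) set" where
  "Theta_star \<alpha> k \<Theta> =
     {\<theta>\<in>\<Theta>. alpha_index \<alpha> \<theta> = alpha_star \<alpha> \<Theta> \<and> k_index \<alpha> k \<theta> = k_star \<alpha> k \<Theta>}"

definition test_functions :: "('a::euclidean_space \<Rightarrow> real) set" where
  "test_functions = {W. continuous_on UNIV W \<and> bounded (range W) \<and>
     (\<exists>C>0. \<forall>x. \<bar>W x\<bar> \<le> C * (norm x)\<^sup>2 * inverse (1 + (norm x)\<^sup>2))}"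

definition measure_support :: "'a::topological_space measure \<Rightarrow> 'a set" where
  "measure_support \<mu> = {x. \<forall>U. open U \<longrightarrow> x \<in> U \<longrightarrow> emeasure \<mu> U > 0}"

text \<open>
  Given an enumeration \<open>e\<close> of the finite set \<open>\<Theta>\<close> by a finite type \<open>'m\<close>, the family
  \<open>{g\<^sub>\<theta>(x)}\<close> with \<open>\<theta> \<in> \<Theta>\<close> is a vector in \<open>real ^ 'm\<close>, where \<open>CARD('m) = card \<Theta>\<close>. In
  \<open>star_monomial_vec\<close> the coordinates outside \<open>T\<close> are replaced by \<open>0\<close>.
\<close>

definition monomial_vec ::
    "('m::finite \<Rightarrow> 'l::finite \<Rightarrow> nat) \<Rightarrow> ('l \<Rightarrow> real) \<Rightarrow> real ^ 'm" where
  "monomial_vec e x = (\<chi> i. monomial_fun (e i) x)"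

definition star_monomial_vec ::
    "('l::finite \<Rightarrow> nat) set \<Rightarrow> ('m::finite \<Rightarrow> 'l \<Rightarrow> nat) \<Rightarrow> ('l \<Rightarrow> real) \<Rightarrow> real ^ 'm" where
  "star_monomial_vec T e x = (\<chi> i. if e i \<in> T then monomial_fun (e i) x else 0)"

end

theory Submission
  imports Defs "HOL-Real_Asymp.Real_Asymp" "HOL-Computational_Algebra.Polynomial"
begin

text \<open>
  Let \<open>\<alpha>\<^sub>*\<close> and \<open>k\<^sub>*\<close> be the two indices of \<open>\<Theta>\<close>. A monomial \<open>g\<^sub>\<theta>(X)\<close> with \<open>\<theta> \<in> \<Theta>\<^sub>*\<close> splits as
  \<open>U V\<close>, where \<open>U\<close> collects the factors with index in \<open>J(\<theta>)\<close> and \<open>V\<close> the others. Each factor of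
  \<open>U\<close> has tail index exactly \<open>\<alpha>\<^sub>*\<close>, the factors of \<open>V\<close> have a finite moment of order \<open>\<alpha>\<^sub>*\<close>.

  Multiplying two independent variables with tails \<open>z\<^sup>-\<^sup>\<alpha> (ln z)\<^sup>k\<close> and \<open>z\<^sup>-\<^sup>\<alpha> (ln z)\<^sup>l\<close> gives the tail
  \<open>z\<^sup>-\<^sup>\<alpha> (ln z)\<^sup>k\<^sup>+\<^sup>l\<^sup>+\<^sup>1\<close> up to a Beta integral (\<open>positive_product_tail\<close>): on the logarithmic scale the
  integrated tail of a product is a convolution of the two tails, and an exponentially decreasing
  function can be recovered from its integral by differencing. Hence \<open>U\<close> has the tail
  \<open>z\<^sup>-\<^sup>\<alpha> (ln z)\<^sup>k\<close> with \<open>\<alpha> = \<alpha>\<^sub>*\<close> and \<open>k = k\<^sub>*\<close>. Since \<open>\<sigma>\<^sub>j = \<alpha>\<^sub>j / \<alpha>\<^sub>*\<close> for \<open>j \<in> J(\<theta>)\<close>, the factor \<open>U\<close> depends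
  only on the set \<open>J(\<theta>)\<close>. So for each \<open>J\<close> the coordinates \<open>\<theta> \<in> \<Theta>\<^sub>*\<close> with \<open>J(\<theta>) = J\<close> form a vector
  \<open>U\<^sub>J V\<^sub>J\<close>, with one heavy real factor \<open>U\<^sub>J\<close> and an independent vector \<open>V\<^sub>J\<close> that has a moment of order
  \<open>\<alpha>\<^sub>*\<close>. Its scaled law converges in the sense of part (i), with a limit spread over the rays through
  \<open>V\<^sub>J\<close> and \<open>- V\<^sub>J\<close> (\<open>breiman_limit\<close>).

  Different blocks \<open>J\<close>, and the coordinates outside \<open>\<Theta>\<^sub>*\<close>, do not interact. If two coordinates \<open>\<theta>\<close>
  and \<open>\<theta>'\<close> are both large, then so is their geometric mean, a monomial with real exponents
  \<open>(\<theta> + \<theta>') / 2\<close>. Its critical set is \<open>J(\<theta>) \<inter> J(\<theta>')\<close>, which is strictly smaller than one of the two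
  sets unless they agree, so at least one power of the logarithm is lost
  (\<open>joint_exceedance_negligible\<close>). A compactness argument turns this into the statement that a test
  function of the whole vector may be replaced by the sum of its values on the blocks
  (\<open>concentration_limit\<close>, \<open>monomial_limit\<close>). Writing the limit in polar coordinates gives \<open>\<nu>\<close>.

  The limit is not zero, and its support is where it should be, because a polynomial in independent
  variables of unbounded support vanishes almost surely only if all its coefficients are zero
  (\<open>polynomial_AE_zero\<close>). Part (ii) is part (i) for functions of the linear form
  \<open>x \<mapsto> \<Sum> h\<^sub>\<theta> x\<^sub>\<theta>\<close>: limits for continuous test functions determine tails since the limit is
  homogeneous (\<open>upper_tail_of_test_limits\<close>).
\<close>

section \<open>Normalising rates and one-sided tails\<close>

definition rate :: "real \<Rightarrow> real \<Rightarrow> real \<Rightarrow> real" where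
  "rate \<alpha> k z = z powr \<alpha> * ln z powr (- k)"

text \<open>
  The constant \<open>c\<close> may be \<open>0\<close>; the rate then only bounds the tail. A two-sided tail is expressed by
  this predicate for \<open>U\<close> and for \<open>- U\<close>.
\<close>
definition upper_tail :: "'w measure \<Rightarrow> ('w \<Rightarrow> real) \<Rightarrow> real \<Rightarrow> real \<Rightarrow> real \<Rightarrow> bool" where
  "upper_tail M U \<alpha> k c \<longleftrightarrow> U \<in> borel_measurable M \<and>
     ((\<lambda>z. rate \<alpha> k z * measure M {\<omega>\<in>space M. U \<omega> > z}) \<longlongrightarrow> c) at_top"

lemma rate_nonneg: "0 \<le> rate \<alpha> k z"
  by (simp add: rate_def)

lemma rate_pos: "1 < z \<Longrightarrow> 0 < rate \<alpha> k z"
  by (simp add: rate_def)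

lemma rate_at_top: "0 < \<alpha> \<Longrightarrow> filterlim (rate \<alpha> k) at_top at_top"
  unfolding rate_def by real_asymp

lemma rate_scale:
  assumes "0 < x"
  shows "((\<lambda>z. rate \<alpha> k z / rate \<alpha> k (z * x)) \<longlongrightarrow> x powr (- \<alpha>)) at_top"
proof -
  have "((\<lambda>z. x powr (- \<alpha>) * (ln (z * x) / ln z) powr k) \<longlongrightarrow> x powr (- \<alpha>) * 1 powr k) at_top"
  proof (intro tendsto_intros)
    show "((\<lambda>z. ln (z * x) / ln z) \<longlongrightarrow> 1) at_top"
      using assms by real_asymp
  qed auto
  moreover have "eventually (\<lambda>z. x powr (- \<alpha>) * (ln (z * x) / ln z) powr k
      = rate \<alpha> k z / rate \<alpha> k (z * x)) at_top"
    using eventually_gt_at_top[of 1] eventually_gt_at_top[of "1 / x"]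
  proof eventually_elim
    case (elim z)
    then have "1 < z * x" using assms by (simp add: field_simps)
    with elim assms show ?case
      by (simp add: rate_def powr_divide powr_mult powr_minus field_simps)
  qed
  ultimately show ?thesis using Lim_transform_eventually by fastforce
qed

lemma upper_tailD:
  assumes "upper_tail M U \<alpha> k c"
  shows "U \<in> borel_measurable M"
    "((\<lambda>z. rate \<alpha> k z * measure M {\<omega>\<in>space M. U \<omega> > z}) \<longlongrightarrow> c) at_top"
  using assms by (auto simp: upper_tail_def)

lemma upper_tail_scaled:
  assumes U: "upper_tail M U \<alpha> k c" and "0 < x"
  shows "((\<lambda>z. rate \<alpha> k z * measure M {\<omega>\<in>space M. U \<omega> > z * x}) \<longlongrightarrow> c * x powr (- \<alpha>)) at_top"
proof -
  have lim: "filterlim (\<lambda>z. z * x) at_top at_top" using assms(2) by real_asymp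
  have "((\<lambda>z. (rate \<alpha> k (z * x) * measure M {\<omega>\<in>space M. U \<omega> > z * x})
        * (rate \<alpha> k z / rate \<alpha> k (z * x))) \<longlongrightarrow> c * x powr (- \<alpha>)) at_top"
    by (intro tendsto_mult rate_scale assms(2) filterlim_compose[OF upper_tailD(2)[OF U] lim])
  moreover have "eventually (\<lambda>z. (rate \<alpha> k (z * x) * measure M {\<omega>\<in>space M. U \<omega> > z * x})
        * (rate \<alpha> k z / rate \<alpha> k (z * x)) = rate \<alpha> k z * measure M {\<omega>\<in>space M. U \<omega> > z * x}) at_top"
    using eventually_gt_at_top[of 1] eventually_gt_at_top[of "1 / x"]
  proof eventually_elim
    case (elim z)
    then have "1 < z * x" using assms by (simp add: field_simps)
    then have "rate \<alpha> k (z * x) \<noteq> 0" using rate_pos[of "z * x" \<alpha> k] by simp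
    then show ?case by simp
  qed
  ultimately show ?thesis by (rule Lim_transform_eventually)
qed

lemma upper_tail_nonneg: "upper_tail M U \<alpha> k c \<Longrightarrow> 0 \<le> c"
  by (rule tendsto_lowerbound[OF upper_tailD(2)]) (auto simp: rate_nonneg)

lemma rate_le_powr: "0 \<le> k \<Longrightarrow> exp 1 \<le> z \<Longrightarrow> rate \<alpha> k z \<le> z powr \<alpha>"
proof -
  assume k: "0 \<le> k" and z: "exp 1 \<le> z"
  have "1 \<le> ln z" using z by (metis exp_gt_zero less_le_trans ln_ge_iff)
  then have "ln z powr (- k) \<le> 1" using k by (simp add: powr_minus ge_one_powr_ge_zero field_simps)
  then show ?thesis unfolding rate_def by (simp add: mult_left_le)
qed

text \<open>
  The bound that makes dominated convergence possible near \<open>x = 0\<close>. Where \<open>z x\<close> is large the limit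
  applies and \<open>ln (z x) \<le> ln z\<close> works in favour of the bound; where \<open>z x\<close> stays below a constant
  \<open>y\<^sub>0\<close>, already \<open>rate \<alpha> k z \<le> z\<^sup>\<alpha> \<le> (y\<^sub>0 / x)\<^sup>\<alpha>\<close>.
\<close>
lemma (in prob_space) upper_tail_uniform_bound:
  assumes U: "upper_tail M U \<alpha> k c" and "0 < \<alpha>" "0 \<le> k"
  obtains C where "0 < C" "\<And>z x. exp 1 \<le> z \<Longrightarrow> 0 < x \<Longrightarrow> x \<le> 1 \<Longrightarrow>
    rate \<alpha> k z * prob {\<omega>\<in>space M. U \<omega> > z * x} \<le> C * x powr (- \<alpha>)"
proof -
  have "eventually (\<lambda>z. rate \<alpha> k z * prob {\<omega>\<in>space M. U \<omega> > z} < c + 1) at_top"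
    by (rule order_tendstoD(2)[OF upper_tailD(2)[OF U]]) simp
  then obtain y0' where y0': "\<And>y. y \<ge> y0' \<Longrightarrow> rate \<alpha> k y * prob {\<omega>\<in>space M. U \<omega> > y} < c + 1"
    by (auto simp: eventually_at_top_linorder)
  define y0 where "y0 = max y0' (exp 1)"
  have c: "0 \<le> c" by (rule upper_tail_nonneg[OF U])
  define C where "C = max (c + 1) (y0 powr \<alpha>)"
  have y0: "exp 1 \<le> y0" "0 < y0" using less_le_trans[OF exp_gt_zero, of 1 y0] by (auto simp: y0_def)
  have "rate \<alpha> k z * prob {\<omega>\<in>space M. U \<omega> > z * x} \<le> C * x powr (- \<alpha>)"
    if z: "exp 1 \<le> z" and x: "0 < x" "x \<le> 1" for z x
  proof (cases "y0 \<le> z * x")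
    case True
    have pos: "0 < z" using z by (auto intro: less_le_trans[OF exp_gt_zero])
    then have pos: "0 < z" "0 < z * x" using x by auto
    have "exp 1 \<le> z * x" using True y0 by simp
    then have ln1: "1 \<le> ln (z * x)" using pos by (simp add: ln_ge_iff)
    have ln2: "ln (z * x) \<le> ln z" using pos x by (simp add: mult_left_le)
    have "ln z powr (- k) \<le> ln (z * x) powr (- k)"
      using ln1 ln2 \<open>0 \<le> k\<close> by (intro powr_mono2') auto
    then have "rate \<alpha> k z \<le> z powr \<alpha> * ln (z * x) powr (- k)"
      unfolding rate_def by (rule mult_left_mono) simp
    also have "\<dots> = x powr (- \<alpha>) * rate \<alpha> k (z * x)"
      using pos x by (simp add: rate_def powr_mult powr_minus field_simps)
    finally have "rate \<alpha> k z \<le> x powr (- \<alpha>) * rate \<alpha> k (z * x)" .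
    then have "rate \<alpha> k z * prob {\<omega>\<in>space M. U \<omega> > z * x}
        \<le> x powr (- \<alpha>) * (rate \<alpha> k (z * x) * prob {\<omega>\<in>space M. U \<omega> > z * x})"
      by (metis measure_nonneg mult.assoc mult_right_mono)
    also have "\<dots> \<le> x powr (- \<alpha>) * C"
      using y0'[of "z * x"] True by (intro mult_left_mono) (auto simp: y0_def C_def)
    finally show ?thesis by (simp add: mult.commute)
  next
    case False
    have pos: "0 < z" using z by (auto intro: less_le_trans[OF exp_gt_zero])
    have "rate \<alpha> k z * prob {\<omega>\<in>space M. U \<omega> > z * x} \<le> z powr \<alpha> * 1"
      using rate_le_powr[OF \<open>0 \<le> k\<close> z] by (intro mult_mono) (auto simp: rate_nonneg)
    also have "z powr \<alpha> \<le> (y0 / x) powr \<alpha>"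
      using False x pos \<open>0 < \<alpha>\<close> by (intro powr_mono2) (auto simp: field_simps)
    also have "\<dots> = y0 powr \<alpha> * x powr (- \<alpha>)"
      using y0 x by (simp add: powr_divide powr_minus field_simps)
    also have "\<dots> \<le> C * x powr (- \<alpha>)" by (intro mult_right_mono) (auto simp: C_def)
    finally show ?thesis by simp
  qed
  moreover have "0 < C" using c by (auto simp: C_def less_max_iff_disj)
  ultimately show ?thesis using that by blast
qed

section \<open>Quantiles and the one-dimensional limit\<close>

text \<open>
  The quantile transform, parametrised by the upper tail probability \<open>p\<close>: \<open>q\<close> is the generalised
  inverse of the tail function and carries the uniform law on \<open>(0, 1)\<close> to the law of \<open>U\<close>.
\<close>
lemma (in prob_space) upper_quantile:
  assumes U[measurable]: "U \<in> borel_measurable M"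
  obtains q :: "real \<Rightarrow> real" where
    "q \<in> borel_measurable borel"
    "\<And>p x. 0 < p \<Longrightarrow> p < 1 \<Longrightarrow> q p \<le> x \<longleftrightarrow> prob {\<omega>\<in>space M. U \<omega> > x} \<le> p"
    "\<And>f :: real \<Rightarrow> real. f \<in> borel_measurable borel \<Longrightarrow>
       expectation (\<lambda>\<omega>. f (U \<omega>)) = (LINT p|lborel. indicator {0<..<1} p * f (q p))"
proof -
  interpret \<mu>: cdf_distribution "distr M borel U"
    unfolding cdf_distribution_def real_distribution_def real_distribution_axioms_def
    by (auto intro!: prob_space_distr)
  define q where "q p = indicator {0<..<1} p * \<mu>.I (1 - p)" for p
  have tail: "prob {\<omega>\<in>space M. U \<omega> > x} = 1 - cdf (distr M borel U) x" for x
  proof -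
    have "cdf (distr M borel U) x = prob {\<omega>\<in>space M. U \<omega> \<le> x}"
      by (auto simp: cdf_def measure_distr intro!: arg_cong[where f=prob])
    moreover have "prob {\<omega>\<in>space M. \<not> U \<omega> \<le> x} = 1 - prob {\<omega>\<in>space M. U \<omega> \<le> x}"
      by (rule prob_neg) measurable
    ultimately show ?thesis by (simp add: not_le)
  qed
  have I[measurable]: "\<mu>.I \<in> borel_measurable (restrict_space lborel {0<..<1})"
    using \<mu>.measurable_CI by (simp add: measurable_def space_restrict_space sets_restrict_space)
  have Im: "(\<lambda>p. indicator {0<..<1} p * \<mu>.I p) \<in> borel_measurable borel"
    using borel_measurable_restrict_space_iff[of "{0<..<1::real}" borel \<mu>.I] \<mu>.measurable_CI by simp
  have "(\<lambda>p. (\<lambda>p. indicator {0<..<1} p * \<mu>.I p) (1 - p)) \<in> borel_measurable borel"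
    by (rule measurable_compose[OF _ Im]) measurable
  also have "(\<lambda>p. (\<lambda>p. indicator {0<..<1} p * \<mu>.I p) (1 - p)) = q"
    by (auto simp: q_def indicator_def fun_eq_iff)
  finally have 1: "q \<in> borel_measurable borel" .
  have 2: "q p \<le> x \<longleftrightarrow> prob {\<omega>\<in>space M. U \<omega> > x} \<le> p" if "0 < p" "p < 1" for p x
    using \<mu>.pseudoinverse[of "1 - p" x] that by (auto simp: q_def tail)
  have 3: "expectation (\<lambda>\<omega>. f (U \<omega>)) = (LINT p|lborel. indicator {0<..<1} p * f (q p))"
    if f[measurable]: "f \<in> borel_measurable borel" for f :: "real \<Rightarrow> real"
  proof -
    have "expectation (\<lambda>\<omega>. f (U \<omega>)) = integral\<^sup>L (distr M borel U) f"
      by (simp add: integral_distr)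
    also have "\<dots> = integral\<^sup>L (distr (restrict_space lborel {0<..<1::real}) borel \<mu>.I) f"
      by (simp add: \<mu>.distr_I_eq_M)
    also have "\<dots> = (LINT p|restrict_space lborel {0<..<1::real}. f (\<mu>.I p))"
      by (rule integral_distr) auto
    also have "\<dots> = (LINT p|lborel. indicator {0<..<1} p * f (\<mu>.I p))"
      by (subst integral_restrict_space) auto
    also have "\<dots> = (LINT p|lborel. indicator {0<..<1} (1 + (-1) * p) * f (\<mu>.I (1 + (-1) * p)))"
      by (subst lborel_integral_real_affine[where c="-1" and t=1]) auto
    also have "\<dots> = (LINT p|lborel. indicator {0<..<1} p * f (q p))"
      by (rule Bochner_Integration.integral_cong) (auto simp: q_def indicator_def)
    finally show ?thesis .
  qed
  show ?thesis by (rule that[OF 1 2 3])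
qed

text \<open>
  The substitution \<open>t = c r\<^sup>-\<^sup>\<alpha>\<close> between the level of a quantile and its value.
\<close>
lemma powr_substitution:
  fixes w :: "real \<Rightarrow> real"
  assumes \<alpha>: "0 < \<alpha>" and c: "0 < c"
    and int: "integrable lborel (\<lambda>t. indicator {0<..} t * w ((c / t) powr (1 / \<alpha>)))"
    and [measurable]: "w \<in> borel_measurable borel"
  shows "set_integrable lborel {0<..} (\<lambda>r. w r / r powr (1 + \<alpha>))"
    "(LINT t|lborel. indicator {0<..} t * w ((c / t) powr (1 / \<alpha>)))
       = c * \<alpha> * (LINT r:{0<..}|lborel. w r / r powr (1 + \<alpha>))"
proof -
  define g where "g r = c * r powr (- \<alpha>)" for r :: real
  define g' where "g' r = - c * \<alpha> * r powr (- \<alpha> - 1)" for r :: real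
  define f where "f t = w ((c / t) powr (1 / \<alpha>))" for t :: real
  have fg: "f (g r) = w r" if "0 < r" for r
    using that c \<alpha> by (simp add: f_def g_def powr_minus powr_powr field_simps)
  have gpos: "0 < g r" if "0 < r" for r using that c by (simp add: g_def)
  have "g ((c / t) powr (1 / \<alpha>)) = t" if "0 < t" for t
    using that c \<alpha> by (simp add: g_def powr_powr powr_minus field_simps)
  moreover have "0 < (c / t) powr (1 / \<alpha>)" if "0 < t" for t
    using that c by simp
  ultimately have "t \<in> g ` {0<..}" if "0 < t" for t
    using that by (metis greaterThan_iff image_eqI)
  then have img: "g ` {0<..} = {0<..}" using gpos by auto
  have inj: "inj_on g {0<..}"
  proof (rule inj_onI)
    fix x y :: real assume "x \<in> {0<..}" "y \<in> {0<..}" "g x = g y"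
    then have "x powr \<alpha> = y powr \<alpha>" using c by (simp add: g_def powr_minus)
    then have "(x powr \<alpha>) powr (1 / \<alpha>) = (y powr \<alpha>) powr (1 / \<alpha>)" by simp
    then show "x = y" using \<alpha> \<open>x \<in> {0<..}\<close> \<open>y \<in> {0<..}\<close> by (simp add: powr_powr)
  qed
  have der: "(g has_field_derivative g' r) (at r within {0<..})" if "r \<in> {0<..}" for r
    unfolding g_def g'_def using that by (auto intro!: derivative_eq_intros)
  have setf: "set_integrable lborel {0<..} f"
    using int by (simp add: set_integrable_def f_def)
  have setf': "f absolutely_integrable_on {0<..}"
    using setf unfolding set_integrable_def by (intro integrable_completion[THEN iffD2]) auto
  have "(\<lambda>x. \<bar>g' x\<bar> * f (g x)) absolutely_integrable_on {0<..} \<and>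
      integral {0<..} (\<lambda>x. \<bar>g' x\<bar> * f (g x)) = integral {0<..} f"
    using has_absolute_integral_change_of_variables_1'[of "{0<..}" g g' f "integral {0<..} f"]
      der inj img setf' by simp
  moreover have eq: "\<bar>g' x\<bar> * f (g x) = c * \<alpha> * (w x / x powr (1 + \<alpha>))" if "x \<in> {0<..}" for x
  proof -
    have "x powr (- \<alpha> - 1) = 1 / x powr (1 + \<alpha>)" using that
      by (metis add.commute diff_conv_add_uminus minus_add_distrib powr_minus_divide)
    then show ?thesis using that c \<alpha> by (simp add: fg g'_def abs_mult)
  qed
  ultimately have "(\<lambda>x. \<bar>g' x\<bar> * f (g x)) absolutely_integrable_on {0<..}"
    and B0: "integral {0<..} (\<lambda>x. \<bar>g' x\<bar> * f (g x)) = integral {0<..} f"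
    by auto
  moreover have "(\<lambda>x. \<bar>g' x\<bar> * f (g x)) absolutely_integrable_on {0<..} \<longleftrightarrow>
      (\<lambda>x. c * \<alpha> * (w x / x powr (1 + \<alpha>))) absolutely_integrable_on {0<..}"
    by (rule set_integrable_cong[OF refl refl]) (rule eq)
  moreover have "integral {0<..} (\<lambda>x. \<bar>g' x\<bar> * f (g x))
      = integral {0<..} (\<lambda>x. c * \<alpha> * (w x / x powr (1 + \<alpha>)))"
    by (rule Henstock_Kurzweil_Integration.integral_cong) (rule eq)
  ultimately have A: "(\<lambda>x. c * \<alpha> * (w x / x powr (1 + \<alpha>))) absolutely_integrable_on {0<..}"
    and B: "integral {0<..} (\<lambda>x. c * \<alpha> * (w x / x powr (1 + \<alpha>))) = integral {0<..} f"
    by auto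
  have A': "set_integrable lborel {0<..} (\<lambda>x. c * \<alpha> * (w x / x powr (1 + \<alpha>)))"
    using A unfolding set_integrable_def
    by (subst (asm) integrable_completion) auto
  have "set_integrable lborel {0<..} (\<lambda>x. 1 / (c * \<alpha>) * (c * \<alpha> * (w x / x powr (1 + \<alpha>))))"
    by (rule set_integrable_mult_right) (rule A')
  then show "set_integrable lborel {0<..} (\<lambda>x. w x / x powr (1 + \<alpha>))"
    using c \<alpha> by simp
  have "(LINT t|lborel. indicator {0<..} t * w ((c / t) powr (1 / \<alpha>))) = (LINT t:{0<..}|lborel. f t)"
    by (simp add: set_lebesgue_integral_def f_def)
  also have "\<dots> = integral {0<..} f"
    by (rule set_borel_integral_eq_integral(2)[OF setf])
  also have "\<dots> = (LINT x:{0<..}|lborel. c * \<alpha> * (w x / x powr (1 + \<alpha>)))"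
    using set_borel_integral_eq_integral(2)[OF A'] B by simp
  finally show "(LINT t|lborel. indicator {0<..} t * w ((c / t) powr (1 / \<alpha>)))
       = c * \<alpha> * (LINT r:{0<..}|lborel. w r / r powr (1 + \<alpha>))"
    by (simp only: set_integral_mult_right)
qed

text \<open>
  A continuous function lies in \<open>test_functions\<close> exactly if it is bounded by a multiple of \<open>trunc_sq\<close>,
  which is itself such a function. Being at least \<open>1 / 2\<close> outside the unit ball, it also bounds tail
  probabilities.
\<close>
definition trunc_sq :: "'a::real_normed_vector \<Rightarrow> real" where
  "trunc_sq x = (norm x)\<^sup>2 / (1 + (norm x)\<^sup>2)"

lemma trunc_sq_zero [simp]: "trunc_sq 0 = 0"
  by (simp add: trunc_sq_def)

lemma trunc_sq_nonneg [simp]: "0 \<le> trunc_sq x"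
  by (simp add: trunc_sq_def)

lemma trunc_sq_le_one: "trunc_sq x \<le> 1"
  by (simp add: trunc_sq_def divide_le_eq add_pos_nonneg)

lemma trunc_sq_le_sq: "trunc_sq x \<le> (norm x)\<^sup>2"
  by (simp add: trunc_sq_def divide_le_eq add_pos_nonneg mult_left_le algebra_simps)

lemma trunc_sq_mono: "norm x \<le> norm y \<Longrightarrow> trunc_sq x \<le> trunc_sq y"
proof -
  assume "norm x \<le> norm y"
  then have "(norm x)\<^sup>2 \<le> (norm y)\<^sup>2" by (intro power_mono) auto
  then show ?thesis by (simp add: trunc_sq_def frac_le_eq add_pos_nonneg divide_le_eq pos_le_divide_eq field_simps)
qed

lemma trunc_sq_norm [simp]: "trunc_sq (norm x) = trunc_sq x"
  by (simp add: trunc_sq_def)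

lemma trunc_sq_ge_half: "1 \<le> norm x \<Longrightarrow> 1 / 2 \<le> trunc_sq x"
  by (simp add: trunc_sq_def field_simps add_pos_nonneg)

lemma continuous_on_trunc_sq [continuous_intros]: "continuous_on S f \<Longrightarrow> continuous_on S (\<lambda>x. trunc_sq (f x))"
  unfolding trunc_sq_def by (intro continuous_intros) (auto simp: add_nonneg_eq_0_iff)

lemma borel_measurable_trunc_sq [measurable]: "trunc_sq \<in> borel_measurable borel"
  by (intro borel_measurable_continuous_onI continuous_intros)

lemma test_functionsD:
  assumes "W \<in> test_functions"
  shows "continuous_on UNIV W" "W \<in> borel_measurable borel" "W 0 = 0"
    "\<exists>C>0. \<forall>x. \<bar>W x\<bar> \<le> C * trunc_sq x"
  using assms by (auto simp: test_functions_def trunc_sq_def divide_inverse mult.assoc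
      intro!: borel_measurable_continuous_onI) (metis abs_le_zero_iff mult_zero_left mult_zero_right norm_zero power_zero_numeral)

lemma test_functionsI:
  assumes "continuous_on UNIV W" "\<And>x. \<bar>W x\<bar> \<le> C * trunc_sq x"
  shows "W \<in> test_functions"
proof -
  have b: "\<bar>W x\<bar> \<le> (\<bar>C\<bar> + 1) * trunc_sq x" for x
    using assms(2)[of x] by (rule order_trans) (intro mult_right_mono, auto)
  have "\<bar>W x\<bar> \<le> \<bar>C\<bar> + 1" for x
    using b[of x] trunc_sq_le_one[of x] mult_left_mono[of "trunc_sq x" 1 "\<bar>C\<bar> + 1"] by auto
  then have "bounded (range W)" by (auto simp: bounded_iff)
  moreover have "\<exists>C>0. \<forall>x. \<bar>W x\<bar> \<le> C * (norm x)\<^sup>2 * inverse (1 + (norm x)\<^sup>2)"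
    using b by (intro exI[of _ "\<bar>C\<bar> + 1"]) (auto simp: trunc_sq_def divide_inverse mult.assoc)
  ultimately show ?thesis using assms(1) by (simp add: test_functions_def)
qed

lemma trunc_sq_test_function: "trunc_sq \<in> test_functions"
  by (rule test_functionsI[where C=1]) (auto intro: continuous_intros)

lemma test_functions_compose:
  assumes W: "W \<in> test_functions" and "continuous_on UNIV g" "\<And>x. norm (g x) \<le> norm x"
  shows "(\<lambda>x. W (g x)) \<in> test_functions"
proof -
  obtain C where C: "0 < C" "\<And>x. \<bar>W x\<bar> \<le> C * trunc_sq x"
    using test_functionsD(4)[OF W] by auto
  show ?thesis
  proof (rule test_functionsI)
    show "continuous_on UNIV (\<lambda>x. W (g x))"
      using continuous_on_compose2[OF test_functionsD(1)[OF W] assms(2)] by auto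
    show "\<bar>W (g x)\<bar> \<le> C * trunc_sq x" for x
      using C(2)[of "g x"] mult_left_mono[OF trunc_sq_mono[OF assms(3)[of x]], of C] C(1) by linarith
  qed
qed

text \<open>
  The dominating function for test functions of rescaled quantiles. This is where \<open>\<alpha> < 2\<close> enters: a
  test function may decrease at the origin only like \<open>x\<^sup>2\<close>.
\<close>
lemma quantile_envelope_integrable:
  fixes C :: real
  assumes "0 < C" "0 < \<alpha>" "\<alpha> < 2"
  shows "integrable lborel (\<lambda>t. indicator {0<..} t * (if t < C then 1 else (C / t) powr (2 / \<alpha>)))"
proof -
  have "((\<lambda>t. t powr (- 2 / \<alpha>)) has_integral - (C powr (- 2 / \<alpha> + 1)) / (- 2 / \<alpha> + 1)) {C..}"
    using assms by (intro has_integral_powr_to_inf) (auto simp: field_simps)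
  then have "(\<lambda>t. t powr (- 2 / \<alpha>)) absolutely_integrable_on {C..}"
    by (intro nonnegative_absolutely_integrable_1) auto
  then have "set_integrable lborel {C..} (\<lambda>t. t powr (- 2 / \<alpha>))"
    unfolding set_integrable_def by (subst (asm) integrable_completion) auto
  then have "integrable lborel (\<lambda>t. C powr (2 / \<alpha>) * (indicator {C..} t * t powr (- 2 / \<alpha>)))"
    unfolding set_integrable_def by auto
  moreover have "integrable lborel (indicator {0<..<C} :: real \<Rightarrow> real)" using assms by simp
  ultimately have "integrable lborel (\<lambda>t. indicator {0<..<C} t
      + C powr (2 / \<alpha>) * (indicator {C..} t * t powr (- 2 / \<alpha>)))"
    by (intro Bochner_Integration.integrable_add)
  also have "(\<lambda>t. indicator {0<..<C} t + C powr (2 / \<alpha>) * (indicator {C..} t * t powr (- 2 / \<alpha>)))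
     = (\<lambda>t. indicator {0<..} t * (if t < C then 1 else (C / t) powr (2 / \<alpha>)))"
    using assms by (auto simp: fun_eq_iff indicator_def powr_divide powr_minus field_simps)
  finally show ?thesis .
qed

lemma test_function_set_integrable:
  fixes w :: "real \<Rightarrow> real"
  assumes w: "w \<in> test_functions" and \<alpha>: "0 < \<alpha>" "\<alpha> < 2"
  shows "set_integrable lborel {0<..} (\<lambda>r. w r / r powr (1 + \<alpha>))"
proof -
  note [measurable] = test_functionsD(2)[OF w]
  obtain C where C: "0 < C" "\<And>x. \<bar>w x\<bar> \<le> C * trunc_sq x"
    using test_functionsD(4)[OF w] by auto
  have "integrable lborel (\<lambda>t. indicator {0<..} t * w ((1 / t) powr (1 / \<alpha>)))"
  proof (rule Bochner_Integration.integrable_bound)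
    show "integrable lborel (\<lambda>t. C * (indicator {0<..} t * (if t < 1 then 1 else (1 / t) powr (2 / \<alpha>))))"
      using quantile_envelope_integrable[of 1 \<alpha>] \<alpha> by auto
    have "norm (indicator {0<..} t * w ((1 / t) powr (1 / \<alpha>)))
      \<le> norm (C * (indicator {0<..} t * (if t < 1 then 1 else (1 / t) powr (2 / \<alpha>))))" for t :: real
    proof (cases "t < 1")
      case True
      show ?thesis using True C(2)[of "(1 / t) powr (1 / \<alpha>)"] C(1) trunc_sq_le_one[of "(1 / t) powr (1 / \<alpha>)"]
        by (auto simp: indicator_def abs_mult intro!: order_trans[OF C(2)])
    next
      case False
      have "((1 / t) powr (1 / \<alpha>))\<^sup>2 = (1 / t) powr (2 / \<alpha>)"
        using False \<alpha> by (simp add: powr_powr flip: powr_numeral)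
      then show ?thesis using False C(1) trunc_sq_le_sq[of "(1 / t) powr (1 / \<alpha>)"]
        by (auto simp: indicator_def abs_mult intro!: order_trans[OF C(2)])
    qed
    then show "AE t in lborel. norm (indicator {0<..} t * w ((1 / t) powr (1 / \<alpha>)))
      \<le> norm (C * (indicator {0<..} t * (if t < 1 then 1 else (1 / t) powr (2 / \<alpha>))))" by simp
  qed measurable
  from powr_substitution(1)[OF \<alpha>(1) _ this] show ?thesis by simp
qed

lemma powr_less_iff_base:
  fixes a b p :: real
  assumes "0 \<le> a" "0 \<le> b" "0 < p"
  shows "a powr p < b powr p \<longleftrightarrow> a < b"
  by (metis assms less_imp_le not_less powr_less_mono2 powr_mono2)

text \<open>
  Inverting \<open>rate \<alpha> k z * P(U > z x) \<longlongrightarrow> c x\<^sup>-\<^sup>\<alpha>\<close>: by the Galois connection between \<open>q\<close> and the tail,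
  each inequality for the quantile is an inequality for the tail.
\<close>
lemma (in prob_space) quantile_scaling_limit:
  assumes U: "upper_tail M U \<alpha> k c" and \<alpha>: "0 < \<alpha>" and t: "0 < t"
    and q: "\<And>p x. 0 < p \<Longrightarrow> p < 1 \<Longrightarrow> q p \<le> x \<longleftrightarrow> prob {\<omega>\<in>space M. U \<omega> > x} \<le> p"
  shows "((\<lambda>z. max 0 (q (t / rate \<alpha> k z)) / z) \<longlongrightarrow> (c / t) powr (1 / \<alpha>)) at_top"
proof -
  have c: "0 \<le> c" by (rule upper_tail_nonneg[OF U])
  have ev: "eventually (\<lambda>z. 1 < z \<and> t < rate \<alpha> k z) at_top"
    using rate_at_top[OF \<alpha>, of k] by (intro eventually_conj eventually_gt_at_top)
      (auto simp: filterlim_at_top_dense)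
  have galois: "max 0 (q (t / rate \<alpha> k z)) / z \<le> x \<longleftrightarrow>
      rate \<alpha> k z * prob {\<omega>\<in>space M. U \<omega> > z * x} \<le> t" if "1 < z" "t < rate \<alpha> k z" "0 < x" for x z
  proof -
    have "max 0 (q (t / rate \<alpha> k z)) / z \<le> x \<longleftrightarrow> q (t / rate \<alpha> k z) \<le> z * x"
      using that by (simp add: divide_le_eq mult.commute)
    also have "\<dots> \<longleftrightarrow> prob {\<omega>\<in>space M. U \<omega> > z * x} \<le> t / rate \<alpha> k z"
      using that t by (intro q) auto
    also have "\<dots> \<longleftrightarrow> rate \<alpha> k z * prob {\<omega>\<in>space M. U \<omega> > z * x} \<le> t"
      using that t by (simp add: le_divide_eq mult.commute)
    finally show ?thesis .
  qed
  have level: "c * x powr (- \<alpha>) < t \<longleftrightarrow> (c / t) powr (1 / \<alpha>) < x"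
    "t < c * x powr (- \<alpha>) \<longleftrightarrow> x < (c / t) powr (1 / \<alpha>)" if "0 < x" for x
  proof -
    have x: "x = (x powr \<alpha>) powr (1 / \<alpha>)" using that \<alpha> by (simp add: powr_powr)
    have "c * x powr (- \<alpha>) < t \<longleftrightarrow> c / t < x powr \<alpha>"
      using that t by (simp add: powr_minus field_simps)
    also have "\<dots> \<longleftrightarrow> (c / t) powr (1 / \<alpha>) < x"
      using powr_less_iff_base[of "c / t" "x powr \<alpha>" "1 / \<alpha>"] x c t \<alpha> by simp
    finally show "c * x powr (- \<alpha>) < t \<longleftrightarrow> (c / t) powr (1 / \<alpha>) < x" .
    have "t < c * x powr (- \<alpha>) \<longleftrightarrow> x powr \<alpha> < c / t"
      using that t by (simp add: powr_minus field_simps)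
    also have "\<dots> \<longleftrightarrow> x < (c / t) powr (1 / \<alpha>)"
      using powr_less_iff_base[of "x powr \<alpha>" "c / t" "1 / \<alpha>"] x c t \<alpha> by simp
    finally show "t < c * x powr (- \<alpha>) \<longleftrightarrow> x < (c / t) powr (1 / \<alpha>)" .
  qed
  show ?thesis
  proof (rule order_tendstoI)
    fix y assume y: "y < (c / t) powr (1 / \<alpha>)"
    show "eventually (\<lambda>z. y < max 0 (q (t / rate \<alpha> k z)) / z) at_top"
    proof (cases "y < 0")
      case True
      show ?thesis using ev by eventually_elim (use True in \<open>auto intro: less_le_trans\<close>)
    next
      case False
      obtain x where x: "y < x" "x < (c / t) powr (1 / \<alpha>)" using dense[OF y] by auto
      then have x0: "0 < x" using False by simp
      have "eventually (\<lambda>z. t < rate \<alpha> k z * prob {\<omega>\<in>space M. U \<omega> > z * x}) at_top"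
        using level(2)[OF x0] x by (intro order_tendstoD[OF upper_tail_scaled[OF U x0]]) auto
      with ev show ?thesis
      proof eventually_elim
        case (elim z) then show ?case using galois[of z x] x x0 by auto
      qed
    qed
  next
    fix y assume y: "(c / t) powr (1 / \<alpha>) < y"
    obtain x where x: "x < y" "(c / t) powr (1 / \<alpha>) < x" using dense[OF y] by auto
    then have x0: "0 < x" by (auto intro: le_less_trans[of 0 "(c / t) powr (1 / \<alpha>)"])
    have "eventually (\<lambda>z. rate \<alpha> k z * prob {\<omega>\<in>space M. U \<omega> > z * x} < t) at_top"
      using level(1)[OF x0] x by (intro order_tendstoD[OF upper_tail_scaled[OF U x0]]) auto
    with ev show "eventually (\<lambda>z. max 0 (q (t / rate \<alpha> k z)) / z < y) at_top"
    proof eventually_elim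
      case (elim z) then show ?case using galois[of z x] x x0 by auto
    qed
  qed
qed

text \<open>
  Writing the mean as an integral over quantile levels \<open>p\<close> and substituting \<open>p = t / rate \<alpha> k z\<close>
  absorbs the rate. The integrand \<open>w (q (t / rate \<alpha> k z) / z)\<close> then converges pointwise to
  \<open>w ((c / t) powr (1 / \<alpha>))\<close>, so the limit follows from a single application of dominated convergence,
  for every continuous \<open>w\<close>.
\<close>
lemma (in prob_space) upper_tail_test_limit:
  assumes U: "upper_tail M U \<alpha> k c" and \<alpha>: "0 < \<alpha>" "\<alpha> < 2" and k: "0 \<le> k"
    and w: "w \<in> test_functions"
  shows "((\<lambda>z. rate \<alpha> k z * expectation (\<lambda>\<omega>. w (max 0 (U \<omega>) / z))) \<longlongrightarrow>
    c * \<alpha> * (LINT r:{0<..}|lborel. w r / r powr (1 + \<alpha>))) at_top"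
proof -
  have c: "0 \<le> c" by (rule upper_tail_nonneg[OF U])
  note [measurable] = upper_tailD(1)[OF U] test_functionsD(2)[OF w]
  obtain B where B: "0 < B" "\<And>x. \<bar>w x\<bar> \<le> B * trunc_sq x"
    using test_functionsD(4)[OF w] by auto
  obtain q where q_meas[measurable]: "q \<in> borel_measurable borel"
    and q: "\<And>p x. 0 < p \<Longrightarrow> p < 1 \<Longrightarrow> q p \<le> x \<longleftrightarrow> prob {\<omega>\<in>space M. U \<omega> > x} \<le> p"
    and q_int: "\<And>f :: real \<Rightarrow> real. f \<in> borel_measurable borel \<Longrightarrow>
       expectation (\<lambda>\<omega>. f (U \<omega>)) = (LINT p|lborel. indicator {0<..<1} p * f (q p))"
    by (rule upper_quantile[OF upper_tailD(1)[OF U]]) (rule that)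
  obtain C where C: "0 < C" "\<And>z x. exp 1 \<le> z \<Longrightarrow> 0 < x \<Longrightarrow> x \<le> 1 \<Longrightarrow>
    rate \<alpha> k z * prob {\<omega>\<in>space M. U \<omega> > z * x} \<le> C * x powr (- \<alpha>)"
    by (rule upper_tail_uniform_bound[OF U \<alpha>(1) k]) (rule that)
  define s where "s z t = indicator {0<..<1} (t / rate \<alpha> k z) * w (max 0 (q (t / rate \<alpha> k z)) / z)" for z t
  define f where "f t = indicator {0<..} t * w ((c / t) powr (1 / \<alpha>))" for t
  define env where "env t = B * (indicator {0<..} t * (if t < C then 1 else (C / t) powr (2 / \<alpha>)))" for t
  have pos: "0 < rate \<alpha> k z" if "1 < z" for z using rate_pos that .
  have gt1: "1 < z" if "exp 1 \<le> z" for z :: real using that less_le_trans[of 1 "exp (1::real)" z] by simp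
  have env_int: "integrable lborel env" unfolding env_def
    using quantile_envelope_integrable[OF C(1) \<alpha>] by auto
  have s_int: "rate \<alpha> k z * expectation (\<lambda>\<omega>. w (max 0 (U \<omega>) / z)) = (LINT t|lborel. s z t)" if "1 < z" for z
  proof -
    have "expectation (\<lambda>\<omega>. w (max 0 (U \<omega>) / z)) = (LINT p|lborel. indicator {0<..<1} p * w (max 0 (q p) / z))"
      by (rule q_int[of "\<lambda>x. w (max 0 x / z)"]) measurable
    also have "\<dots> = \<bar>1 / rate \<alpha> k z\<bar> * (LINT t|lborel. s z t)"
      using pos[OF that] by (subst lborel_integral_real_affine[where c="1 / rate \<alpha> k z" and t=0]) (auto simp: s_def [abs_def])
    finally show ?thesis using pos[OF that] by simp
  qed
  have bound: "\<bar>s z t\<bar> \<le> env t" if z: "exp 1 \<le> z" for z t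
  proof (cases "0 < t \<and> t < rate \<alpha> k z")
    case False
    then have "s z t = 0" using pos[OF gt1[OF z]] by (auto simp: s_def indicator_def divide_less_eq zero_less_divide_iff)
    then show ?thesis using B(1) C(1) by (auto simp: env_def indicator_def)
  next
    case True
    define y where "y = max 0 (q (t / rate \<alpha> k z)) / z"
    have zpos: "1 < z" by (rule gt1[OF z])
    have sy: "s z t = w y" using True pos[OF zpos] by (simp add: s_def y_def indicator_def)
    show ?thesis
    proof (cases "t < C")
      case t: True
      have "\<bar>w y\<bar> \<le> B * 1" using B trunc_sq_le_one[of y] by (meson less_imp_le mult_left_mono order_trans)
      then show ?thesis using t True by (simp add: sy env_def)
    next
      case t: False
      \<comment> \<open>the point at which the uniform tail bound equals \<open>t\<close>\<close>
      define x where "x = (C / t) powr (1 / \<alpha>)"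
      have x: "0 < x" "x \<le> 1" using t C(1) True \<alpha> by (auto simp: x_def powr_le1)
      have "x powr (- \<alpha>) = t / C" using t C(1) True \<alpha> by (simp add: x_def powr_powr powr_minus)
      then have "rate \<alpha> k z * prob {\<omega>\<in>space M. U \<omega> > z * x} \<le> t"
        using C(2)[OF z x] C(1) by simp
      then have "prob {\<omega>\<in>space M. U \<omega> > z * x} \<le> t / rate \<alpha> k z"
        using pos[OF zpos] by (simp add: le_divide_eq mult.commute)
      then have "q (t / rate \<alpha> k z) \<le> z * x" using True pos[OF zpos] by (subst q) auto
      then have "y \<le> x" "0 \<le> y" using x zpos by (auto simp: y_def divide_le_eq mult.commute)
      then have "(norm y)\<^sup>2 \<le> x\<^sup>2" by (auto intro: power_mono)
      also have "x\<^sup>2 = (C / t) powr (2 / \<alpha>)" using t C(1) True by (simp add: x_def powr_powr flip: powr_numeral)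
      finally have "trunc_sq y \<le> (C / t) powr (2 / \<alpha>)" using trunc_sq_le_sq[of y] by simp
      then have "\<bar>w y\<bar> \<le> B * (C / t) powr (2 / \<alpha>)" using B by (meson less_imp_le mult_left_mono order_trans)
      then show ?thesis using t True by (simp add: sy env_def)
    qed
  qed
  have lim: "((\<lambda>z. s z t) \<longlongrightarrow> f t) at_top" for t
  proof (cases "0 < t")
    case True
    have "isCont w ((c / t) powr (1 / \<alpha>))"
      using test_functionsD(1)[OF w] by (simp add: continuous_on_eq_continuous_at)
    from isCont_tendsto_compose[OF this quantile_scaling_limit[OF U \<alpha>(1) True q]]
    have "((\<lambda>z. w (max 0 (q (t / rate \<alpha> k z)) / z)) \<longlongrightarrow> f t) at_top"
      using True by (simp add: f_def)
    moreover have "eventually (\<lambda>z. t < rate \<alpha> k z) at_top"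
      using rate_at_top[OF \<alpha>(1), of k] by (auto simp: filterlim_at_top_dense)
    then have "eventually (\<lambda>z. w (max 0 (q (t / rate \<alpha> k z)) / z) = s z t) at_top"
      using eventually_gt_at_top[of 1]
    proof eventually_elim
      case (elim z) then show ?case using True pos[of z] by (simp add: s_def)
    qed
    ultimately show ?thesis by (rule Lim_transform_eventually)
  next
    case False
    have "eventually (\<lambda>z. f t = s z t) at_top"
      using eventually_gt_at_top[of 1]
    proof eventually_elim
      case (elim z) then show ?case using False pos[of z] by (simp add: s_def f_def indicator_def zero_less_divide_iff)
    qed
    then show ?thesis by (intro tendsto_eventually) (auto elim: eventually_mono)
  qed
  have fm[measurable]: "f \<in> borel_measurable lborel" unfolding f_def by measurable
  have sm[measurable]: "s z \<in> borel_measurable lborel" for z unfolding s_def by measurable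
  have evb: "\<forall>\<^sub>F z in at_top. AE t in lborel. norm (s z t) \<le> env t"
    using eventually_ge_at_top[of "exp 1"] by eventually_elim (simp add: bound)
  have AElim: "AE t in lborel. ((\<lambda>z. s z t) \<longlongrightarrow> f t) at_top" using lim by simp
  have L: "((\<lambda>z. LINT t|lborel. s z t) \<longlongrightarrow> (LINT t|lborel. f t)) at_top"
    by (rule integral_dominated_convergence_at_top[OF fm sm env_int AElim evb])
  have f_int: "integrable lborel f"
    by (rule integrable_dominated_convergence_at_top[OF fm sm env_int AElim evb])
  have "(LINT t|lborel. f t) = c * \<alpha> * (LINT r:{0<..}|lborel. w r / r powr (1 + \<alpha>))"
  proof (cases "c = 0")
    case True
    then have "f = (\<lambda>_. 0)" using test_functionsD(3)[OF w] by (auto simp: f_def)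
    then show ?thesis using True by simp
  next
    case False
    then have "0 < c" using c by simp
    from powr_substitution(2)[OF \<alpha>(1) this f_int[unfolded f_def [abs_def]]]
    show ?thesis by (simp add: f_def)
  qed
  moreover have "\<forall>\<^sub>F z in at_top. (LINT t|lborel. s z t) = rate \<alpha> k z * expectation (\<lambda>\<omega>. w (max 0 (U \<omega>) / z))"
    using eventually_gt_at_top[of 1] by eventually_elim (simp add: s_int)
  ultimately show ?thesis using Lim_transform_eventually[OF L] by simp
qed

section \<open>Products with an independent vector of lighter tails\<close>

definition radial_integral :: "real \<Rightarrow> ('a::real_normed_vector \<Rightarrow> real) \<Rightarrow> 'a \<Rightarrow> real" where
  "radial_integral \<alpha> W s = (LINT r:{0<..}|lborel. W (r *\<^sub>R s) / r powr (1 + \<alpha>))"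

lemma test_functions_bounded_linear:
  fixes g :: "'a::euclidean_space \<Rightarrow> 'b::euclidean_space"
  assumes W: "W \<in> test_functions" and g: "bounded_linear g"
  shows "(\<lambda>x. W (g x)) \<in> test_functions"
proof -
  obtain C where C: "0 < C" "\<And>x. \<bar>W x\<bar> \<le> C * trunc_sq x"
    using test_functionsD(4)[OF W] by auto
  obtain c where c: "\<And>x. norm (g x) \<le> norm x * c" using bounded_linear.bounded[OF g] by auto
  show ?thesis
  proof (rule test_functionsI)
    show "continuous_on UNIV (\<lambda>x. W (g x))"
      by (rule continuous_on_compose2[OF test_functionsD(1)[OF W] linear_continuous_on[OF g]]) auto
    fix x
    have "norm (g x) \<le> norm (norm x *\<^sub>R \<bar>c\<bar>)" using order_trans[OF c[of x] mult_left_mono[OF abs_ge_self norm_ge_zero]] by simp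
    then have "trunc_sq (g x) \<le> trunc_sq (norm x *\<^sub>R \<bar>c\<bar>)" by (rule trunc_sq_mono)
    also have "\<dots> \<le> (1 + c\<^sup>2) * trunc_sq x"
    proof -
      define r where "r = norm x"
      have "r\<^sup>2 * c\<^sup>2 * (1 + r\<^sup>2) \<le> (1 + c\<^sup>2) * r\<^sup>2 * (1 + r\<^sup>2 * c\<^sup>2)"
        by (simp add: algebra_simps mult_left_mono)
      then show ?thesis unfolding trunc_sq_def r_def[symmetric]
        by (simp add: power_mult_distrib divide_simps add_nonneg_eq_0_iff
            mult.commute mult.left_commute add_pos_nonneg not_less zero_le_mult_iff)
    qed
    finally have "C * trunc_sq (g x) \<le> C * ((1 + c\<^sup>2) * trunc_sq x)" using C(1) by (intro mult_left_mono) auto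
    then show "\<bar>W (g x)\<bar> \<le> C * (1 + c\<^sup>2) * trunc_sq x" using C(2)[of "g x"] by (simp only: mult.assoc)
  qed
qed

lemma test_functions_ray:
  fixes W :: "'a::euclidean_space \<Rightarrow> real"
  assumes "W \<in> test_functions"
  shows "(\<lambda>r :: real. W (r *\<^sub>R s)) \<in> test_functions"
  by (rule test_functions_bounded_linear[OF assms bounded_linear_scaleR_left])

lemma borel_measurable_radial_integral [measurable (raw)]:
  fixes W :: "'a::euclidean_space \<Rightarrow> real"
  assumes [measurable]: "W \<in> borel_measurable borel" "f \<in> borel_measurable N"
  shows "(\<lambda>x. radial_integral \<alpha> W (f x)) \<in> borel_measurable N"
  unfolding radial_integral_def set_lebesgue_integral_def by measurable

lemma (in prob_space) integrable_test_function:
  assumes W: "W \<in> test_functions" and [measurable]: "Z \<in> borel_measurable M"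
  shows "integrable M (\<lambda>\<omega>. W (Z \<omega>))"
proof -
  note [measurable] = test_functionsD(2)[OF W]
  obtain C where C: "0 < C" "\<And>x. \<bar>W x\<bar> \<le> C * trunc_sq x"
    using test_functionsD(4)[OF W] by auto
  have "\<bar>W x\<bar> \<le> C" for x
    using C(2)[of x] mult_left_mono[OF trunc_sq_le_one[of x], of C] C(1) by linarith
  then show ?thesis by (intro integrable_const_bound[where B=C]) auto
qed

lemma (in prob_space) two_sided_test_limit:
  assumes up: "upper_tail M U \<alpha> k a" and lo: "upper_tail M (\<lambda>\<omega>. - U \<omega>) \<alpha> k b"
    and \<alpha>: "0 < \<alpha>" "\<alpha> < 2" and k: "0 \<le> k" and w: "w \<in> test_functions"
  shows "((\<lambda>z. rate \<alpha> k z * expectation (\<lambda>\<omega>. w (U \<omega> / z))) \<longlongrightarrow>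
    a * \<alpha> * radial_integral \<alpha> w 1 + b * \<alpha> * radial_integral \<alpha> w (-1)) at_top"
proof -
  note [measurable] = upper_tailD(1)[OF up]
  have w': "(\<lambda>x. w (- x)) \<in> test_functions"
    by (rule test_functions_compose[OF w]) (auto intro: continuous_intros)
  have split: "w (x / z) = w (max 0 x / z) + w (- (max 0 (- x) / z))" for x z
    using test_functionsD(3)[OF w] by (auto simp: max_def)
  have "((\<lambda>z. rate \<alpha> k z * expectation (\<lambda>\<omega>. w (max 0 (U \<omega>) / z))
      + rate \<alpha> k z * expectation (\<lambda>\<omega>. w (- (max 0 (- U \<omega>) / z)))) \<longlongrightarrow>
    a * \<alpha> * (LINT r:{0<..}|lborel. w r / r powr (1 + \<alpha>))
    + b * \<alpha> * (LINT r:{0<..}|lborel. w (- r) / r powr (1 + \<alpha>))) at_top"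
    by (intro tendsto_add upper_tail_test_limit[OF up \<alpha> k w] upper_tail_test_limit[OF lo \<alpha> k w'])
  moreover have "rate \<alpha> k z * expectation (\<lambda>\<omega>. w (max 0 (U \<omega>) / z))
      + rate \<alpha> k z * expectation (\<lambda>\<omega>. w (- (max 0 (- U \<omega>) / z)))
     = rate \<alpha> k z * expectation (\<lambda>\<omega>. w (U \<omega> / z))" for z
  proof -
    have "expectation (\<lambda>\<omega>. w (U \<omega> / z))
      = expectation (\<lambda>\<omega>. w (max 0 (U \<omega>) / z) + w (- (max 0 (- U \<omega>) / z)))"
      by (subst split) simp
    also have "\<dots> = expectation (\<lambda>\<omega>. w (max 0 (U \<omega>) / z)) + expectation (\<lambda>\<omega>. w (- (max 0 (- U \<omega>) / z)))"
      by (intro Bochner_Integration.integral_add integrable_test_function[OF w]) measurable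
    finally show ?thesis by (simp add: algebra_simps)
  qed
  ultimately show ?thesis by (simp add: radial_integral_def)
qed

text \<open>
  The bound grows only like \<open>\<bar>v\<bar>\<^sup>\<alpha>\<close>, with no logarithm: replacing \<open>z\<close> by the smaller \<open>z / \<bar>v\<bar>\<close> makes
  \<open>(ln z)\<^sup>-\<^sup>k\<close> larger. Therefore a moment of order exactly \<open>\<alpha>\<close> suffices for the second factor of a
  product.
\<close>
lemma (in prob_space) truncated_moment_bound:
  assumes up: "upper_tail M U \<alpha> k a" and lo: "upper_tail M (\<lambda>\<omega>. - U \<omega>) \<alpha> k b"
    and \<alpha>: "0 < \<alpha>" "\<alpha> < 2" and k: "0 \<le> k"
  obtains K where "0 < K" "\<And>z v. exp 1 \<le> z \<Longrightarrow>
    rate \<alpha> k z * expectation (\<lambda>\<omega>. trunc_sq (U \<omega> * v / z)) \<le> K * (1 + \<bar>v\<bar> powr \<alpha>)"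
proof -
  note [measurable] = upper_tailD(1)[OF up]
  define N where "N z = expectation (\<lambda>\<omega>. trunc_sq (U \<omega> / z))" for z
  have N0: "0 \<le> N z" for z unfolding N_def by (intro Bochner_Integration.integral_nonneg) simp
  have int: "integrable M (\<lambda>\<omega>. trunc_sq (Z \<omega>))" if "Z \<in> borel_measurable M" for Z :: "'a \<Rightarrow> real"
    by (rule integrable_test_function[OF trunc_sq_test_function that])
  have N1: "N z \<le> 1" for z
  proof -
    have "N z \<le> expectation (\<lambda>_. 1)"
      unfolding N_def by (intro integral_mono int) (auto simp: trunc_sq_le_one)
    then show ?thesis by (simp add: prob_space)
  qed
  obtain L where L: "((\<lambda>z. rate \<alpha> k z * N z) \<longlongrightarrow> L) at_top"
    using two_sided_test_limit[OF up lo \<alpha> k trunc_sq_test_function] unfolding N_def by blast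
  have "eventually (\<lambda>z. rate \<alpha> k z * N z < L + 1) at_top"
    by (rule order_tendstoD(2)[OF L]) simp
  then obtain z1 where z1: "\<And>z. z1 \<le> z \<Longrightarrow> rate \<alpha> k z * N z < L + 1"
    by (auto simp: eventually_at_top_linorder)
  define K0 where "K0 = max (L + 1) (\<bar>z1\<bar> powr \<alpha>)"
  have K0: "rate \<alpha> k z * N z \<le> K0" if z: "exp 1 \<le> z" for z
  proof (cases "z1 \<le> z")
    case True then show ?thesis using z1[OF True] by (auto simp: K0_def)
  next
    case False
    have zp: "0 < z" using z less_le_trans[OF exp_gt_zero] by blast
    have "rate \<alpha> k z * N z \<le> z powr \<alpha> * 1"
      using rate_le_powr[OF k z] N0 N1 by (intro mult_mono) auto
    also have "\<dots> \<le> \<bar>z1\<bar> powr \<alpha>" using False zp \<alpha> by (auto intro: powr_mono2)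
    finally show ?thesis by (simp add: K0_def)
  qed
  have K0_0: "0 \<le> K0" by (simp add: K0_def le_max_iff_disj)
  define K where "K = K0 + exp \<alpha>"
  have "rate \<alpha> k z * expectation (\<lambda>\<omega>. trunc_sq (U \<omega> * v / z)) \<le> K * (1 + \<bar>v\<bar> powr \<alpha>)"
    if z: "exp 1 \<le> z" for z v
  proof (cases "\<bar>v\<bar> \<le> 1")
    case True
    have zp: "0 < z" using z less_le_trans[OF exp_gt_zero] by blast
    have "trunc_sq (U \<omega> * v / z) \<le> trunc_sq (U \<omega> / z)" for \<omega>
      using True zp by (intro trunc_sq_mono) (auto simp: abs_mult divide_right_mono mult_left_le)
    then have "expectation (\<lambda>\<omega>. trunc_sq (U \<omega> * v / z)) \<le> N z"
      unfolding N_def by (intro integral_mono int) auto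
    then have "rate \<alpha> k z * expectation (\<lambda>\<omega>. trunc_sq (U \<omega> * v / z)) \<le> rate \<alpha> k z * N z"
      by (intro mult_left_mono rate_nonneg)
    also have "\<dots> \<le> K * 1" using K0[OF z] by (simp add: K_def add_increasing2)
    also have "\<dots> \<le> K * (1 + \<bar>v\<bar> powr \<alpha>)"
      using K0_0 by (intro mult_left_mono) (auto simp: K_def)
    finally show ?thesis .
  next
    case False
    define y where "y = z / \<bar>v\<bar>"
    have zp: "0 < z" using z less_le_trans[OF exp_gt_zero] by blast
    have yp: "0 < y" and zy: "z = \<bar>v\<bar> * y" and yz: "y \<le> z"
      using zp False by (auto simp: y_def divide_le_eq)
    have "trunc_sq (U \<omega> * v / z) = trunc_sq (U \<omega> / y)" for \<omega>
      using False by (simp add: y_def trunc_sq_def abs_mult flip: power_abs)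
    then have E: "expectation (\<lambda>\<omega>. trunc_sq (U \<omega> * v / z)) = N y" by (simp add: N_def)
    have "rate \<alpha> k z * N y \<le> \<bar>v\<bar> powr \<alpha> * K"
    proof (cases "exp 1 \<le> y")
      case True
      have "1 \<le> ln y" using True yp by (subst ln_ge_iff) auto
      moreover have "ln y \<le> ln z" using yp zp yz by simp
      ultimately have "ln z powr (- k) \<le> ln y powr (- k)" using k by (intro powr_mono2') auto
      then have "rate \<alpha> k z \<le> z powr \<alpha> * ln y powr (- k)"
        unfolding rate_def by (intro mult_left_mono) auto
      also have "\<dots> = \<bar>v\<bar> powr \<alpha> * rate \<alpha> k y"
        using yp by (simp add: rate_def zy powr_mult)
      finally have "rate \<alpha> k z * N y \<le> (\<bar>v\<bar> powr \<alpha> * rate \<alpha> k y) * N y"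
        by (intro mult_right_mono N0)
      also have "\<dots> \<le> \<bar>v\<bar> powr \<alpha> * K0"
        using K0[OF True] by (simp add: mult.assoc mult_left_mono)
      also have "\<dots> \<le> \<bar>v\<bar> powr \<alpha> * K" by (intro mult_left_mono) (auto simp: K_def)
      finally show ?thesis .
    next
      case False
      have "rate \<alpha> k z * N y \<le> z powr \<alpha> * 1"
        using rate_le_powr[OF k z] N0 N1 by (intro mult_mono) auto
      also have "z powr \<alpha> = \<bar>v\<bar> powr \<alpha> * y powr \<alpha>" using yp by (simp add: zy powr_mult)
      also have "y powr \<alpha> \<le> exp 1 powr \<alpha>" using False yp \<alpha> by (intro powr_mono2) auto
      also have "exp 1 powr \<alpha> \<le> K" using K0_0 by (simp add: K_def powr_def)
      finally show ?thesis by (simp add: mult_left_mono)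
    qed
    moreover have "0 \<le> K" using K0_0 by (simp add: K_def)
    ultimately show ?thesis unfolding E by (simp add: distrib_left mult.commute)
  qed
  moreover have "0 < K" using K0_0 by (simp add: K_def add_nonneg_pos)
  ultimately show ?thesis using that by blast
qed

text \<open>
  For a fixed value \<open>v\<close> of \<open>V\<close> this is the one-dimensional limit along the ray through \<open>v\<close>, with \<open>z\<close>
  replaced by \<open>z / norm v\<close>; the change of the rate produces the factor \<open>norm v powr \<alpha>\<close>. The bound above
  allows integration over \<open>v\<close>. Independence is stated through the joint law because \<open>indep_var\<close>
  relates variables of one common type only.
\<close>
lemma (in prob_space) breiman_limit:
  fixes V :: "'a \<Rightarrow> 'b::euclidean_space"
  assumes up: "upper_tail M U \<alpha> k a" and lo: "upper_tail M (\<lambda>\<omega>. - U \<omega>) \<alpha> k b"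
    and \<alpha>: "0 < \<alpha>" "\<alpha> < 2" and k: "0 \<le> k"
    and V: "V \<in> borel_measurable M"
    and joint: "distr M borel U \<Otimes>\<^sub>M distr M borel V = distr M (borel \<Otimes>\<^sub>M borel) (\<lambda>\<omega>. (U \<omega>, V \<omega>))"
    and V_int: "integrable M (\<lambda>\<omega>. norm (V \<omega>) powr \<alpha>)"
    and W: "W \<in> test_functions"
  shows "((\<lambda>z. rate \<alpha> k z * expectation (\<lambda>\<omega>. W ((U \<omega> *\<^sub>R V \<omega>) /\<^sub>R z))) \<longlongrightarrow>
    expectation (\<lambda>\<omega>. norm (V \<omega>) powr \<alpha> * (a * \<alpha> * radial_integral \<alpha> W (sgn (V \<omega>))
      + b * \<alpha> * radial_integral \<alpha> W (- sgn (V \<omega>))))) at_top"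
proof -
  note [measurable] = upper_tailD(1)[OF up] V
  note [measurable] = test_functionsD(2)[OF W]
  let ?\<mu> = "distr M borel U" and ?\<nu> = "distr M borel V"
  interpret \<mu>: prob_space ?\<mu> by (rule prob_space_distr) simp
  interpret \<nu>: prob_space ?\<nu> by (rule prob_space_distr) simp
  interpret P: pair_prob_space ?\<mu> ?\<nu> ..
  obtain C where C: "0 < C" "\<And>x. \<bar>W x\<bar> \<le> C * trunc_sq x"
    using test_functionsD(4)[OF W] by auto
  obtain K where K: "0 < K" "\<And>z v. exp 1 \<le> z \<Longrightarrow>
    rate \<alpha> k z * expectation (\<lambda>\<omega>. trunc_sq (U \<omega> * v / z)) \<le> K * (1 + \<bar>v\<bar> powr \<alpha>)"
    by (rule truncated_moment_bound[OF up lo \<alpha> k]) (rule that)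
  define g where "g z v = rate \<alpha> k z * expectation (\<lambda>\<omega>. W ((U \<omega> *\<^sub>R v) /\<^sub>R z))" for z v
  define G where "G v = norm v powr \<alpha> * (a * \<alpha> * radial_integral \<alpha> W (sgn v)
      + b * \<alpha> * radial_integral \<alpha> W (- sgn v))" for v
  have sgn_meas: "(sgn :: 'b \<Rightarrow> 'b) \<in> borel_measurable borel"
    unfolding sgn_div_norm [abs_def] by measurable
  note [measurable] = sgn_meas
  have iterated: "expectation (\<lambda>\<omega>. W ((U \<omega> *\<^sub>R V \<omega>) /\<^sub>R z))
      = (LINT v|?\<nu>. expectation (\<lambda>\<omega>. W ((U \<omega> *\<^sub>R v) /\<^sub>R z)))" for z
  proof -
    have "expectation (\<lambda>\<omega>. W ((U \<omega> *\<^sub>R V \<omega>) /\<^sub>R z))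
        = integral\<^sup>L (?\<mu> \<Otimes>\<^sub>M ?\<nu>) (\<lambda>(u, v). W ((u *\<^sub>R v) /\<^sub>R z))"
      unfolding joint by (subst integral_distr) auto
    also have "\<dots> = (LINT v|?\<nu>. LINT u|?\<mu>. W ((u *\<^sub>R v) /\<^sub>R z))"
      by (rule P.integral_snd[symmetric])
        (use P.integrable_test_function[OF W, of "\<lambda>(u, v). (u *\<^sub>R v) /\<^sub>R z"] in \<open>simp add: split_beta'\<close>)
    also have "\<dots> = (LINT v|?\<nu>. expectation (\<lambda>\<omega>. W ((U \<omega> *\<^sub>R v) /\<^sub>R z)))"
      by (intro Bochner_Integration.integral_cong refl) (subst integral_distr, auto)
    finally show ?thesis .
  qed
  have "((\<lambda>z. LINT v|?\<nu>. g z v) \<longlongrightarrow> (LINT v|?\<nu>. G v)) at_top"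
  proof (rule integral_dominated_convergence_at_top)
    show "G \<in> borel_measurable ?\<nu>" unfolding G_def by measurable
    show "g z \<in> borel_measurable ?\<nu>" for z
      unfolding g_def by measurable
    have "integrable ?\<nu> (\<lambda>v. norm v powr \<alpha>)"
      using V_int by (subst integrable_distr_eq) auto
    then show "integrable ?\<nu> (\<lambda>v. C * (K * (1 + norm v powr \<alpha>)))" by auto
    show "\<forall>\<^sub>F z in at_top. AE v in ?\<nu>. norm (g z v) \<le> C * (K * (1 + norm v powr \<alpha>))"
      using eventually_ge_at_top[of "exp 1"]
    proof eventually_elim
      case (elim z)
      have "norm (g z v) \<le> C * (K * (1 + norm v powr \<alpha>))" for v
      proof -
        have zp: "0 < z" using elim less_le_trans[OF exp_gt_zero] by blast
        have "\<bar>expectation (\<lambda>\<omega>. W ((U \<omega> *\<^sub>R v) /\<^sub>R z))\<bar> \<le> expectation (\<lambda>\<omega>. \<bar>W ((U \<omega> *\<^sub>R v) /\<^sub>R z)\<bar>)"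
          by (rule integral_abs_bound)
        also have "\<dots> \<le> expectation (\<lambda>\<omega>. C * trunc_sq (U \<omega> * norm v / z))"
        proof (intro integral_mono integrable_abs integrable_test_function[OF W] integrable_mult_right
            integrable_test_function[OF trunc_sq_test_function])
          fix \<omega>
          have "norm ((U \<omega> *\<^sub>R v) /\<^sub>R z) = norm (U \<omega> * norm v / z)"
            using zp by (simp add: abs_mult divide_inverse mult.commute mult.left_commute)
          then have "trunc_sq ((U \<omega> *\<^sub>R v) /\<^sub>R z) = trunc_sq (U \<omega> * norm v / z)"
            by (metis trunc_sq_norm)
          then show "\<bar>W ((U \<omega> *\<^sub>R v) /\<^sub>R z)\<bar> \<le> C * trunc_sq (U \<omega> * norm v / z)"
            using C(2)[of "(U \<omega> *\<^sub>R v) /\<^sub>R z"] by simp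
        qed measurable
        also have "\<dots> = C * expectation (\<lambda>\<omega>. trunc_sq (U \<omega> * norm v / z))" by simp
        finally have "rate \<alpha> k z * \<bar>expectation (\<lambda>\<omega>. W ((U \<omega> *\<^sub>R v) /\<^sub>R z))\<bar>
            \<le> rate \<alpha> k z * (C * expectation (\<lambda>\<omega>. trunc_sq (U \<omega> * norm v / z)))"
          by (rule mult_left_mono) (rule rate_nonneg)
        also have "\<dots> = C * (rate \<alpha> k z * expectation (\<lambda>\<omega>. trunc_sq (U \<omega> * norm v / z)))"
          by (simp only: mult.left_commute)
        also have "\<dots> \<le> C * (K * (1 + norm v powr \<alpha>))"
          using K(2)[OF elim, of "norm v"] C(1) by (intro mult_left_mono) auto
        finally show ?thesis by (simp add: g_def abs_mult rate_nonneg)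
      qed
      then show ?case by simp
    qed
    have "((\<lambda>z. g z v) \<longlongrightarrow> G v) at_top" for v
    proof (cases "v = 0")
      case True
      then show ?thesis using test_functionsD(3)[OF W] by (simp add: g_def G_def)
    next
      case False
      define x where "x = 1 / norm v"
      have x: "0 < x" using False by (simp add: x_def)
      define w where "w r = W (r *\<^sub>R sgn v)" for r :: real
      have w: "w \<in> test_functions" unfolding w_def by (rule test_functions_ray[OF W])
      have lim: "filterlim (\<lambda>z. z * x) at_top at_top" using x by real_asymp
      have "((\<lambda>z. (rate \<alpha> k z / rate \<alpha> k (z * x)) * (rate \<alpha> k (z * x) * expectation (\<lambda>\<omega>. w (U \<omega> / (z * x))))) \<longlongrightarrow>
        x powr (- \<alpha>) * (a * \<alpha> * radial_integral \<alpha> w 1 + b * \<alpha> * radial_integral \<alpha> w (-1))) at_top"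
        by (intro tendsto_mult rate_scale x filterlim_compose[OF two_sided_test_limit[OF up lo \<alpha> k w] lim])
      moreover have "x powr (- \<alpha>) * (a * \<alpha> * radial_integral \<alpha> w 1 + b * \<alpha> * radial_integral \<alpha> w (-1)) = G v"
        using False by (simp add: G_def radial_integral_def w_def x_def powr_minus_divide powr_divide)
      moreover have "\<forall>\<^sub>F z in at_top. (rate \<alpha> k z / rate \<alpha> k (z * x)) * (rate \<alpha> k (z * x) * expectation (\<lambda>\<omega>. w (U \<omega> / (z * x)))) = g z v"
        using eventually_gt_at_top[of 1] eventually_gt_at_top[of "1 / x"]
      proof eventually_elim
        case (elim z)
        then have "1 < z * x" using x by (simp add: field_simps)
        then have "rate \<alpha> k (z * x) \<noteq> 0" using rate_pos[of "z * x" \<alpha> k] by simp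
        moreover have "w (u / (z * x)) = W ((u *\<^sub>R v) /\<^sub>R z)" for u
          using False by (simp add: w_def x_def sgn_div_norm divide_inverse mult.commute mult.left_commute)
        ultimately show ?case by (simp add: g_def)
      qed
      ultimately show ?thesis using Lim_transform_eventually by fastforce
    qed
    then show "AE v in ?\<nu>. ((\<lambda>z. g z v) \<longlongrightarrow> G v) at_top" by simp
  qed
  moreover have "(LINT v|?\<nu>. g z v) = rate \<alpha> k z * expectation (\<lambda>\<omega>. W ((U \<omega> *\<^sub>R V \<omega>) /\<^sub>R z))" for z
    unfolding g_def iterated by simp
  moreover have "(LINT v|?\<nu>. G v) = expectation (\<lambda>\<omega>. G (V \<omega>))"
    by (rule integral_distr) (auto simp: G_def)
  ultimately show ?thesis by (simp add: G_def)
qed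

section \<open>Products of independent variables with the same tail index\<close>

text \<open>
  The dominating function for the convolution of two logarithmic tails after rescaling.
\<close>
lemma poly_exp_integrable:
  fixes p :: real
  assumes \<alpha>: "0 < \<alpha>" and p: "0 \<le> p"
  shows "integrable lborel (\<lambda>u. (2 + \<bar>u\<bar>) powr p * exp (\<alpha> * (1 - \<bar>u\<bar>)))"
proof (rule Bochner_Integration.integrable_bound)
  define q where "q = p + 2"
  have q: "0 < q" using p by (simp add: q_def)
  define D where "D = (q / \<alpha>) powr q * exp (3 * \<alpha>)"
  have "integrable lborel (\<lambda>u::real. inverse (1 + u\<^sup>2))"
    using integrable_inverse_1_plus_square by (simp add: set_integrable_def)
  then show "integrable lborel (\<lambda>u. D * inverse (1 + u\<^sup>2))" by simp
  have "norm ((2 + \<bar>u\<bar>) powr p * exp (\<alpha> * (1 - \<bar>u\<bar>))) \<le> norm (D * inverse (1 + u\<^sup>2))" for u :: real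
  proof -
    define x where "x = \<bar>u\<bar>"
    have x: "0 \<le> x" by (simp add: x_def)
    have "\<alpha> * (2 + x) / q \<le> exp (\<alpha> * (2 + x) / q)"
      using exp_ge_add_one_self[of "\<alpha> * (2 + x) / q"] by linarith
    then have "2 + x \<le> q / \<alpha> * exp (\<alpha> * (2 + x) / q)" using \<alpha> q by (simp add: field_simps)
    then have "(2 + x) powr q \<le> (q / \<alpha> * exp (\<alpha> * (2 + x) / q)) powr q"
      using x q by (intro powr_mono2) auto
    also have "\<dots> = (q / \<alpha>) powr q * exp (\<alpha> * (2 + x))"
      using q \<alpha> by (subst powr_mult) (simp_all add: exp_powr_real)
    finally have 1: "(2 + x) powr q \<le> (q / \<alpha>) powr q * exp (\<alpha> * (2 + x))" .
    have "1 + u\<^sup>2 \<le> (2 + x)\<^sup>2" using x by (simp add: x_def power2_eq_square algebra_simps)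
    also have "\<dots> = (2 + x) powr 2" using x by (simp add: powr_numeral)
    finally have "(2 + x) powr p * (1 + u\<^sup>2) \<le> (2 + x) powr p * (2 + x) powr 2"
      by (intro mult_left_mono) auto
    also have "\<dots> = (2 + x) powr q" by (simp add: q_def powr_add)
    also note 1
    finally have "(2 + x) powr p * (1 + u\<^sup>2) * exp (\<alpha> * (1 - x))
        \<le> (q / \<alpha>) powr q * exp (\<alpha> * (2 + x)) * exp (\<alpha> * (1 - x))"
      by (intro mult_right_mono) auto
    also have "\<dots> = D" unfolding D_def mult.assoc exp_add[symmetric] by (simp add: algebra_simps)
    finally have "(2 + x) powr p * exp (\<alpha> * (1 - x)) \<le> D * inverse (1 + u\<^sup>2)"
      by (simp add: divide_inverse[symmetric] le_divide_eq add_pos_nonneg mult.commute mult.left_commute)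
    then show ?thesis by (simp add: x_def abs_mult add_nonneg_pos D_def)
  qed
  then show "AE u in lborel. norm ((2 + \<bar>u\<bar>) powr p * exp (\<alpha> * (1 - \<bar>u\<bar>))) \<le> norm (D * inverse (1 + u\<^sup>2))"
    by simp
qed measurable

text \<open>
  A tail function on the logarithmic scale, \<open>F t = P(X > exp t)\<close>, behaves like
  \<open>a t\<^sup>k exp (- \<alpha> t)\<close> for large \<open>t\<close> and is only bounded by \<open>1\<close> for negative \<open>t\<close>. This and the next lemma
  describe it at \<open>t = s u\<close> as \<open>s\<close> grows: bounded by an integrable profile in \<open>u\<close>, and convergent to
  \<open>a u\<^sup>k\<close> for \<open>u > 0\<close> and to \<open>0\<close> for \<open>u < 0\<close>.
\<close>
lemma log_tail_bound:
  fixes F :: "real \<Rightarrow> real"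
  assumes F: "\<And>t. 0 \<le> F t" "\<And>t. F t \<le> 1"
    and lim: "((\<lambda>t. exp (\<alpha> * t) * t powr (- k) * F t) \<longlongrightarrow> a) at_top"
    and \<alpha>: "0 < \<alpha>" and k: "0 \<le> k"
  obtains C where "1 \<le> C" "\<And>s u. 1 \<le> s \<Longrightarrow>
    s powr (- k) * exp (\<alpha> * (s * u)) * F (s * u) \<le> C * ((1 + \<bar>u\<bar>) powr k * exp (\<alpha> * min 0 u))"
proof -
  have "eventually (\<lambda>t. exp (\<alpha> * t) * t powr (- k) * F t < a + 1) at_top"
    by (rule order_tendstoD(2)[OF lim]) simp
  then obtain t0' where t0': "\<And>t. t0' \<le> t \<Longrightarrow> exp (\<alpha> * t) * t powr (- k) * F t < a + 1"
    by (auto simp: eventually_at_top_linorder)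
  define t0 where "t0 = max 1 t0'"
  define C where "C = max (a + 1) (exp (\<alpha> * t0))"
  have C1: "1 \<le> C" using \<alpha> by (simp add: C_def le_max_iff_disj t0_def)
  have pos: "exp (\<alpha> * t) * F t \<le> C * (1 + t) powr k" if t: "0 \<le> t" for t
  proof (cases "t0 \<le> t")
    case True
    then have tp: "0 < t" by (auto simp: t0_def)
    have "exp (\<alpha> * t) * F t = t powr k * (exp (\<alpha> * t) * t powr (- k) * F t)"
      using tp by (simp add: powr_minus field_simps)
    also have "\<dots> \<le> t powr k * C"
      using t0'[of t] True by (intro mult_left_mono) (auto simp: t0_def C_def)
    also have "\<dots> \<le> (1 + t) powr k * C"
      using tp k C1 by (intro mult_right_mono powr_mono2) auto
    finally show ?thesis by (simp add: mult.commute)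
  next
    case False
    have "exp (\<alpha> * t) * F t \<le> exp (\<alpha> * t0) * 1"
      using False F \<alpha> by (intro mult_mono) auto
    also have "\<dots> \<le> C * 1" by (simp add: C_def)
    also have "\<dots> \<le> C * (1 + t) powr k"
      using C1 t k by (intro mult_left_mono ge_one_powr_ge_zero) auto
    finally show ?thesis .
  qed
  have "s powr (- k) * exp (\<alpha> * (s * u)) * F (s * u) \<le> C * ((1 + \<bar>u\<bar>) powr k * exp (\<alpha> * min 0 u))"
    if s: "1 \<le> s" for s u
  proof (cases "0 \<le> u")
    case True
    have "s powr (- k) * exp (\<alpha> * (s * u)) * F (s * u) \<le> s powr (- k) * (C * (1 + s * u) powr k)"
      unfolding mult.assoc using True s by (intro mult_left_mono pos) auto
    also have "\<dots> \<le> s powr (- k) * (C * (s * (1 + u)) powr k)"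
      using True s C1 k by (intro mult_left_mono powr_mono2) (auto simp: algebra_simps)
    also have "(s * (1 + u)) powr k = s powr k * (1 + u) powr k" by (rule powr_mult)
    also have "s powr (- k) * (C * (s powr k * (1 + u) powr k)) = C * (1 + u) powr k"
      using s by (simp add: powr_minus)
    finally show ?thesis using True by simp
  next
    case False
    have "s powr (- k) \<le> 1" using s k by (simp add: powr_minus ge_one_powr_ge_zero field_simps)
    moreover have "s * u \<le> 1 * u" using s False by (intro mult_right_mono_neg) auto
    ultimately have "s powr (- k) * exp (\<alpha> * (s * u)) * F (s * u) \<le> 1 * exp (\<alpha> * u) * 1"
      using F \<alpha> by (intro mult_mono) auto
    also have "\<dots> \<le> (C * (1 + \<bar>u\<bar>) powr k) * exp (\<alpha> * u)"
    proof -
      have "1 * 1 \<le> C * (1 + \<bar>u\<bar>) powr k"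
        using C1 k by (intro mult_mono ge_one_powr_ge_zero) auto
      then show ?thesis by simp
    qed
    finally show ?thesis using False by (simp add: mult.assoc)
  qed
  with C1 show ?thesis using that by blast
qed

lemma log_tail_scaled_limit:
  fixes F :: "real \<Rightarrow> real"
  assumes F: "\<And>t. 0 \<le> F t" "\<And>t. F t \<le> 1"
    and lim: "((\<lambda>t. exp (\<alpha> * t) * t powr (- k) * F t) \<longlongrightarrow> a) at_top"
    and \<alpha>: "0 < \<alpha>" and k: "0 \<le> k" and u: "u \<noteq> 0"
  shows "((\<lambda>s. s powr (- k) * exp (\<alpha> * (s * u)) * F (s * u)) \<longlongrightarrow> indicator {0<..} u * a * u powr k) at_top"
proof (cases "0 < u")
  case True
  have "filterlim (\<lambda>s. s * u) at_top at_top" using True by real_asymp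
  from filterlim_compose[OF lim this]
  have "((\<lambda>s. u powr k * (exp (\<alpha> * (s * u)) * (s * u) powr (- k) * F (s * u))) \<longlongrightarrow> u powr k * a) at_top"
    by (intro tendsto_intros)
  moreover have "eventually (\<lambda>s. u powr k * (exp (\<alpha> * (s * u)) * (s * u) powr (- k) * F (s * u))
      = s powr (- k) * exp (\<alpha> * (s * u)) * F (s * u)) at_top"
    using eventually_gt_at_top[of 0]
    by eventually_elim (use True in \<open>simp add: powr_mult powr_minus field_simps\<close>)
  ultimately have "((\<lambda>s. s powr (- k) * exp (\<alpha> * (s * u)) * F (s * u)) \<longlongrightarrow> u powr k * a) at_top"
    by (rule Lim_transform_eventually)
  then show ?thesis using True by (simp add: mult.commute)
next
  case False
  then have u: "u < 0" using u by simp
  have "((\<lambda>s. s powr (- k) * exp (\<alpha> * (s * u)) * F (s * u)) \<longlongrightarrow> 0) at_top"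
  proof (rule tendsto_sandwich[where f="\<lambda>_. 0" and h="\<lambda>s. exp (\<alpha> * (s * u))"])
    show "eventually (\<lambda>s. 0 \<le> s powr (- k) * exp (\<alpha> * (s * u)) * F (s * u)) at_top"
      using F by simp
    show "eventually (\<lambda>s. s powr (- k) * exp (\<alpha> * (s * u)) * F (s * u) \<le> exp (\<alpha> * (s * u))) at_top"
      using eventually_ge_at_top[of 1]
    proof eventually_elim
      case (elim s)
      have "s powr (- k) \<le> 1" using elim k by (simp add: powr_minus ge_one_powr_ge_zero field_simps)
      then have "s powr (- k) * exp (\<alpha> * (s * u)) * F (s * u) \<le> 1 * exp (\<alpha> * (s * u)) * 1"
        using F by (intro mult_mono) auto
      then show ?case by simp
    qed
    define d where "d = - (\<alpha> * u)"
    have "0 < d" using \<alpha> u by (simp add: d_def mult_pos_neg)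
    then have "((\<lambda>s. exp (- d * s)) \<longlongrightarrow> 0) at_top" by real_asymp
    then have "((\<lambda>s. exp ((\<alpha> * u) * s)) \<longlongrightarrow> 0) at_top" by (simp add: d_def)
    then show "((\<lambda>s. exp (\<alpha> * (s * u))) \<longlongrightarrow> 0) at_top" by (simp add: mult.commute mult.left_commute)
  qed auto
  then show ?thesis using False by simp
qed

text \<open>
  Euler's Beta function at \<open>(k + 1, l + 1)\<close>.
\<close>
definition beta_integral :: "real \<Rightarrow> real \<Rightarrow> real" where
  "beta_integral k l = (LINT u|lborel. indicator {0<..<1} u * (u powr k * (1 - u) powr l))"

text \<open>
  With \<open>t = s u\<close> the exponentials in \<open>F t\<close> and \<open>G (s - t)\<close> multiply to \<open>exp (- \<alpha> s)\<close>, whatever \<open>u\<close>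
  is. What remains is the integral of \<open>a u\<^sup>k b (1 - u)\<^sup>l\<close> over \<open>(0, 1)\<close>; the pieces \<open>u < 0\<close> and \<open>u > 1\<close>
  disappear in the limit.
\<close>
lemma log_tail_convolution:
  fixes F G :: "real \<Rightarrow> real"
  assumes [measurable]: "F \<in> borel_measurable borel" "G \<in> borel_measurable borel"
    and F: "\<And>t. 0 \<le> F t" "\<And>t. F t \<le> 1" and G: "\<And>t. 0 \<le> G t" "\<And>t. G t \<le> 1"
    and limF: "((\<lambda>t. exp (\<alpha> * t) * t powr (- k) * F t) \<longlongrightarrow> a) at_top"
    and limG: "((\<lambda>t. exp (\<alpha> * t) * t powr (- l) * G t) \<longlongrightarrow> b) at_top"
    and \<alpha>: "0 < \<alpha>" and k: "0 \<le> k" and l: "0 \<le> l"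
  shows "((\<lambda>s. exp (\<alpha> * s) * s powr (- (k + l + 1)) * (LINT t|lborel. F t * G (s - t)))
           \<longlongrightarrow> a * b * beta_integral k l) at_top"
    "1 \<le> s \<Longrightarrow> integrable lborel (\<lambda>t. F t * G (s - t))"
proof -
  obtain C where C: "1 \<le> C" "\<And>s u. 1 \<le> s \<Longrightarrow>
    s powr (- k) * exp (\<alpha> * (s * u)) * F (s * u) \<le> C * ((1 + \<bar>u\<bar>) powr k * exp (\<alpha> * min 0 u))"
    by (rule log_tail_bound[OF F limF \<alpha> k]) (rule that)
  obtain C' where C': "1 \<le> C'" "\<And>s u. 1 \<le> s \<Longrightarrow>
    s powr (- l) * exp (\<alpha> * (s * u)) * G (s * u) \<le> C' * ((1 + \<bar>u\<bar>) powr l * exp (\<alpha> * min 0 u))"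
    by (rule log_tail_bound[OF G limG \<alpha> l]) (rule that)
  define \<Phi> where "\<Phi> s u = (s powr (- k) * exp (\<alpha> * (s * u)) * F (s * u)) *
     (s powr (- l) * exp (\<alpha> * (s * (1 - u))) * G (s * (1 - u)))" for s u
  define \<phi> where "\<phi> u = indicator {0<..<1} u * (a * b * (u powr k * (1 - u) powr l))" for u :: real
  define env where "env u = C * C' * ((2 + \<bar>u\<bar>) powr (k + l) * exp (\<alpha> * (1 - \<bar>u\<bar>)))" for u :: real
  have env_int: "integrable lborel env" unfolding env_def
    using poly_exp_integrable[OF \<alpha>, of "k + l"] k l by simp
  have bound: "\<bar>\<Phi> s u\<bar> \<le> env u" if s: "1 \<le> s" for s u
  proof -
    have "\<bar>\<Phi> s u\<bar> = \<Phi> s u" using F G by (simp add: \<Phi>_def)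
    also have "\<dots> \<le> (C * ((1 + \<bar>u\<bar>) powr k * exp (\<alpha> * min 0 u))) *
        (C' * ((1 + \<bar>1 - u\<bar>) powr l * exp (\<alpha> * min 0 (1 - u))))"
      unfolding \<Phi>_def using F G C(1) C'(1) by (intro mult_mono C(2)[OF s] C'(2)[OF s]) auto
    also have "\<dots> \<le> (C * ((2 + \<bar>u\<bar>) powr k * exp (\<alpha> * min 0 u))) *
        (C' * ((2 + \<bar>u\<bar>) powr l * exp (\<alpha> * min 0 (1 - u))))"
      using C(1) C'(1) k l by (intro mult_mono mult_left_mono mult_right_mono powr_mono2) auto
    also have "\<dots> = C * C' * ((2 + \<bar>u\<bar>) powr (k + l) * exp (\<alpha> * (min 0 u + min 0 (1 - u))))"
      by (simp add: powr_add exp_add distrib_left)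
    also have "\<dots> \<le> env u"
      unfolding env_def using C(1) C'(1) \<alpha> by (intro mult_left_mono) auto
    finally show ?thesis .
  qed
  have [measurable]: "\<Phi> s \<in> borel_measurable lborel" for s unfolding \<Phi>_def by measurable
  have \<phi>m: "\<phi> \<in> borel_measurable lborel" unfolding \<phi>_def by measurable
  have lim: "((\<lambda>s. \<Phi> s u) \<longlongrightarrow> \<phi> u) at_top" if "u \<noteq> 0" "u \<noteq> 1" for u
  proof -
    have "((\<lambda>s. \<Phi> s u) \<longlongrightarrow> (indicator {0<..} u * a * u powr k) * (indicator {0<..} (1 - u) * b * (1 - u) powr l)) at_top"
      unfolding \<Phi>_def using that
      by (intro tendsto_mult log_tail_scaled_limit[OF F limF \<alpha> k] log_tail_scaled_limit[OF G limG \<alpha> l]) auto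
    also have "(indicator {0<..} u * a * u powr k) * (indicator {0<..} (1 - u) * b * (1 - u) powr l) = \<phi> u"
      by (auto simp: \<phi>_def indicator_def)
    finally show ?thesis .
  qed
  have AElim: "AE u in lborel. ((\<lambda>s. \<Phi> s u) \<longlongrightarrow> \<phi> u) at_top"
    using AE_lborel_singleton[of 0] AE_lborel_singleton[of 1] by eventually_elim (rule lim)
  have evb: "\<forall>\<^sub>F s in at_top. AE u in lborel. norm (\<Phi> s u) \<le> env u"
    using eventually_ge_at_top[of 1] by eventually_elim (simp add: bound)
  have L: "((\<lambda>s. LINT u|lborel. \<Phi> s u) \<longlongrightarrow> (LINT u|lborel. \<phi> u)) at_top"
    by (rule integral_dominated_convergence_at_top[OF \<phi>m _ env_int AElim evb]) measurable
  have "(LINT u|lborel. \<phi> u) = a * b * beta_integral k l"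
    unfolding \<phi>_def beta_integral_def
    by (subst integral_mult_right_zero[symmetric]) (simp only: mult.left_commute)
  moreover have eq: "\<Phi> s u = exp (\<alpha> * s) * s powr (- (k + l)) * (F (s * u) * G (s - s * u))" for s u
  proof -
    have "exp (\<alpha> * (s * u)) * exp (\<alpha> * (s * (1 - u))) = exp (\<alpha> * s)"
      by (simp add: exp_add[symmetric] algebra_simps)
    then have "exp (\<alpha> * s) * s powr (- (k + l)) * (F (s * u) * G (s - s * u)) =
      (exp (\<alpha> * (s * u)) * exp (\<alpha> * (s * (1 - u)))) * (s powr (- k) * s powr (- l)) * (F (s * u) * G (s - s * u))"
      by (simp add: powr_add[symmetric])
    then show ?thesis by (auto simp: \<Phi>_def algebra_simps)
  qed
  moreover have "\<forall>\<^sub>F s in at_top. (LINT u|lborel. \<Phi> s u)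
      = exp (\<alpha> * s) * s powr (- (k + l + 1)) * (LINT t|lborel. F t * G (s - t))"
    using eventually_gt_at_top[of 0]
  proof eventually_elim
    case (elim s)
    have "(LINT t|lborel. F t * G (s - t)) = s * (LINT u|lborel. F (s * u) * G (s - s * u))"
      using elim by (subst lborel_integral_real_affine[where c=s and t=0]) auto
    moreover have "s powr (- (k + l + 1)) * s = s powr (- (k + l))"
      using elim powr_add[of s "- (k + l + 1)" 1] by simp
    ultimately show ?case by (simp add: eq mult.assoc)
  qed
  ultimately show "((\<lambda>s. exp (\<alpha> * s) * s powr (- (k + l + 1)) * (LINT t|lborel. F t * G (s - t)))
           \<longlongrightarrow> a * b * beta_integral k l) at_top"
    using Lim_transform_eventually[OF L] by simp
  assume s: "1 \<le> s"
  have "integrable lborel (\<Phi> s)"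
    using env_int by (rule Bochner_Integration.integrable_bound) (auto intro!: AE_I2 order_trans[OF bound[OF s]])
  then have "integrable lborel (\<lambda>u. F (s * u) * G (s - s * u))"
    using s by (simp add: eq [abs_def])
  then show "integrable lborel (\<lambda>t. F t * G (s - t))"
    using lborel_integrable_real_affine_iff[of s "\<lambda>t. F t * G (s - t)" 0] s by simp
qed

text \<open>
  Here \<open>Q\<close> plays the role of the integral of the decreasing function \<open>H\<close> over \<open>[s, \<infinity>)\<close>, which the two
  inequalities express. Since \<open>Q\<close> decays exponentially, the difference quotients of \<open>Q\<close> over a step
  \<open>\<delta>\<close> have limits proportional to \<open>(exp (\<alpha> \<delta>) - 1) / \<delta>\<close> and \<open>(1 - exp (- \<alpha> \<delta>)) / \<delta>\<close>, and both tend to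
  \<open>\<alpha>\<close> as \<open>\<delta>\<close> tends to \<open>0\<close>.
\<close>
lemma monotone_density:
  fixes H Q :: "real \<Rightarrow> real"
  assumes \<alpha>: "0 < \<alpha>"
    and lim: "((\<lambda>s. exp (\<alpha> * s) * s powr (- p) * Q s) \<longlongrightarrow> D) at_top"
    and up: "\<And>s \<delta>. 0 < \<delta> \<Longrightarrow> 1 + \<delta> \<le> s \<Longrightarrow> \<delta> * H s \<le> Q (s - \<delta>) - Q s"
    and lo: "\<And>s \<delta>. 0 < \<delta> \<Longrightarrow> 1 \<le> s \<Longrightarrow> Q s - Q (s + \<delta>) \<le> \<delta> * H s"
  shows "((\<lambda>s. exp (\<alpha> * s) * s powr (- p) * H s) \<longlongrightarrow> \<alpha> * D) at_top"
proof -
  define \<beta> where "\<beta> s = exp (\<alpha> * s) * s powr (- p)" for s :: real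
  have \<beta>0: "0 \<le> \<beta> s" for s by (simp add: \<beta>_def)
  have shift: "((\<lambda>s. \<beta> s * Q (s + x)) \<longlongrightarrow> exp (- \<alpha> * x) * D) at_top" for x
  proof -
    have "filterlim (\<lambda>s. s + x) at_top at_top" by real_asymp
    from filterlim_compose[OF lim this]
    have "((\<lambda>s. \<beta> (s + x) * Q (s + x)) \<longlongrightarrow> D) at_top" by (simp add: \<beta>_def)
    moreover have "((\<lambda>s. exp (- \<alpha> * x) * ((s + x) / s) powr p) \<longlongrightarrow> exp (- \<alpha> * x) * 1 powr p) at_top"
    proof (intro tendsto_intros)
      show "((\<lambda>s. (s + x) / s) \<longlongrightarrow> 1) at_top" by real_asymp
    qed auto
    ultimately have "((\<lambda>s. (exp (- \<alpha> * x) * ((s + x) / s) powr p) * (\<beta> (s + x) * Q (s + x))) \<longlongrightarrow> (exp (- \<alpha> * x) * 1 powr p) * D) at_top"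
      by (rule tendsto_mult[rotated])
    moreover have "\<forall>\<^sub>F s in at_top. (exp (- \<alpha> * x) * ((s + x) / s) powr p) * (\<beta> (s + x) * Q (s + x)) = \<beta> s * Q (s + x)"
      using eventually_gt_at_top[of 0] eventually_gt_at_top[of "- x"]
    proof eventually_elim
      case (elim s)
      have "exp (- \<alpha> * x) * exp (\<alpha> * (s + x)) = exp (\<alpha> * s)" by (simp add: exp_add[symmetric] algebra_simps)
      moreover have "((s + x) / s) powr p * (s + x) powr (- p) = s powr (- p)"
        using elim by (simp add: powr_divide powr_minus field_simps)
      ultimately have "(exp (- \<alpha> * x) * exp (\<alpha> * (s + x))) * (((s + x) / s) powr p * (s + x) powr (- p)) * Q (s + x)
          = \<beta> s * Q (s + x)" by (simp add: \<beta>_def)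
      then show ?case by (simp add: \<beta>_def algebra_simps)
    qed
    ultimately show ?thesis using Lim_transform_eventually by fastforce
  qed
  have lim0: "((\<lambda>s. \<beta> s * Q s) \<longlongrightarrow> D) at_top" using lim by (simp add: \<beta>_def)
  have "((\<lambda>s. \<beta> s * H s) \<longlongrightarrow> \<alpha> * D) at_top"
  proof (rule order_tendstoI)
    fix y assume y: "\<alpha> * D < y"
    have "((\<lambda>\<delta>. (exp (\<alpha> * \<delta>) - 1) / \<delta>) \<longlongrightarrow> \<alpha>) (at_right 0)" by real_asymp
    then have "((\<lambda>\<delta>. (exp (\<alpha> * \<delta>) - 1) / \<delta> * D) \<longlongrightarrow> \<alpha> * D) (at_right 0)" by (intro tendsto_intros)
    from order_tendstoD(2)[OF this y] have "eventually (\<lambda>\<delta>. (exp (\<alpha> * \<delta>) - 1) / \<delta> * D < y \<and> 0 < \<delta>) (at_right 0)"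
      by (intro eventually_conj) (auto simp: eventually_at_right_less)
    then obtain \<delta> where \<delta>: "(exp (\<alpha> * \<delta>) - 1) / \<delta> * D < y" "0 < \<delta>"
      by (auto dest: eventually_happens simp: trivial_limit_at_right_real)
    have "((\<lambda>s. (\<beta> s * Q (s + - \<delta>) - \<beta> s * Q s) / \<delta>) \<longlongrightarrow> (exp (- \<alpha> * - \<delta>) * D - D) / \<delta>) at_top"
      using \<delta> by (intro tendsto_intros shift lim0) auto
    moreover have "(exp (- \<alpha> * - \<delta>) * D - D) / \<delta> < y" using \<delta>(1) by (simp add: algebra_simps diff_divide_distrib)
    ultimately have "\<forall>\<^sub>F s in at_top. (\<beta> s * Q (s + - \<delta>) - \<beta> s * Q s) / \<delta> < y" by (rule order_tendstoD(2))
    then show "\<forall>\<^sub>F s in at_top. \<beta> s * H s < y" using eventually_ge_at_top[of "1 + \<delta>"]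
    proof eventually_elim
      case (elim s)
      have "\<beta> s * (\<delta> * H s) \<le> \<beta> s * (Q (s - \<delta>) - Q s)" by (intro mult_left_mono up \<delta> \<beta>0 elim)
      then have "\<beta> s * H s \<le> (\<beta> s * Q (s + - \<delta>) - \<beta> s * Q s) / \<delta>" using \<delta>(2) by (simp add: field_simps)
      then show ?case using elim(1) by linarith
    qed
  next
    fix y assume y: "y < \<alpha> * D"
    have "((\<lambda>\<delta>. (1 - exp (- \<alpha> * \<delta>)) / \<delta>) \<longlongrightarrow> \<alpha>) (at_right 0)" by real_asymp
    then have "((\<lambda>\<delta>. (1 - exp (- \<alpha> * \<delta>)) / \<delta> * D) \<longlongrightarrow> \<alpha> * D) (at_right 0)" by (intro tendsto_intros)
    from order_tendstoD(1)[OF this y] have "eventually (\<lambda>\<delta>. y < (1 - exp (- \<alpha> * \<delta>)) / \<delta> * D \<and> 0 < \<delta>) (at_right 0)"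
      by (intro eventually_conj) (auto simp: eventually_at_right_less)
    then obtain \<delta> where \<delta>: "y < (1 - exp (- \<alpha> * \<delta>)) / \<delta> * D" "0 < \<delta>"
      by (auto dest: eventually_happens simp: trivial_limit_at_right_real)
    have "((\<lambda>s. (\<beta> s * Q s - \<beta> s * Q (s + \<delta>)) / \<delta>) \<longlongrightarrow> (D - exp (- \<alpha> * \<delta>) * D) / \<delta>) at_top"
      using \<delta> by (intro tendsto_intros shift lim0) auto
    moreover have "y < (D - exp (- \<alpha> * \<delta>) * D) / \<delta>" using \<delta>(1) by (simp add: algebra_simps diff_divide_distrib)
    ultimately have "\<forall>\<^sub>F s in at_top. y < (\<beta> s * Q s - \<beta> s * Q (s + \<delta>)) / \<delta>" by (rule order_tendstoD(1))
    then show "\<forall>\<^sub>F s in at_top. y < \<beta> s * H s" using eventually_ge_at_top[of 1]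
    proof eventually_elim
      case (elim s)
      have "\<beta> s * (Q s - Q (s + \<delta>)) \<le> \<beta> s * (\<delta> * H s)" by (intro mult_left_mono lo \<delta> \<beta>0 elim)
      then have "(\<beta> s * Q s - \<beta> s * Q (s + \<delta>)) / \<delta> \<le> \<beta> s * H s" using \<delta>(2) by (simp add: field_simps)
      then show ?case using elim(1) by linarith
    qed
  qed
  then show ?thesis by (simp add: \<beta>_def)
qed

lemma beta_integral_pos:
  assumes "0 \<le> k" "0 \<le> l"
  shows "0 < beta_integral k l"
proof -
  let ?f = "\<lambda>u::real. indicator {0<..<1} u * (u powr k * (1 - u) powr l)"
  have int: "integrable lborel ?f"
  proof (rule Bochner_Integration.integrable_bound)
    show "integrable lborel (indicator {0<..<1} :: real \<Rightarrow> real)" by simp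
    show "AE u in lborel. norm (?f u) \<le> norm (indicator {0<..<1} u :: real)"
      using assms by (intro AE_I2) (auto simp: indicator_def abs_mult intro!: mult_le_one powr_le1)
  qed measurable
  have "beta_integral k l \<noteq> 0"
  proof
    assume "beta_integral k l = 0"
    then have "AE u in lborel. ?f u = 0"
      unfolding beta_integral_def by (subst (asm) integral_nonneg_eq_0_iff_AE[OF int]) auto
    then have "AE u in lborel. u \<notin> {0<..<1::real}"
      by eventually_elim (auto simp: indicator_def split: if_splits)
    moreover have "{u. \<not> u \<notin> {0<..<1::real}} = {0<..<1}" by auto
    ultimately have "emeasure lborel {0<..<1::real} = 0" by (subst (asm) AE_iff_measurable[OF _ refl]) auto
    then show False by simp
  qed
  moreover have "0 \<le> beta_integral k l"
    unfolding beta_integral_def by (intro Bochner_Integration.integral_nonneg) auto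
  ultimately show ?thesis by simp
qed

text \<open>
  For \<open>X, Y > 0\<close> the set of \<open>t\<close> with \<open>exp t < X\<close> and \<open>exp (s - t) < Y\<close> is an interval of length
  \<open>ln X + ln Y - s\<close>. Integrating its indicator over \<open>t\<close> and over the probability space in both orders
  identifies the mean excess of \<open>ln (X Y)\<close> over \<open>s\<close> with the convolution of the tails.
\<close>
lemma (in prob_space) excess_eq_convolution:
  fixes X Y :: "'a \<Rightarrow> real"
  assumes indep: "indep_var borel X borel Y"
  defines "F \<equiv> \<lambda>t. prob {\<omega>\<in>space M. X \<omega> > exp t}" and "G \<equiv> \<lambda>t. prob {\<omega>\<in>space M. Y \<omega> > exp t}"
  defines "L \<equiv> \<lambda>s \<omega>. if 0 < X \<omega> \<and> 0 < Y \<omega> then max 0 (ln (X \<omega>) + ln (Y \<omega>) - s) else 0"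
  assumes int: "integrable lborel (\<lambda>t. F t * G (s - t))"
  shows "integrable M (L s)" "expectation (L s) = (LINT t|lborel. F t * G (s - t))"
proof -
  have [measurable]: "X \<in> borel_measurable M" "Y \<in> borel_measurable M"
    using indep_var_rv1[OF indep] indep_var_rv2[OF indep] by auto
  interpret P: pair_sigma_finite M lborel ..
  define A where "A = (\<lambda>\<omega> t. indicator {(\<omega>, t). exp t < X \<omega> \<and> exp (s - t) < Y \<omega>} (\<omega>, t) :: ennreal)"
  have [measurable]: "L s \<in> borel_measurable M" unfolding L_def by measurable
  have Am: "case_prod A \<in> borel_measurable (M \<Otimes>\<^sub>M lborel)"
    unfolding A_def by (simp add: indicator_def) measurable
  have inner1: "(\<integral>\<^sup>+t. A \<omega> t \<partial>lborel) = ennreal (L s \<omega>)" for \<omega>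
  proof -
    have "(\<integral>\<^sup>+t. A \<omega> t \<partial>lborel) = (\<integral>\<^sup>+t. indicator {t. exp t < X \<omega> \<and> exp (s - t) < Y \<omega>} t \<partial>lborel)"
      by (simp add: A_def indicator_def)
    also have "{t. exp t < X \<omega> \<and> exp (s - t) < Y \<omega>}
        = (if 0 < X \<omega> \<and> 0 < Y \<omega> then {s - ln (Y \<omega>)<..<ln (X \<omega>)} else {})"
    proof (cases "0 < X \<omega> \<and> 0 < Y \<omega>")
      case True
      then have "exp t < X \<omega> \<longleftrightarrow> t < ln (X \<omega>)" "exp (s - t) < Y \<omega> \<longleftrightarrow> s - t < ln (Y \<omega>)" for t
        by (metis exp_less_cancel_iff exp_ln)+
      then show ?thesis using True by auto
    next
      case False
      have "0 < X \<omega> \<and> 0 < Y \<omega>" if "exp t < X \<omega>" "exp (s - t) < Y \<omega>" for t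
        using that less_trans[OF exp_gt_zero that(1)] less_trans[OF exp_gt_zero that(2)] by simp
      then show ?thesis using False by auto
    qed
    also have "(\<integral>\<^sup>+t. indicator (if 0 < X \<omega> \<and> 0 < Y \<omega> then {s - ln (Y \<omega>)<..<ln (X \<omega>)} else {}) t \<partial>lborel)
        = emeasure lborel (if 0 < X \<omega> \<and> 0 < Y \<omega> then {s - ln (Y \<omega>)<..<ln (X \<omega>)} else {})"
      by (rule nn_integral_indicator) auto
    also have "\<dots> = ennreal (L s \<omega>)"
    proof -
      have "emeasure lborel {c<..<d} = ennreal (max 0 (d - c))" for c d :: real
        by (cases "c \<le> d") (auto simp: max_def)
      then show ?thesis by (simp add: L_def algebra_simps)
    qed
    finally show ?thesis .
  qed
  have inner2: "(\<integral>\<^sup>+\<omega>. A \<omega> t \<partial>M) = ennreal (F t * G (s - t))" for t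
  proof -
    have "(\<integral>\<^sup>+\<omega>. A \<omega> t \<partial>M) = (\<integral>\<^sup>+\<omega>. indicator {\<omega>\<in>space M. exp t < X \<omega> \<and> exp (s - t) < Y \<omega>} \<omega> \<partial>M)"
      by (intro nn_integral_cong) (auto simp: A_def indicator_def)
    also have "\<dots> = ennreal (prob {\<omega>\<in>space M. exp t < X \<omega> \<and> exp (s - t) < Y \<omega>})"
      by (simp add: emeasure_eq_measure)
    also have "{\<omega>\<in>space M. exp t < X \<omega> \<and> exp (s - t) < Y \<omega>}
        = (\<lambda>x. (X x, Y x)) -` ({exp t<..} \<times> {exp (s - t)<..}) \<inter> space M" by auto
    also have "prob \<dots> = prob (X -` {exp t<..} \<inter> space M) * prob (Y -` {exp (s - t)<..} \<inter> space M)"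
      by (rule indep_varD[OF indep]) auto
    also have "\<dots> = F t * G (s - t)"
      unfolding F_def G_def by (intro arg_cong2[where f="(*)"] arg_cong[where f=prob]) auto
    finally show ?thesis .
  qed
  have FG: "0 \<le> F t * G (s - t)" for t by (simp add: F_def G_def)
  have L0: "0 \<le> L s \<omega>" for \<omega> by (simp add: L_def)
  have "(\<integral>\<^sup>+\<omega>. ennreal (L s \<omega>) \<partial>M) = (\<integral>\<^sup>+t. ennreal (F t * G (s - t)) \<partial>lborel)"
    using P.Fubini'[OF Am] by (simp add: inner1 inner2)
  also have "\<dots> = ennreal (LINT t|lborel. F t * G (s - t))"
    by (rule nn_integral_eq_integral[OF int]) (use FG in simp)
  finally have eq: "(\<integral>\<^sup>+\<omega>. ennreal (L s \<omega>) \<partial>M) = ennreal (LINT t|lborel. F t * G (s - t))" .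
  show "integrable M (L s)"
    by (rule integrableI_nonneg) (use L0 eq in auto)
  show "expectation (L s) = (LINT t|lborel. F t * G (s - t))"
    using L0 Bochner_Integration.integral_nonneg[of lborel "\<lambda>t. F t * G (s - t)"] FG
    by (subst integral_eq_nn_integral) (simp_all add: eq)
qed

text \<open>
  The mean excess of \<open>ln (X Y)\<close> over \<open>s\<close> is the integrated tail, so the asymptotics of the convolution
  pass to the tail itself by \<open>monotone_density\<close>.
\<close>
lemma (in prob_space) positive_product_tail:
  fixes X Y :: "'a \<Rightarrow> real"
  assumes X: "upper_tail M X \<alpha> k a" and Y: "upper_tail M Y \<alpha> l b"
    and indep: "indep_var borel X borel Y"
    and \<alpha>: "0 < \<alpha>" and k: "0 \<le> k" and l: "0 \<le> l"
  shows "((\<lambda>z. rate \<alpha> (k + l + 1) z * prob {\<omega>\<in>space M. 0 < X \<omega> \<and> 0 < Y \<omega> \<and> X \<omega> * Y \<omega> > z})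
    \<longlongrightarrow> \<alpha> * (a * b * beta_integral k l)) at_top"
proof -
  note [measurable] = upper_tailD(1)[OF X] upper_tailD(1)[OF Y]
  define F where "F t = prob {\<omega>\<in>space M. X \<omega> > exp t}" for t
  define G where "G t = prob {\<omega>\<in>space M. Y \<omega> > exp t}" for t
  define H where "H s = prob {\<omega>\<in>space M. 0 < X \<omega> \<and> 0 < Y \<omega> \<and> X \<omega> * Y \<omega> > exp s}" for s
  define L where "L s \<omega> = (if 0 < X \<omega> \<and> 0 < Y \<omega> then max 0 (ln (X \<omega>) + ln (Y \<omega>) - s) else 0)" for s \<omega>
  define Q where "Q s = (LINT t|lborel. F t * G (s - t))" for s
  have "antimono F" "antimono G"
  proof -
    have "{\<omega>\<in>space M. X \<omega> > exp t} \<subseteq> {\<omega>\<in>space M. X \<omega> > exp s}"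
      "{\<omega>\<in>space M. Y \<omega> > exp t} \<subseteq> {\<omega>\<in>space M. Y \<omega> > exp s}" if "s \<le> t" for s t :: real
    proof -
      have "exp s \<le> exp t" using that by simp
      then show "{\<omega>\<in>space M. X \<omega> > exp t} \<subseteq> {\<omega>\<in>space M. X \<omega> > exp s}"
        "{\<omega>\<in>space M. Y \<omega> > exp t} \<subseteq> {\<omega>\<in>space M. Y \<omega> > exp s}"
        by (auto intro: le_less_trans[OF \<open>exp s \<le> exp t\<close>])
    qed
    then show "antimono F" "antimono G"
      unfolding F_def G_def by (intro antimonoI finite_measure_mono; simp)+
  qed
  have [measurable]: "F \<in> borel_measurable borel" "G \<in> borel_measurable borel"
  proof -
    have "(\<lambda>t. - F t) \<in> borel_measurable borel" "(\<lambda>t. - G t) \<in> borel_measurable borel"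
      using antimonoD[OF \<open>antimono F\<close>] antimonoD[OF \<open>antimono G\<close>]
      by (intro borel_measurable_mono monoI; simp)+
    then show "F \<in> borel_measurable borel" "G \<in> borel_measurable borel"
      by (simp_all add: borel_measurable_uminus_eq)
  qed
  have F01: "0 \<le> F t" "F t \<le> 1" "0 \<le> G t" "G t \<le> 1" for t by (simp_all add: F_def G_def)
  have exp_lim: "filterlim (exp :: real \<Rightarrow> real) at_top at_top" by (rule exp_at_top)
  have limF: "((\<lambda>t. exp (\<alpha> * t) * t powr (- k) * F t) \<longlongrightarrow> a) at_top"
    using filterlim_compose[OF upper_tailD(2)[OF X] exp_lim] by (simp add: rate_def exp_powr_real F_def mult.commute[of _ \<alpha>])
  have limG: "((\<lambda>t. exp (\<alpha> * t) * t powr (- l) * G t) \<longlongrightarrow> b) at_top"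
    using filterlim_compose[OF upper_tailD(2)[OF Y] exp_lim] by (simp add: rate_def exp_powr_real G_def mult.commute[of _ \<alpha>])
  note conv = log_tail_convolution[OF _ _ F01 limF limG \<alpha> k l]
  have L: "integrable M (L s)" "expectation (L s) = Q s" if "1 \<le> s" for s
    using excess_eq_convolution[OF indep conv(2)[OF _ _ that, unfolded F_def G_def]]
    unfolding L_def [abs_def] Q_def F_def [abs_def] G_def [abs_def] by measurable
  have exceed: "X \<omega> * Y \<omega> > exp s \<longleftrightarrow> ln (X \<omega>) + ln (Y \<omega>) > s" if "0 < X \<omega>" "0 < Y \<omega>" for \<omega> s
  proof -
    have "ln (X \<omega>) + ln (Y \<omega>) = ln (X \<omega> * Y \<omega>)" using that by (simp add: ln_mult)
    then show ?thesis using that by (metis exp_less_cancel_iff exp_ln mult_pos_pos)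
  qed
  have ind: "expectation (\<lambda>\<omega>. \<delta> * indicator {\<omega>\<in>space M. 0 < X \<omega> \<and> 0 < Y \<omega> \<and> X \<omega> * Y \<omega> > exp s} \<omega>) = \<delta> * H s" for s \<delta> :: real
    unfolding H_def by (subst integral_mult_right_zero) simp
  have ind_int: "integrable M (\<lambda>\<omega>. \<delta> * indicator {\<omega>\<in>space M. 0 < X \<omega> \<and> 0 < Y \<omega> \<and> X \<omega> * Y \<omega> > exp s} \<omega>)" for s \<delta> :: real
    by (rule integrable_const_bound[where B="\<bar>\<delta>\<bar>"]) (auto simp: indicator_def)
  have pointwise: "\<delta> * indicator {\<omega>\<in>space M. 0 < X \<omega> \<and> 0 < Y \<omega> \<and> X \<omega> * Y \<omega> > exp s} \<omega> \<le> L (s - \<delta>) \<omega> - L s \<omega>"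
    "L s \<omega> - L (s + \<delta>) \<omega> \<le> \<delta> * indicator {\<omega>\<in>space M. 0 < X \<omega> \<and> 0 < Y \<omega> \<and> X \<omega> * Y \<omega> > exp s} \<omega>"
    if "0 < \<delta>" "\<omega> \<in> space M" for s \<delta> :: real and \<omega>
  proof -
    define x where "x = ln (X \<omega>) + ln (Y \<omega>)"
    have "\<delta> * (if s < x then 1 else 0) \<le> max 0 (x - (s - \<delta>)) - max 0 (x - s)"
      "max 0 (x - s) - max 0 (x - (s + \<delta>)) \<le> \<delta> * (if s < x then 1 else 0)"
      using that by (auto simp: max_def)
    then show "\<delta> * indicator {\<omega>\<in>space M. 0 < X \<omega> \<and> 0 < Y \<omega> \<and> X \<omega> * Y \<omega> > exp s} \<omega> \<le> L (s - \<delta>) \<omega> - L s \<omega>"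
      "L s \<omega> - L (s + \<delta>) \<omega> \<le> \<delta> * indicator {\<omega>\<in>space M. 0 < X \<omega> \<and> 0 < Y \<omega> \<and> X \<omega> * Y \<omega> > exp s} \<omega>"
      using that exceed[of \<omega> s] unfolding L_def x_def[symmetric] indicator_def by auto
  qed
  have up: "\<delta> * H s \<le> Q (s - \<delta>) - Q s" if "0 < \<delta>" "1 + \<delta> \<le> s" for s \<delta>
  proof -
    have s: "1 \<le> s" "1 \<le> s - \<delta>" using that by auto
    have "\<delta> * H s \<le> expectation (\<lambda>\<omega>. L (s - \<delta>) \<omega> - L s \<omega>)"
      unfolding ind[symmetric] using that
      by (intro integral_mono ind_int Bochner_Integration.integrable_diff L s)
         (auto intro: pointwise)
    then show ?thesis using L s by simp
  qed
  have lo: "Q s - Q (s + \<delta>) \<le> \<delta> * H s" if "0 < \<delta>" "1 \<le> s" for s \<delta>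
  proof -
    have s: "1 \<le> s" "1 \<le> s + \<delta>" using that by auto
    have "expectation (\<lambda>\<omega>. L s \<omega> - L (s + \<delta>) \<omega>) \<le> \<delta> * H s"
      unfolding ind[symmetric] using that
      by (intro integral_mono ind_int Bochner_Integration.integrable_diff L s)
         (auto intro: pointwise)
    then show ?thesis using L s by simp
  qed
  have "((\<lambda>s. exp (\<alpha> * s) * s powr (- (k + l + 1)) * H s) \<longlongrightarrow> \<alpha> * (a * b * beta_integral k l)) at_top"
  proof (rule monotone_density[where H=H and Q=Q, OF \<alpha> _ up lo])
    show "((\<lambda>s. exp (\<alpha> * s) * s powr (- (k + l + 1)) * Q s) \<longlongrightarrow> a * b * beta_integral k l) at_top"
      unfolding Q_def by (rule conv(1)) measurable
  qed
  from filterlim_compose[OF this ln_at_top]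
  have "((\<lambda>z. exp (\<alpha> * ln z) * ln z powr (- (k + l + 1)) * H (ln z)) \<longlongrightarrow> \<alpha> * (a * b * beta_integral k l)) at_top" .
  moreover have "\<forall>\<^sub>F z in at_top. exp (\<alpha> * ln z) * ln z powr (- (k + l + 1)) * H (ln z)
     = rate \<alpha> (k + l + 1) z * prob {\<omega>\<in>space M. 0 < X \<omega> \<and> 0 < Y \<omega> \<and> X \<omega> * Y \<omega> > z}"
    using eventually_gt_at_top[of 0] by eventually_elim (simp add: rate_def H_def powr_def)
  ultimately show ?thesis by (rule Lim_transform_eventually)
qed

text \<open>
  A product exceeds \<open>z \<ge> 0\<close> in exactly two ways, according to the common sign of its factors.
\<close>
lemma (in prob_space) product_upper_tail:
  fixes X Y :: "'a \<Rightarrow> real"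
  assumes X: "upper_tail M X \<alpha> k a" "upper_tail M (\<lambda>\<omega>. - X \<omega>) \<alpha> k a'"
    and Y: "upper_tail M Y \<alpha> l b" "upper_tail M (\<lambda>\<omega>. - Y \<omega>) \<alpha> l b'"
    and indep: "indep_var borel X borel Y"
    and \<alpha>: "0 < \<alpha>" and k: "0 \<le> k" and l: "0 \<le> l"
  shows "upper_tail M (\<lambda>\<omega>. X \<omega> * Y \<omega>) \<alpha> (k + l + 1) (\<alpha> * beta_integral k l * (a * b + a' * b'))"
proof -
  note [measurable] = upper_tailD(1)[OF X(1)] upper_tailD(1)[OF Y(1)]
  have indep': "indep_var borel (\<lambda>\<omega>. - X \<omega>) borel (\<lambda>\<omega>. - Y \<omega>)"
  proof -
    have "indep_var borel (uminus \<circ> X) borel (uminus \<circ> Y)"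
      by (rule indep_var_compose[OF indep]) auto
    then show ?thesis by (simp only: comp_def)
  qed
  have "((\<lambda>z. rate \<alpha> (k + l + 1) z * prob {\<omega>\<in>space M. 0 < X \<omega> \<and> 0 < Y \<omega> \<and> X \<omega> * Y \<omega> > z}
      + rate \<alpha> (k + l + 1) z * prob {\<omega>\<in>space M. 0 < - X \<omega> \<and> 0 < - Y \<omega> \<and> (- X \<omega>) * (- Y \<omega>) > z})
    \<longlongrightarrow> \<alpha> * (a * b * beta_integral k l) + \<alpha> * (a' * b' * beta_integral k l)) at_top"
    by (intro tendsto_add positive_product_tail[OF X(1) Y(1) indep \<alpha> k l]
        positive_product_tail[OF X(2) Y(2) indep' \<alpha> k l])
  moreover have "\<forall>\<^sub>F z in at_top. rate \<alpha> (k + l + 1) z * prob {\<omega>\<in>space M. 0 < X \<omega> \<and> 0 < Y \<omega> \<and> X \<omega> * Y \<omega> > z}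
      + rate \<alpha> (k + l + 1) z * prob {\<omega>\<in>space M. 0 < - X \<omega> \<and> 0 < - Y \<omega> \<and> (- X \<omega>) * (- Y \<omega>) > z}
      = rate \<alpha> (k + l + 1) z * prob {\<omega>\<in>space M. X \<omega> * Y \<omega> > z}"
    using eventually_ge_at_top[of 0]
  proof eventually_elim
    case (elim z)
    have split: "{\<omega>\<in>space M. X \<omega> * Y \<omega> > z} = {\<omega>\<in>space M. 0 < X \<omega> \<and> 0 < Y \<omega> \<and> X \<omega> * Y \<omega> > z}
        \<union> {\<omega>\<in>space M. 0 < - X \<omega> \<and> 0 < - Y \<omega> \<and> (- X \<omega>) * (- Y \<omega>) > z}"
    proof -
      have "z < X \<omega> * Y \<omega> \<longleftrightarrow> 0 < X \<omega> \<and> 0 < Y \<omega> \<and> z < X \<omega> * Y \<omega> \<or>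
          0 < - X \<omega> \<and> 0 < - Y \<omega> \<and> z < (- X \<omega>) * (- Y \<omega>)" for \<omega>
      proof (cases "z < X \<omega> * Y \<omega>")
        case True
        then have "0 < X \<omega> * Y \<omega>" using elim by linarith
        then have "0 < X \<omega> \<and> 0 < Y \<omega> \<or> X \<omega> < 0 \<and> Y \<omega> < 0" by (simp add: zero_less_mult_iff)
        then show ?thesis using True by simp
      qed simp
      then show ?thesis by blast
    qed
    have "prob {\<omega>\<in>space M. X \<omega> * Y \<omega> > z} = prob {\<omega>\<in>space M. 0 < X \<omega> \<and> 0 < Y \<omega> \<and> X \<omega> * Y \<omega> > z}
        + prob {\<omega>\<in>space M. 0 < - X \<omega> \<and> 0 < - Y \<omega> \<and> (- X \<omega>) * (- Y \<omega>) > z}"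
    unfolding split
    proof (rule finite_measure_Union)
      show "{\<omega>\<in>space M. 0 < X \<omega> \<and> 0 < Y \<omega> \<and> X \<omega> * Y \<omega> > z}
        \<inter> {\<omega>\<in>space M. 0 < - X \<omega> \<and> 0 < - Y \<omega> \<and> (- X \<omega>) * (- Y \<omega>) > z} = {}" by force
    qed measurable
    then show ?case by (simp add: distrib_left)
  qed
  ultimately have "((\<lambda>z. rate \<alpha> (k + l + 1) z * prob {\<omega>\<in>space M. X \<omega> * Y \<omega> > z}) \<longlongrightarrow>
     \<alpha> * (a * b * beta_integral k l) + \<alpha> * (a' * b' * beta_integral k l)) at_top"
    by (rule Lim_transform_eventually)
  moreover have "\<alpha> * (a * b * beta_integral k l) + \<alpha> * (a' * b' * beta_integral k l)
      = \<alpha> * beta_integral k l * (a * b + a' * b')" by (simp add: algebra_simps)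
  ultimately show ?thesis unfolding upper_tail_def by simp
qed

text \<open>
  Each additional factor contributes its own power of the logarithm and one more. Positivity
  survives because the two constants of a product add up to a positive multiple of
  \<open>(a + b) (c + d)\<close>, even if one side of each factor is missing.
\<close>
lemma (in prob_space) prod_two_sided_tail:
  fixes Y :: "'i \<Rightarrow> 'a \<Rightarrow> real"
  assumes "finite J" "J \<noteq> {}" and indep: "indep_vars (\<lambda>_. borel) Y J"
    and \<alpha>: "0 < \<alpha>" and k: "\<And>j. j \<in> J \<Longrightarrow> 0 \<le> k j"
    and tails: "\<And>j. j \<in> J \<Longrightarrow> \<exists>a b. 0 < a + b \<and> upper_tail M (Y j) \<alpha> (k j) a \<and> upper_tail M (\<lambda>\<omega>. - Y j \<omega>) \<alpha> (k j) b"
  shows "\<exists>a b. 0 < a + b \<and> upper_tail M (\<lambda>\<omega>. \<Prod>j\<in>J. Y j \<omega>) \<alpha> (real (card J) - 1 + (\<Sum>j\<in>J. k j)) a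
    \<and> upper_tail M (\<lambda>\<omega>. - (\<Prod>j\<in>J. Y j \<omega>)) \<alpha> (real (card J) - 1 + (\<Sum>j\<in>J. k j)) b"
  using assms(1,2) indep k tails
proof (induction J rule: finite_ne_induct)
  case (singleton j)
  then show ?case by simp
next
  case (insert j J)
  define l where "l = real (card J) - 1 + (\<Sum>j\<in>J. k j)"
  have "1 \<le> real (card J)" using insert.hyps by (simp add: Suc_leI card_gt_0_iff)
  then have l: "0 \<le> l" using insert.prems(2) by (simp add: l_def sum_nonneg)
  obtain a b where ab: "0 < a + b" "upper_tail M (Y j) \<alpha> (k j) a" "upper_tail M (\<lambda>\<omega>. - Y j \<omega>) \<alpha> (k j) b"
    using insert.prems(3)[of j] by auto
  have "\<exists>a b. 0 < a + b \<and> upper_tail M (\<lambda>\<omega>. \<Prod>j\<in>J. Y j \<omega>) \<alpha> l a \<and> upper_tail M (\<lambda>\<omega>. - (\<Prod>j\<in>J. Y j \<omega>)) \<alpha> l b"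
    unfolding l_def using insert.prems by (intro insert.IH indep_vars_subset[OF insert.prems(1)]) auto
  then obtain c d where cd: "0 < c + d" "upper_tail M (\<lambda>\<omega>. \<Prod>j\<in>J. Y j \<omega>) \<alpha> l c"
      "upper_tail M (\<lambda>\<omega>. - (\<Prod>j\<in>J. Y j \<omega>)) \<alpha> l d" by auto
  have ind: "indep_var borel (Y j) borel (\<lambda>\<omega>. \<Prod>j\<in>J. Y j \<omega>)"
    using insert by (intro indep_vars_prod) auto
  have ind': "indep_var borel (Y j) borel (\<lambda>\<omega>. - (\<Prod>j\<in>J. Y j \<omega>))"
  proof -
    have "indep_var borel ((\<lambda>x. x) \<circ> Y j) borel (uminus \<circ> (\<lambda>\<omega>. \<Prod>j\<in>J. Y j \<omega>))"
      by (rule indep_var_compose[OF ind]) auto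
    then show ?thesis by (simp only: comp_def)
  qed
  have kj: "0 \<le> k j" using insert.prems(2) by simp
  define D where "D = \<alpha> * beta_integral (k j) l"
  have D: "0 < D" using \<alpha> beta_integral_pos[OF kj l] by (simp add: D_def)
  have 1: "upper_tail M (\<lambda>\<omega>. Y j \<omega> * (\<Prod>j\<in>J. Y j \<omega>)) \<alpha> (k j + l + 1) (D * (a * c + b * d))"
    unfolding D_def by (rule product_upper_tail[OF ab(2,3) cd(2,3) ind \<alpha> kj l])
  have "upper_tail M (\<lambda>\<omega>. - (- (\<Prod>j\<in>J. Y j \<omega>))) \<alpha> l c" using cd by simp
  then have 2: "upper_tail M (\<lambda>\<omega>. Y j \<omega> * (- (\<Prod>j\<in>J. Y j \<omega>))) \<alpha> (k j + l + 1) (D * (a * d + b * c))"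
    unfolding D_def by (rule product_upper_tail[OF ab(2,3) cd(3) _ ind' \<alpha> kj l])
  have "D * (a * c + b * d) + D * (a * d + b * c) = D * ((a + b) * (c + d))" by (simp add: algebra_simps)
  then have "0 < D * (a * c + b * d) + D * (a * d + b * c)" using D ab(1) cd(1) by simp
  moreover have idx: "real (card (insert j J)) - 1 + (\<Sum>j\<in>insert j J. k j) = k j + l + 1"
    using insert.hyps by (simp add: l_def)
  ultimately have "0 < D * (a * c + b * d) + D * (a * d + b * c)
    \<and> upper_tail M (\<lambda>\<omega>. \<Prod>j\<in>insert j J. Y j \<omega>) \<alpha> (real (card (insert j J)) - 1 + (\<Sum>j\<in>insert j J. k j)) (D * (a * c + b * d))
    \<and> upper_tail M (\<lambda>\<omega>. - (\<Prod>j\<in>insert j J. Y j \<omega>)) \<alpha> (real (card (insert j J)) - 1 + (\<Sum>j\<in>insert j J. k j)) (D * (a * d + b * c))"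
    unfolding idx using 1 2 insert.hyps by simp
  then show ?case by blast
qed

section \<open>Powers and moments\<close>

text \<open>
  As \<open>0 powr 0 = 0\<close>, the exponent \<open>0\<close> has to be treated separately in order to agree with \<open>x ^ 0 = 1\<close>.
\<close>
definition abs_pow :: "real \<Rightarrow> real \<Rightarrow> real" where
  "abs_pow x \<tau> = (if \<tau> = 0 then 1 else \<bar>x\<bar> powr \<tau>)"

lemma abs_pow_nonneg [simp]: "0 \<le> abs_pow x \<tau>"
  by (simp add: abs_pow_def)

lemma borel_measurable_abs_pow [measurable (raw)]:
  "f \<in> borel_measurable N \<Longrightarrow> (\<lambda>\<omega>. abs_pow (f \<omega>) \<tau>) \<in> borel_measurable N"
  by (cases "\<tau> = 0") (simp_all add: abs_pow_def)

lemma abs_pow_of_nat: "abs_pow x (real n) = \<bar>x\<bar> ^ n"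
  by (cases "x = 0") (auto simp: abs_pow_def powr_realpow)

lemma abs_pow_powr: "abs_pow x \<tau> powr p = abs_pow x (\<tau> * p)" if "p \<noteq> 0"
  using that by (simp add: abs_pow_def powr_powr)

lemma abs_pow_add: "0 \<le> s \<Longrightarrow> 0 \<le> t \<Longrightarrow> abs_pow x s * abs_pow x t = abs_pow x (s + t)"
  by (simp add: abs_pow_def powr_add add_nonneg_eq_0_iff)

text \<open>
  Taking a root \<open>y = z powr (1 / \<tau>)\<close> turns index \<open>\<tau> \<alpha>\<close> into \<open>\<alpha>\<close>; the factor \<open>\<tau> powr (- k)\<close> comes from
  \<open>ln z = \<tau> ln y\<close>.
\<close>
lemma rate_root_limit:
  assumes lim: "((\<lambda>y. rate (\<tau> * \<alpha>) k y * f y) \<longlongrightarrow> c) at_top" and \<tau>: "0 < \<tau>"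
  shows "((\<lambda>z. rate \<alpha> k z * f (z powr (1 / \<tau>))) \<longlongrightarrow> \<tau> powr (- k) * c) at_top"
proof -
  have "filterlim (\<lambda>z :: real. z powr (1 / \<tau>)) at_top at_top" using \<tau> by real_asymp
  from filterlim_compose[OF lim this]
  have "((\<lambda>z. \<tau> powr (- k) * (rate (\<tau> * \<alpha>) k (z powr (1 / \<tau>)) * f (z powr (1 / \<tau>)))) \<longlongrightarrow> \<tau> powr (- k) * c) at_top"
    by (intro tendsto_intros)
  moreover have "\<forall>\<^sub>F z in at_top. \<tau> powr (- k) * (rate (\<tau> * \<alpha>) k (z powr (1 / \<tau>)) * f (z powr (1 / \<tau>)))
      = rate \<alpha> k z * f (z powr (1 / \<tau>))"
    using eventually_gt_at_top[of 1]
  proof eventually_elim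
    case (elim z)
    have "ln z powr (- k) = (\<tau> * (ln z / \<tau>)) powr (- k)" using \<tau> by simp
    also have "\<dots> = \<tau> powr (- k) * (ln z / \<tau>) powr (- k)" by (rule powr_mult)
    finally show ?case using elim \<tau> by (simp add: rate_def powr_powr ln_powr)
  qed
  ultimately show ?thesis by (rule Lim_transform_eventually)
qed

lemma (in prob_space) abs_upper_tail:
  assumes up: "upper_tail M X \<alpha> k a" and lo: "upper_tail M (\<lambda>\<omega>. - X \<omega>) \<alpha> k b"
  shows "((\<lambda>y. rate \<alpha> k y * prob {\<omega>\<in>space M. \<bar>X \<omega>\<bar> > y}) \<longlongrightarrow> a + b) at_top"
proof -
  note [measurable] = upper_tailD(1)[OF up]
  have "\<forall>\<^sub>F y in at_top. rate \<alpha> k y * prob {\<omega>\<in>space M. X \<omega> > y} + rate \<alpha> k y * prob {\<omega>\<in>space M. - X \<omega> > y}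
      = rate \<alpha> k y * prob {\<omega>\<in>space M. \<bar>X \<omega>\<bar> > y}"
    using eventually_ge_at_top[of 0]
  proof eventually_elim
    case (elim y)
    have "{\<omega>\<in>space M. \<bar>X \<omega>\<bar> > y} = {\<omega>\<in>space M. X \<omega> > y} \<union> {\<omega>\<in>space M. - X \<omega> > y}" by auto
    moreover have "prob ({\<omega>\<in>space M. X \<omega> > y} \<union> {\<omega>\<in>space M. - X \<omega> > y})
        = prob {\<omega>\<in>space M. X \<omega> > y} + prob {\<omega>\<in>space M. - X \<omega> > y}"
      using elim by (intro finite_measure_Union) auto
    ultimately show ?case by (simp add: distrib_left)
  qed
  with tendsto_add[OF upper_tailD(2)[OF up] upper_tailD(2)[OF lo]] show ?thesis
    by (rule Lim_transform_eventually)
qed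

lemma (in prob_space) abs_powr_tails:
  assumes up: "upper_tail M X (\<tau> * \<alpha>) k a" and lo: "upper_tail M (\<lambda>\<omega>. - X \<omega>) (\<tau> * \<alpha>) k b"
    and \<tau>: "0 < \<tau>"
  shows "upper_tail M (\<lambda>\<omega>. abs_pow (X \<omega>) \<tau>) \<alpha> k (\<tau> powr (- k) * (a + b))"
    "upper_tail M (\<lambda>\<omega>. - abs_pow (X \<omega>) \<tau>) \<alpha> k 0"
proof -
  note [measurable] = upper_tailD(1)[OF up]
  have iff: "abs_pow x \<tau> > z \<longleftrightarrow> \<bar>x\<bar> > z powr (1 / \<tau>)" if "0 < z" for x z
  proof -
    have "z = (z powr (1 / \<tau>)) powr \<tau>" using that \<tau> by (simp add: powr_powr)
    then show ?thesis using powr_less_iff_base[of "z powr (1 / \<tau>)" "\<bar>x\<bar>" \<tau>] \<tau> by (simp add: abs_pow_def)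
  qed
  have "\<forall>\<^sub>F z in at_top. rate \<alpha> k z * prob {\<omega>\<in>space M. \<bar>X \<omega>\<bar> > z powr (1 / \<tau>)}
      = rate \<alpha> k z * prob {\<omega>\<in>space M. abs_pow (X \<omega>) \<tau> > z}"
    using eventually_gt_at_top[of 0] by eventually_elim (simp add: iff)
  from Lim_transform_eventually[OF rate_root_limit[OF abs_upper_tail[OF up lo] \<tau>] this]
  show "upper_tail M (\<lambda>\<omega>. abs_pow (X \<omega>) \<tau>) \<alpha> k (\<tau> powr (- k) * (a + b))"
    by (simp add: upper_tail_def)
  have "\<forall>\<^sub>F z in at_top. rate \<alpha> k z * prob {\<omega>\<in>space M. - abs_pow (X \<omega>) \<tau> > z} = 0"
    using eventually_gt_at_top[of 0]
  proof eventually_elim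
    case (elim z)
    have "\<not> z < - abs_pow x \<tau>" for x using elim abs_pow_nonneg[of x \<tau>] by linarith
    then show ?case by simp
  qed
  then show "upper_tail M (\<lambda>\<omega>. - abs_pow (X \<omega>) \<tau>) \<alpha> k 0"
    by (simp add: upper_tail_def tendsto_eventually)
qed

text \<open>
  An even power merges both tails into the positive one, an odd power keeps them apart; in both cases
  some mass remains.
\<close>
lemma (in prob_space) power_tails:
  assumes up: "upper_tail M X (real n * \<alpha>) k a" and lo: "upper_tail M (\<lambda>\<omega>. - X \<omega>) (real n * \<alpha>) k b"
    and n: "0 < n" and ab: "0 < a + b"
  shows "\<exists>a b. 0 < a + b \<and> upper_tail M (\<lambda>\<omega>. X \<omega> ^ n) \<alpha> k a \<and> upper_tail M (\<lambda>\<omega>. - (X \<omega> ^ n)) \<alpha> k b"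
proof (cases "even n")
  case True
  then have "X \<omega> ^ n = abs_pow (X \<omega>) (real n)" for \<omega>
    by (simp add: abs_pow_of_nat power_even_abs)
  then have "upper_tail M (\<lambda>\<omega>. X \<omega> ^ n) \<alpha> k (real n powr (- k) * (a + b)) \<and> upper_tail M (\<lambda>\<omega>. - (X \<omega> ^ n)) \<alpha> k 0"
    using abs_powr_tails[OF up lo] n by simp
  moreover have "0 < real n powr (- k) * (a + b) + 0" using n ab by simp
  ultimately show ?thesis by blast
next
  case False
  note [measurable] = upper_tailD(1)[OF up]
  have iff: "x ^ n > z \<longleftrightarrow> x > z powr (1 / real n)" if "0 < z" for x z :: real
  proof -
    have "z = (z powr (1 / real n)) powr real n" using that n by (simp add: powr_powr)
    also have "\<dots> = (z powr (1 / real n)) ^ n" using that by (simp add: powr_realpow)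
    finally have z: "z = (z powr (1 / real n)) ^ n" .
    have "0 \<le> z powr (1 / real n)" by simp
    then have "x ^ n > (z powr (1 / real n)) ^ n \<longleftrightarrow> x > z powr (1 / real n)"
      using power_mono_odd[of n x "z powr (1 / real n)"] power_strict_mono[of "z powr (1 / real n)" x n] False n
      by (meson not_le)
    then show ?thesis using z by simp
  qed
  have 1: "\<forall>\<^sub>F z in at_top. rate \<alpha> k z * prob {\<omega>\<in>space M. X \<omega> > z powr (1 / real n)}
      = rate \<alpha> k z * prob {\<omega>\<in>space M. X \<omega> ^ n > z}"
    using eventually_gt_at_top[of 0] by eventually_elim (simp add: iff)
  have 2: "\<forall>\<^sub>F z in at_top. rate \<alpha> k z * prob {\<omega>\<in>space M. - X \<omega> > z powr (1 / real n)}
      = rate \<alpha> k z * prob {\<omega>\<in>space M. - (X \<omega> ^ n) > z}"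
    using eventually_gt_at_top[of 0] by eventually_elim (use False in \<open>simp add: iff flip: power_minus_odd\<close>)
  have n': "0 < real n" using n by simp
  have "upper_tail M (\<lambda>\<omega>. X \<omega> ^ n) \<alpha> k (real n powr (- k) * a)"
    "upper_tail M (\<lambda>\<omega>. - (X \<omega> ^ n)) \<alpha> k (real n powr (- k) * b)"
    using Lim_transform_eventually[OF rate_root_limit[OF upper_tailD(2)[OF up] n'] 1]
      Lim_transform_eventually[OF rate_root_limit[OF upper_tailD(2)[OF lo] n'] 2]
    by (simp_all add: upper_tail_def)
  moreover have "0 < real n powr (- k) * a + real n powr (- k) * b"
    using n ab by (simp flip: distrib_left)
  ultimately show ?thesis by blast
qed

text \<open>
  The mean is at most the sum of the probabilities of \<open>Y > n\<close>.
\<close>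
lemma (in prob_space) integrable_of_tail:
  assumes [measurable]: "Y \<in> borel_measurable M" and Y: "\<And>\<omega>. 0 \<le> Y \<omega>"
    and tail: "\<forall>\<^sub>F y in at_top. prob {\<omega>\<in>space M. Y \<omega> > y} \<le> y powr (- \<gamma>)" and \<gamma>: "1 < \<gamma>"
  shows "integrable M Y"
proof (rule integrableI_nonneg)
  have "summable (\<lambda>n. real n powr (- \<gamma>))" using \<gamma> by (simp add: summable_real_powr_iff)
  moreover have "\<forall>\<^sub>F n in sequentially. norm (prob {\<omega>\<in>space M. Y \<omega> > real n}) \<le> real n powr (- \<gamma>)"
    using filterlim_iff[THEN iffD1, OF filterlim_real_sequentially, rule_format, OF tail] by simp
  ultimately have summ: "summable (\<lambda>n. prob {\<omega>\<in>space M. Y \<omega> > real n})"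
    by (rule summable_comparison_test_ev[rotated])
  have "ennreal (Y \<omega>) \<le> (\<Sum>n. indicator {\<omega>\<in>space M. Y \<omega> > real n} \<omega>)" if \<omega>: "\<omega> \<in> space M" for \<omega>
  proof -
    define N where "N = nat \<lceil>Y \<omega>\<rceil>"
    have "Y \<omega> \<le> real N" unfolding N_def by (rule real_nat_ceiling_ge)
    then have "ennreal (Y \<omega>) \<le> ennreal (real N)" by (rule ennreal_leI)
    also have "\<dots> = (\<Sum>n<N. 1)" by (simp add: ennreal_of_nat_eq_real_of_nat)
    also have "\<dots> = (\<Sum>n<N. indicator {\<omega>\<in>space M. Y \<omega> > real n} \<omega>)"
    proof (intro sum.cong refl)
      fix n assume "n \<in> {..<N}"
      then have "int n < \<lceil>Y \<omega>\<rceil>" by (simp add: N_def)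
      then have "real n < Y \<omega>" by (simp add: less_ceiling_iff)
      then show "1 = (indicator {\<omega>\<in>space M. Y \<omega> > real n} \<omega> :: ennreal)" using \<omega> by simp
    qed
    also have "\<dots> \<le> (\<Sum>n. indicator {\<omega>\<in>space M. Y \<omega> > real n} \<omega>)"
      by (rule sum_le_suminf) auto
    finally show ?thesis .
  qed
  then have "(\<integral>\<^sup>+\<omega>. ennreal (Y \<omega>) \<partial>M) \<le> (\<integral>\<^sup>+\<omega>. (\<Sum>n. indicator {\<omega>\<in>space M. Y \<omega> > real n} \<omega>) \<partial>M)"
    by (intro nn_integral_mono) auto
  also have "\<dots> = (\<Sum>n. \<integral>\<^sup>+\<omega>. indicator {\<omega>\<in>space M. Y \<omega> > real n} \<omega> \<partial>M)"
    by (rule nn_integral_suminf) measurable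
  also have "\<dots> = (\<Sum>n. ennreal (prob {\<omega>\<in>space M. Y \<omega> > real n}))"
    by (simp add: emeasure_eq_measure)
  also have "\<dots> = ennreal (\<Sum>n. prob {\<omega>\<in>space M. Y \<omega> > real n})"
    by (rule suminf_ennreal2[OF _ summ]) simp
  finally show "(\<integral>\<^sup>+\<omega>. ennreal (Y \<omega>) \<partial>M) < \<infinity>" by (simp add: le_less_trans)
qed (use Y in auto)

text \<open>
  An exponent strictly between \<open>1\<close> and \<open>\<alpha> / p\<close> leaves room to absorb the logarithm.
\<close>
lemma (in prob_space) abs_pow_integrable:
  assumes up: "upper_tail M X \<alpha> k a" and lo: "upper_tail M (\<lambda>\<omega>. - X \<omega>) \<alpha> k b"
    and p: "0 \<le> p" "p < \<alpha>"
  shows "integrable M (\<lambda>\<omega>. abs_pow (X \<omega>) p)"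
proof (cases "p = 0")
  case True then show ?thesis by (simp add: abs_pow_def)
next
  case False
  then have p0: "0 < p" using p by simp
  have "1 < \<alpha> / p" using p p0 by simp
  then obtain \<gamma> where \<gamma>: "1 < \<gamma>" and \<gamma>': "\<gamma> < \<alpha> / p" using dense by blast
  have "p * (\<alpha> / p) = \<alpha>" using p0 by simp
  then have tail: "upper_tail M (\<lambda>\<omega>. abs_pow (X \<omega>) p) (\<alpha> / p) k (p powr (- k) * (a + b))"
    using abs_powr_tails(1)[of X p "\<alpha> / p" k a b] up lo p0 by simp
  show ?thesis
  proof (rule integrable_of_tail[OF upper_tailD(1)[OF tail] _ _ \<gamma>])
    define c where "c = p powr (- k) * (a + b) + 1"
    have "\<forall>\<^sub>F y in at_top. rate (\<alpha> / p) k y * prob {\<omega>\<in>space M. abs_pow (X \<omega>) p > y} < c"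
      by (rule order_tendstoD(2)[OF upper_tailD(2)[OF tail]]) (simp add: c_def)
    moreover have "filterlim (rate (\<alpha> / p - \<gamma>) k) at_top at_top" using \<gamma>' by (intro rate_at_top) simp
    then have "\<forall>\<^sub>F y in at_top. max c 1 \<le> rate (\<alpha> / p - \<gamma>) k y" unfolding filterlim_at_top by blast
    ultimately show "\<forall>\<^sub>F y in at_top. prob {\<omega>\<in>space M. abs_pow (X \<omega>) p > y} \<le> y powr (- \<gamma>)"
      using eventually_gt_at_top[of 1]
    proof eventually_elim
      case (elim y)
      let ?P = "prob {\<omega>\<in>space M. abs_pow (X \<omega>) p > y}"
      have "rate (\<alpha> / p) k y = y powr \<gamma> * rate (\<alpha> / p - \<gamma>) k y"
        using elim by (simp add: rate_def powr_diff)
      then have "rate (\<alpha> / p - \<gamma>) k y * (y powr \<gamma> * ?P) = rate (\<alpha> / p) k y * ?P" by simp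
      also have "\<dots> < rate (\<alpha> / p - \<gamma>) k y * 1" using elim by linarith
      finally have "y powr \<gamma> * ?P < 1"
        by (subst (asm) mult_less_cancel_left_pos) (use rate_pos elim in auto)
      then show ?case using elim by (simp add: powr_minus field_simps)
    qed
  qed simp
qed

lemma (in prob_space) indep_block_functions:
  fixes X :: "'i \<Rightarrow> 'a \<Rightarrow> real"
  assumes indep: "indep_vars (\<lambda>_. borel) X UNIV" and "A \<inter> B = {}"
    and f: "f \<in> borel_measurable (PiM A (\<lambda>_. borel))" and g: "g \<in> borel_measurable (PiM B (\<lambda>_. borel))"
  shows "distr M borel (\<lambda>\<omega>. f (restrict (\<lambda>i. X i \<omega>) A)) \<Otimes>\<^sub>M distr M borel (\<lambda>\<omega>. g (restrict (\<lambda>i. X i \<omega>) B))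
    = distr M (borel \<Otimes>\<^sub>M borel) (\<lambda>\<omega>. (f (restrict (\<lambda>i. X i \<omega>) A), g (restrict (\<lambda>i. X i \<omega>) B)))"
proof -
  let ?SA = "PiM A (\<lambda>_. borel) :: ('i \<Rightarrow> real) measure" and ?SB = "PiM B (\<lambda>_. borel) :: ('i \<Rightarrow> real) measure"
  let ?A = "\<lambda>\<omega>. restrict (\<lambda>i. X i \<omega>) A" and ?B = "\<lambda>\<omega>. restrict (\<lambda>i. X i \<omega>) B"
  have "indep_var ?SA ?A ?SB ?B"
    by (rule indep_var_restrict[OF indep]) (use assms in auto)
  then have m[measurable]: "?A \<in> measurable M ?SA" "?B \<in> measurable M ?SB"
    and joint: "distr M ?SA ?A \<Otimes>\<^sub>M distr M ?SB ?B = distr M (?SA \<Otimes>\<^sub>M ?SB) (\<lambda>\<omega>. (?A \<omega>, ?B \<omega>))"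
    unfolding indep_var_distribution_eq by auto
  interpret PB: prob_space "distr M ?SB ?B" by (rule prob_space_distr) simp
  interpret PG: prob_space "distr (distr M ?SB ?B) borel g" by (rule PB.prob_space_distr) (use g in simp)
  have "distr M borel (\<lambda>\<omega>. f (?A \<omega>)) \<Otimes>\<^sub>M distr M borel (\<lambda>\<omega>. g (?B \<omega>))
      = distr (distr M ?SA ?A) borel f \<Otimes>\<^sub>M distr (distr M ?SB ?B) borel g"
    using f g by (simp add: distr_distr comp_def)
  also have "\<dots> = distr (distr M ?SA ?A \<Otimes>\<^sub>M distr M ?SB ?B) (borel \<Otimes>\<^sub>M borel) (\<lambda>(x, y). (f x, g y))"
    using f g by (intro pair_measure_distr) (auto intro: PG.sigma_finite_measure_axioms)
  also have "\<dots> = distr M (borel \<Otimes>\<^sub>M borel) (\<lambda>\<omega>. (f (?A \<omega>), g (?B \<omega>)))"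
    unfolding joint using f g by (subst distr_distr) (auto simp: comp_def)
  finally show ?thesis .
qed

section \<open>Monomials in independent heavy-tailed variables\<close>

lemma trunc_sq_le_powr:
  assumes "0 \<le> y" "0 < \<alpha>" "\<alpha> \<le> 2"
  shows "trunc_sq y \<le> y powr \<alpha>"
proof (cases "y \<le> 1")
  case True
  show ?thesis
  proof (cases "y = 0")
    case False
    then have "y\<^sup>2 = y powr 2" using assms by (simp add: powr_numeral)
    also have "\<dots> \<le> y powr \<alpha>" using True False assms by (intro powr_mono') auto
    finally show ?thesis using trunc_sq_le_sq[of y] by simp
  qed simp
next
  case False
  then have "1 \<le> y powr \<alpha>" using assms by (simp add: ge_one_powr_ge_zero)
  then show ?thesis using trunc_sq_le_one[of y] by linarith
qed

text \<open>
  The index \<open>\<alpha>s\<close> is the one in which everything is measured; it stands for \<open>\<alpha>\<^sub>*\<close>. Exponents are real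
  here because geometric means of monomials occur later.
\<close>
locale heavy_tails = prob_space M for M :: "'w measure" +
  fixes X :: "'l::finite \<Rightarrow> 'w \<Rightarrow> real" and \<alpha> k c_plus c_minus :: "'l \<Rightarrow> real" and \<alpha>s :: real
  assumes indep: "indep_vars (\<lambda>_. borel) X UNIV"
    and \<alpha>_pos: "\<And>j. 0 < \<alpha> j"
    and k_nonneg: "\<And>j. 0 \<le> k j"
    and c_pos: "\<And>j. 0 < c_plus j + c_minus j"
    and tail_plus: "\<And>j. upper_tail M (X j) (\<alpha> j) (k j) (c_plus j)"
    and tail_minus: "\<And>j. upper_tail M (\<lambda>\<omega>. - X j \<omega>) (\<alpha> j) (k j) (c_minus j)"
    and \<alpha>s: "0 < \<alpha>s" "\<alpha>s < 2"
begin

text \<open>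
  The factors \<open>\<bar>X\<^sub>j\<bar>\<^bsup>\<tau> j\<^esup>\<close> of tail index exactly \<open>\<alpha>s\<close>: the set \<open>J(\<theta>)\<close> if \<open>\<tau>\<close> is a multi-index \<open>\<theta>\<close> with
  \<open>\<alpha>(\<theta>) = \<alpha>s\<close>, and empty if \<open>\<alpha>(\<theta>) > \<alpha>s\<close>.
\<close>
definition crit :: "('l \<Rightarrow> real) \<Rightarrow> 'l set" where
  "crit \<tau> = {j. \<tau> j * \<alpha>s = \<alpha> j}"

text \<open>
  The power \<open>k(\<theta>)\<close> of the logarithm that a critical set produces. The empty set has weight \<open>- 1\<close>, below
  every relevant \<open>k\<close>, so that the one inequality \<open>weight (crit \<tau>) < K\<close> also covers monomials of a
  lighter tail index.
\<close>
definition weight :: "'l set \<Rightarrow> real" where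
  "weight J = real (card J) - 1 + (\<Sum>j\<in>J. k j)"

definition abs_monomial :: "('l \<Rightarrow> real) \<Rightarrow> 'w \<Rightarrow> real" where
  "abs_monomial \<tau> \<omega> = (\<Prod>j\<in>UNIV. abs_pow (X j \<omega>) (\<tau> j))"

lemma X_measurable [measurable]: "X j \<in> borel_measurable M"
  using tail_plus upper_tailD(1) by blast

lemma weight_nonneg: "J \<noteq> {} \<Longrightarrow> 0 \<le> weight J"
proof -
  assume "J \<noteq> {}"
  then have "1 \<le> real (card J)" by (simp add: Suc_leI card_gt_0_iff)
  then show ?thesis using k_nonneg by (simp add: weight_def sum_nonneg)
qed

text \<open>
  Strict because of the cardinality, even when the added \<open>k\<^sub>j\<close> vanish. This is what makes all joint
  exceedances negligible.
\<close>
lemma weight_strict_mono: "I \<subset> J \<Longrightarrow> weight I < weight J"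
  using psubset_card_mono[of J I] sum_mono2[of J I k] k_nonneg by (auto simp: weight_def)

lemma abs_monomial_nonneg [simp]: "0 \<le> abs_monomial \<tau> \<omega>"
  by (simp add: abs_monomial_def prod_nonneg)

lemma abs_monomial_measurable [measurable]: "abs_monomial \<tau> \<in> borel_measurable M"
  unfolding abs_monomial_def [abs_def] by measurable

text \<open>
  Subcritical factors are independent and each has a moment of order \<open>\<alpha>s\<close>.
\<close>
lemma abs_block_integrable:
  assumes "\<And>j. j \<in> A \<Longrightarrow> 0 \<le> \<tau> j \<and> \<tau> j * \<alpha>s < \<alpha> j"
  shows "integrable M (\<lambda>\<omega>. (\<Prod>j\<in>A. abs_pow (X j \<omega>) (\<tau> j)) powr \<alpha>s)"
proof -
  have "integrable M (\<lambda>\<omega>. \<Prod>j\<in>A. abs_pow (X j \<omega>) (\<tau> j * \<alpha>s))"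
  proof (rule indep_vars_integrable)
    show "indep_vars (\<lambda>_. borel) (\<lambda>j \<omega>. abs_pow (X j \<omega>) (\<tau> j * \<alpha>s)) A"
      by (rule indep_vars_compose2[OF indep_vars_subset[OF indep]]) auto
    show "integrable M (\<lambda>\<omega>. abs_pow (X j \<omega>) (\<tau> j * \<alpha>s))" if "j \<in> A" for j
      using assms[OF that] \<alpha>s by (intro abs_pow_integrable[OF tail_plus tail_minus]) auto
  qed simp
  then show ?thesis using \<alpha>s by (simp add: prod_powr_distrib abs_pow_powr)
qed

lemma block_independence:
  fixes V :: "('l \<Rightarrow> real) \<Rightarrow> 'b::euclidean_space"
  assumes "A \<inter> B = {}"
    and f: "f \<in> borel_measurable (PiM A (\<lambda>_. borel))" "\<And>x. f (restrict x A) = f x"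
    and V: "V \<in> borel_measurable (PiM B (\<lambda>_. borel))" "\<And>x. V (restrict x B) = V x"
  shows "distr M borel (\<lambda>\<omega>. f (\<lambda>j. X j \<omega>)) \<Otimes>\<^sub>M distr M borel (\<lambda>\<omega>. V (\<lambda>j. X j \<omega>))
    = distr M (borel \<Otimes>\<^sub>M borel) (\<lambda>\<omega>. (f (\<lambda>j. X j \<omega>), V (\<lambda>j. X j \<omega>)))"
  using indep_block_functions[OF indep assms(1) f(1) V(1)] by (simp add: f(2) V(2))

text \<open>
  The product of the critical factors is heavy, the product of the others is independent of it and
  has a moment of order \<open>\<alpha>s\<close>.
\<close>
lemma abs_monomial_limit:
  assumes \<tau>: "\<And>j. 0 \<le> \<tau> j \<and> \<tau> j * \<alpha>s \<le> \<alpha> j" and ne: "crit \<tau> \<noteq> {}"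
  shows "\<exists>L. ((\<lambda>z. rate \<alpha>s (weight (crit \<tau>)) z * expectation (\<lambda>\<omega>. trunc_sq (abs_monomial \<tau> \<omega> / z))) \<longlongrightarrow> L) at_top"
proof -
  define U where "U \<omega> = (\<Prod>j\<in>crit \<tau>. abs_pow (X j \<omega>) (\<tau> j))" for \<omega>
  define V where "V \<omega> = (\<Prod>j\<in>-crit \<tau>. abs_pow (X j \<omega>) (\<tau> j))" for \<omega>
  have split: "abs_monomial \<tau> \<omega> = U \<omega> * V \<omega>" for \<omega>
    unfolding abs_monomial_def U_def V_def
    by (subst prod.union_disjoint[symmetric]) (auto intro: prod.cong)
  have \<tau>_pos: "0 < \<tau> j" if "j \<in> crit \<tau>" for j
    using that \<alpha>_pos[of j] \<tau>[of j] \<alpha>s by (cases "\<tau> j = 0") (auto simp: crit_def)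
  have "\<exists>a b. 0 < a + b \<and> upper_tail M U \<alpha>s (real (card (crit \<tau>)) - 1 + (\<Sum>j\<in>crit \<tau>. k j)) a
    \<and> upper_tail M (\<lambda>\<omega>. - U \<omega>) \<alpha>s (real (card (crit \<tau>)) - 1 + (\<Sum>j\<in>crit \<tau>. k j)) b"
    unfolding U_def
  proof (rule prod_two_sided_tail)
    show "indep_vars (\<lambda>_. borel) (\<lambda>j \<omega>. abs_pow (X j \<omega>) (\<tau> j)) (crit \<tau>)"
      by (rule indep_vars_compose2[OF indep_vars_subset[OF indep]]) auto
    fix j assume j: "j \<in> crit \<tau>"
    then have "\<tau> j * \<alpha>s = \<alpha> j" by (simp add: crit_def)
    then have "upper_tail M (\<lambda>\<omega>. abs_pow (X j \<omega>) (\<tau> j)) \<alpha>s (k j) (\<tau> j powr (- k j) * (c_plus j + c_minus j))"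
      "upper_tail M (\<lambda>\<omega>. - abs_pow (X j \<omega>) (\<tau> j)) \<alpha>s (k j) 0"
      using abs_powr_tails[of "X j" "\<tau> j" \<alpha>s "k j"] tail_plus[of j] tail_minus[of j] \<tau>_pos[OF j] by auto
    moreover have "0 < \<tau> j powr (- k j) * (c_plus j + c_minus j) + 0" using \<tau>_pos[OF j] c_pos[of j] by simp
    ultimately show "\<exists>a b. 0 < a + b \<and> upper_tail M (\<lambda>\<omega>. abs_pow (X j \<omega>) (\<tau> j)) \<alpha>s (k j) a
        \<and> upper_tail M (\<lambda>\<omega>. - abs_pow (X j \<omega>) (\<tau> j)) \<alpha>s (k j) b" by blast
  qed (use ne \<alpha>s k_nonneg in auto)
  then obtain a b where ab: "upper_tail M U \<alpha>s (weight (crit \<tau>)) a" "upper_tail M (\<lambda>\<omega>. - U \<omega>) \<alpha>s (weight (crit \<tau>)) b"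
    unfolding weight_def by blast
  have [measurable]: "V \<in> borel_measurable M" unfolding V_def by measurable
  have joint: "distr M borel U \<Otimes>\<^sub>M distr M borel V = distr M (borel \<Otimes>\<^sub>M borel) (\<lambda>\<omega>. (U \<omega>, V \<omega>))"
    unfolding U_def V_def
    by (rule block_independence[where f="\<lambda>x. \<Prod>j\<in>crit \<tau>. abs_pow (x j) (\<tau> j)"
          and V="\<lambda>x. \<Prod>j\<in>-crit \<tau>. abs_pow (x j) (\<tau> j)" and A="crit \<tau>" and B="- crit \<tau>"])
       (auto intro!: prod.cong borel_measurable_prod borel_measurable_abs_pow measurable_component_singleton)
  have "\<tau> j * \<alpha>s < \<alpha> j" if "j \<in> - crit \<tau>" for j using that \<tau>[of j] by (auto simp: crit_def)
  then have "integrable M (\<lambda>\<omega>. V \<omega> powr \<alpha>s)"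
    unfolding V_def using \<tau> by (intro abs_block_integrable) auto
  then have "integrable M (\<lambda>\<omega>. norm (V \<omega>) powr \<alpha>s)"
    by (simp add: V_def prod_nonneg)
  from breiman_limit[OF ab \<alpha>s weight_nonneg[OF ne] _ joint this trunc_sq_test_function]
  have "\<exists>L. ((\<lambda>z. rate \<alpha>s (weight (crit \<tau>)) z * expectation (\<lambda>\<omega>. trunc_sq ((U \<omega> *\<^sub>R V \<omega>) /\<^sub>R z))) \<longlongrightarrow> L) at_top"
    by auto
  then show ?thesis by (simp add: split divide_inverse mult.commute mult.left_commute)
qed

text \<open>
  If there are critical factors, the true rate has a smaller power of the logarithm. If there are
  none, the monomial has a moment of order \<open>\<alpha>s\<close>, and dominated convergence applies because
  \<open>trunc_sq y \<le> y\<^sup>\<alpha>\<close> for \<open>\<alpha> \<le> 2\<close> and \<open>trunc_sq y \<le> y\<^sup>2\<close>.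
\<close>
lemma abs_monomial_negligible:
  assumes \<tau>: "\<And>j. 0 \<le> \<tau> j \<and> \<tau> j * \<alpha>s \<le> \<alpha> j" and K: "0 \<le> K" "weight (crit \<tau>) < K"
  shows "((\<lambda>z. rate \<alpha>s K z * expectation (\<lambda>\<omega>. trunc_sq (abs_monomial \<tau> \<omega> / z))) \<longlongrightarrow> 0) at_top"
proof (cases "crit \<tau> = {}")
  case False
  define w where "w = weight (crit \<tau>)"
  obtain L where L: "((\<lambda>z. rate \<alpha>s w z * expectation (\<lambda>\<omega>. trunc_sq (abs_monomial \<tau> \<omega> / z))) \<longlongrightarrow> L) at_top"
    using abs_monomial_limit[OF \<tau> False] unfolding w_def by blast
  define d where "d = K - w"
  have "0 < d" using K by (simp add: d_def w_def)
  then have "((\<lambda>z::real. ln z powr (- d)) \<longlongrightarrow> 0) at_top" by real_asymp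
  from tendsto_mult[OF this L]
  have "((\<lambda>z. ln z powr (- d) * (rate \<alpha>s w z * expectation (\<lambda>\<omega>. trunc_sq (abs_monomial \<tau> \<omega> / z)))) \<longlongrightarrow> 0) at_top"
    by simp
  moreover have "ln z powr (- d) * rate \<alpha>s w z = rate \<alpha>s K z" for z
    by (simp add: rate_def d_def powr_add[symmetric] mult.left_commute)
  ultimately show ?thesis by (simp add: mult.assoc[symmetric])
next
  case True
  define V where "V = abs_monomial \<tau>"
  have [measurable]: "V \<in> borel_measurable M" and V0: "0 \<le> V \<omega>" for \<omega> by (simp_all add: V_def)
  have "\<tau> j * \<alpha>s < \<alpha> j" for j using True \<tau>[of j] by (auto simp: crit_def less_le)
  then have int: "integrable M (\<lambda>\<omega>. V \<omega> powr \<alpha>s)"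
    unfolding V_def abs_monomial_def using \<tau> by (intro abs_block_integrable) auto
  have bnd: "rate \<alpha>s K z * trunc_sq (V \<omega> / z) \<le> V \<omega> powr \<alpha>s"
      "rate \<alpha>s K z * trunc_sq (V \<omega> / z) \<le> (V \<omega>)\<^sup>2 * z powr (\<alpha>s - 2)" if z: "exp 1 \<le> z" for z \<omega>
  proof -
    have zp: "0 < z" using z less_le_trans[OF exp_gt_zero] by blast
    have r: "rate \<alpha>s K z \<le> z powr \<alpha>s" by (rule rate_le_powr[OF K(1) z])
    have "rate \<alpha>s K z * trunc_sq (V \<omega> / z) \<le> z powr \<alpha>s * (V \<omega> / z) powr \<alpha>s"
      using r zp V0 \<alpha>s by (intro mult_mono trunc_sq_le_powr) auto
    also have "\<dots> = V \<omega> powr \<alpha>s" using zp V0 by (simp add: powr_divide)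
    finally show "rate \<alpha>s K z * trunc_sq (V \<omega> / z) \<le> V \<omega> powr \<alpha>s" .
    have "rate \<alpha>s K z * trunc_sq (V \<omega> / z) \<le> z powr \<alpha>s * (norm (V \<omega> / z))\<^sup>2"
      using r by (intro mult_mono trunc_sq_le_sq) auto
    also have "\<dots> = (V \<omega>)\<^sup>2 * z powr (\<alpha>s - 2)"
      using zp by (simp add: powr_diff powr_numeral power_divide)
    finally show "rate \<alpha>s K z * trunc_sq (V \<omega> / z) \<le> (V \<omega>)\<^sup>2 * z powr (\<alpha>s - 2)" .
  qed
  have "((\<lambda>z. expectation (\<lambda>\<omega>. rate \<alpha>s K z * trunc_sq (V \<omega> / z))) \<longlongrightarrow> expectation (\<lambda>_. 0)) at_top"
  proof (rule integral_dominated_convergence_at_top[OF _ _ int])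
    have "((\<lambda>z. rate \<alpha>s K z * trunc_sq (V \<omega> / z)) \<longlongrightarrow> 0) at_top" for \<omega>
    proof (rule tendsto_sandwich[where f="\<lambda>_. 0" and h="\<lambda>z. (V \<omega>)\<^sup>2 * z powr (\<alpha>s - 2)"])
      define d where "d = 2 - \<alpha>s"
      have "0 < d" using \<alpha>s by (simp add: d_def)
      then have "((\<lambda>z::real. z powr (- d)) \<longlongrightarrow> 0) at_top" by real_asymp
      from tendsto_mult_right_zero[OF this] show "((\<lambda>z. (V \<omega>)\<^sup>2 * z powr (\<alpha>s - 2)) \<longlongrightarrow> 0) at_top"
        by (simp add: d_def)
      show "\<forall>\<^sub>F z in at_top. rate \<alpha>s K z * trunc_sq (V \<omega> / z) \<le> (V \<omega>)\<^sup>2 * z powr (\<alpha>s - 2)"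
        using eventually_ge_at_top[of "exp 1"] by eventually_elim (rule bnd(2))
    qed (auto simp: rate_nonneg)
    then show "AE \<omega> in M. ((\<lambda>z. rate \<alpha>s K z * trunc_sq (V \<omega> / z)) \<longlongrightarrow> 0) at_top" by simp
    show "\<forall>\<^sub>F z in at_top. AE \<omega> in M. norm (rate \<alpha>s K z * trunc_sq (V \<omega> / z)) \<le> V \<omega> powr \<alpha>s"
      using eventually_ge_at_top[of "exp 1"]
      by eventually_elim (use bnd(1) in \<open>simp add: abs_mult rate_nonneg\<close>)
  qed measurable
  then show ?thesis by (simp add: V_def)
qed

lemma abs_monomial_bounded:
  assumes \<tau>: "\<And>j. 0 \<le> \<tau> j \<and> \<tau> j * \<alpha>s \<le> \<alpha> j" and K: "0 \<le> K" "weight (crit \<tau>) \<le> K"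
  shows "\<exists>B. \<forall>\<^sub>F z in at_top. rate \<alpha>s K z * expectation (\<lambda>\<omega>. trunc_sq (abs_monomial \<tau> \<omega> / z)) \<le> B"
proof -
  have "\<exists>L. ((\<lambda>z. rate \<alpha>s K z * expectation (\<lambda>\<omega>. trunc_sq (abs_monomial \<tau> \<omega> / z))) \<longlongrightarrow> L) at_top"
  proof (cases "weight (crit \<tau>) = K")
    case True
    then have "crit \<tau> \<noteq> {}" using K by (auto simp: weight_def)
    from abs_monomial_limit[OF \<tau> this] show ?thesis using True by simp
  next
    case False
    then show ?thesis using abs_monomial_negligible[OF \<tau> K(1)] K(2) by fastforce
  qed
  then obtain L where "((\<lambda>z. rate \<alpha>s K z * expectation (\<lambda>\<omega>. trunc_sq (abs_monomial \<tau> \<omega> / z))) \<longlongrightarrow> L) at_top" by blast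
  from order_tendstoD(2)[OF this, of "L + 1"]
  have "\<forall>\<^sub>F z in at_top. rate \<alpha>s K z * expectation (\<lambda>\<omega>. trunc_sq (abs_monomial \<tau> \<omega> / z)) \<le> L + 1"
    by (auto elim: eventually_mono)
  then show ?thesis by blast
qed

lemma not_AE_abs_bounded: "\<not> (AE \<omega> in M. \<bar>X j \<omega>\<bar> \<le> y)"
proof
  assume "AE \<omega> in M. \<bar>X j \<omega>\<bar> \<le> y"
  then have zero: "prob {\<omega>\<in>space M. \<bar>X j \<omega>\<bar> > x} = 0" if "y \<le> x" for x
    using that by (subst prob_eq_0) (auto elim: eventually_mono)
  have "\<forall>\<^sub>F x in at_top. 0 < rate (\<alpha> j) (k j) x * prob {\<omega>\<in>space M. \<bar>X j \<omega>\<bar> > x}"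
    by (rule order_tendstoD(1)[OF abs_upper_tail[OF tail_plus tail_minus] c_pos])
  then have "\<forall>\<^sub>F x :: real in at_top. False" using eventually_ge_at_top[of y]
    by eventually_elim (simp add: zero)
  then show False by simp
qed

text \<open>
  The variables outside \<open>A\<close> have been set aside, so monomials that agree on \<open>A\<close> are to be collected.
  In the induction step independence fixes almost every value of \<open>X\<^sub>j\<close>; by the induction hypothesis the
  collected coefficients, which are polynomials in one variable, vanish at these values. They have
  unboundedly many roots and are therefore zero.
\<close>
lemma polynomial_AE_zero_partial:
  fixes c :: "('l \<Rightarrow> nat) \<Rightarrow> real"
  assumes T: "finite T" and "finite A"
  shows "AE \<omega> in M. (\<Sum>\<theta>\<in>T. c \<theta> * (\<Prod>j\<in>A. X j \<omega> ^ \<theta> j)) = 0 \<Longrightarrow>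
    (\<Sum>\<theta> | \<theta> \<in> T \<and> (\<forall>j\<in>A. \<theta> j = \<eta> j). c \<theta>) = 0"
  using assms(2)
proof (induction A arbitrary: c \<eta> rule: finite_induct)
  case empty
  then show ?case by (simp add: AE_const)
next
  case (insert j A)
  let ?S1 = "PiM {j} (\<lambda>_. borel) :: ('l \<Rightarrow> real) measure" and ?SA = "PiM A (\<lambda>_. borel) :: ('l \<Rightarrow> real) measure"
  let ?R1 = "\<lambda>\<omega>. restrict (\<lambda>i. X i \<omega>) {j}" and ?RA = "\<lambda>\<omega>. restrict (\<lambda>i. X i \<omega>) A"
  have "indep_var ?S1 ?R1 ?SA ?RA"
    by (rule indep_var_restrict[OF indep]) (use insert.hyps in auto)
  then have m[measurable]: "?R1 \<in> measurable M ?S1" "?RA \<in> measurable M ?SA"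
    and joint: "distr M ?S1 ?R1 \<Otimes>\<^sub>M distr M ?SA ?RA = distr M (?S1 \<Otimes>\<^sub>M ?SA) (\<lambda>\<omega>. (?R1 \<omega>, ?RA \<omega>))"
    unfolding indep_var_distribution_eq by auto
  interpret P1: prob_space "distr M ?S1 ?R1" by (rule prob_space_distr) simp
  interpret PA: prob_space "distr M ?SA ?RA" by (rule prob_space_distr) simp
  interpret P: pair_sigma_finite "distr M ?S1 ?R1" "distr M ?SA ?RA" ..
  define Q where "Q x y \<longleftrightarrow> (\<Sum>\<theta>\<in>T. c \<theta> * x j ^ \<theta> j * (\<Prod>i\<in>A. y i ^ \<theta> i)) = 0" for x y :: "'l \<Rightarrow> real"
  have Qm: "{p \<in> space (?S1 \<Otimes>\<^sub>M ?SA). Q (fst p) (snd p)} \<in> sets (?S1 \<Otimes>\<^sub>M ?SA)"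
  proof -
    have 1: "(\<lambda>p. fst p j) \<in> borel_measurable (?S1 \<Otimes>\<^sub>M ?SA)"
      by (rule measurable_compose[OF measurable_fst]) (auto intro: measurable_component_singleton)
    have 2: "(\<lambda>p. snd p i) \<in> borel_measurable (?S1 \<Otimes>\<^sub>M ?SA)" if "i \<in> A" for i
      using that by (intro measurable_compose[OF measurable_snd]) (auto intro: measurable_component_singleton)
    have "(\<lambda>p. \<Sum>\<theta>\<in>T. c \<theta> * fst p j ^ \<theta> j * (\<Prod>i\<in>A. snd p i ^ \<theta> i)) \<in> borel_measurable (?S1 \<Otimes>\<^sub>M ?SA)"
      by (intro borel_measurable_sum borel_measurable_times borel_measurable_const borel_measurable_power
          borel_measurable_prod 1 2)
    then show ?thesis unfolding Q_def by measurable
  qed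
  have "AE \<omega> in M. Q (?R1 \<omega>) (?RA \<omega>)"
    using insert.prems insert.hyps by (simp add: Q_def mult.assoc cong: prod.cong)
  then have "AE p in distr M (?S1 \<Otimes>\<^sub>M ?SA) (\<lambda>\<omega>. (?R1 \<omega>, ?RA \<omega>)). Q (fst p) (snd p)"
    by (subst AE_distr_iff) (use Qm in auto)
  then have "AE p in distr M ?S1 ?R1 \<Otimes>\<^sub>M distr M ?SA ?RA. Q (fst p) (snd p)" unfolding joint .
  from P.AE_pair[OF this] have "AE x in distr M ?S1 ?R1. AE y in distr M ?SA ?RA. Q x y" by simp
  then have "AE \<omega> in M. AE y in distr M ?SA ?RA. Q (?R1 \<omega>) y" by (rule AE_distrD[rotated]) simp
  then have root: "AE \<omega> in M. (\<Sum>\<theta> | \<theta> \<in> T \<and> (\<forall>i\<in>A. \<theta> i = \<eta> i). c \<theta> * X j \<omega> ^ \<theta> j) = 0"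
  proof eventually_elim
    case (elim \<omega>)
    then have "AE \<omega>' in M. Q (?R1 \<omega>) (?RA \<omega>')" by (rule AE_distrD[rotated]) simp
    then have "AE \<omega>' in M. (\<Sum>\<theta>\<in>T. (c \<theta> * X j \<omega> ^ \<theta> j) * (\<Prod>i\<in>A. X i \<omega>' ^ \<theta> i)) = 0"
      by (simp add: Q_def cong: prod.cong)
    from insert.IH[OF this] show ?case .
  qed
  define S where "S = {\<theta> \<in> T. \<forall>i\<in>A. \<theta> i = \<eta> i}"
  have S: "finite S" using T by (simp add: S_def)
  \<comment> \<open>the coefficient polynomial in \<open>X\<^sub>j\<close> belonging to the class of \<open>\<eta>\<close> on \<open>A\<close>\<close>
  define p where "p = (\<Sum>\<theta>\<in>S. monom (c \<theta>) (\<theta> j))"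
  have p: "poly p x = (\<Sum>\<theta>\<in>S. c \<theta> * x ^ \<theta> j)" for x
    by (simp add: p_def poly_sum poly_monom)
  have "p = 0"
  proof (rule ccontr)
    assume "p \<noteq> 0"
    then have fin: "finite {x. poly p x = 0}" by (rule poly_roots_finite)
    then obtain y where y: "\<And>x. poly p x = 0 \<Longrightarrow> \<bar>x\<bar> \<le> y"
      using finite_imp_bounded[OF fin] by (auto simp: bounded_iff)
    have "AE \<omega> in M. \<bar>X j \<omega>\<bar> \<le> y"
      using root by eventually_elim (use y p in \<open>simp add: S_def\<close>)
    then show False using not_AE_abs_bounded by blast
  qed
  then have "coeff p (\<eta> j) = 0" by simp
  then have "(\<Sum>\<theta>\<in>S. if \<theta> j = \<eta> j then c \<theta> else 0) = 0"
    by (simp add: p_def coeff_sum)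
  also have "(\<Sum>\<theta>\<in>S. if \<theta> j = \<eta> j then c \<theta> else 0) = (\<Sum>\<theta> | \<theta> \<in> S \<and> \<theta> j = \<eta> j. c \<theta>)"
    using S by (simp add: sum.If_cases Int_def)
  also have "{\<theta>. \<theta> \<in> S \<and> \<theta> j = \<eta> j} = {\<theta>. \<theta> \<in> T \<and> (\<forall>i\<in>insert j A. \<theta> i = \<eta> i)}"
    by (auto simp: S_def)
  finally show ?case .
qed

lemma polynomial_AE_zero:
  assumes "finite T" and "AE \<omega> in M. (\<Sum>\<theta>\<in>T. c \<theta> * monomial_fun \<theta> (\<lambda>j. X j \<omega>)) = 0" and "\<eta> \<in> T"
  shows "c \<eta> = 0"
proof -
  have "(\<Sum>\<theta> | \<theta> \<in> T \<and> (\<forall>j\<in>UNIV. \<theta> j = \<eta> j). c \<theta>) = 0"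
    using assms(2) unfolding monomial_fun_def by (rule polynomial_AE_zero_partial[OF assms(1) finite])
  moreover have "{\<theta>. \<theta> \<in> T \<and> (\<forall>j\<in>UNIV. \<theta> j = \<eta> j)} = {\<eta>}" using assms(3) by auto
  ultimately show ?thesis by simp
qed

end

section \<open>Concentration, tails from test functions, and measures on the sphere\<close>

text \<open>
  A moment bound at scale \<open>z\<close> gives one at scale \<open>x z\<close>, of order \<open>x\<^sup>-\<^sup>\<alpha>\<close>. This is small for large \<open>x\<close>,
  and for small \<open>x\<close> it still is after multiplication by \<open>x\<^sup>2\<close>.
\<close>
lemma (in prob_space) rescaled_moment_bound:
  fixes Z :: "'a \<Rightarrow> 'b::euclidean_space"
  assumes bnd: "\<forall>\<^sub>F z in at_top. rate \<alpha> k z * expectation (\<lambda>\<omega>. trunc_sq (Z \<omega> /\<^sub>R z)) \<le> K"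
    and x: "0 < x"
  shows "\<forall>\<^sub>F z in at_top. rate \<alpha> k z * expectation (\<lambda>\<omega>. trunc_sq ((Z \<omega> /\<^sub>R z) /\<^sub>R x)) \<le> 2 * K * x powr (- \<alpha>)"
proof -
  have lim: "filterlim (\<lambda>z. z * x) at_top at_top" using x by real_asymp
  have 1: "\<forall>\<^sub>F z in at_top. rate \<alpha> k (z * x) * expectation (\<lambda>\<omega>. trunc_sq (Z \<omega> /\<^sub>R (z * x))) \<le> K"
    using filterlim_iff[THEN iffD1, OF lim, rule_format, OF bnd] .
  have "0 < x powr (- \<alpha>)" using x by simp
  then have 2: "\<forall>\<^sub>F z in at_top. rate \<alpha> k z / rate \<alpha> k (z * x) < 2 * x powr (- \<alpha>)"
    using rate_scale[OF x, of \<alpha> k] by (intro order_tendstoD(2)) auto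
  show ?thesis using 1 2 eventually_gt_at_top[of 1] eventually_gt_at_top[of "1 / x"]
  proof eventually_elim
    case (elim z)
    define E where "E = expectation (\<lambda>\<omega>. trunc_sq (Z \<omega> /\<^sub>R (z * x)))"
    have E0: "0 \<le> E" unfolding E_def by (intro Bochner_Integration.integral_nonneg) simp
    have "1 < z * x" using elim x by (simp add: field_simps)
    then have r: "0 < rate \<alpha> k (z * x)" by (rule rate_pos)
    have eq: "(\<lambda>\<omega>. trunc_sq ((Z \<omega> /\<^sub>R z) /\<^sub>R x)) = (\<lambda>\<omega>. trunc_sq (Z \<omega> /\<^sub>R (z * x)))"
      by (simp add: mult.commute)
    have "rate \<alpha> k z * E = (rate \<alpha> k z / rate \<alpha> k (z * x)) * (rate \<alpha> k (z * x) * E)" using r by simp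
    also have "\<dots> \<le> (2 * x powr (- \<alpha>)) * (rate \<alpha> k (z * x) * E)"
      using elim(2) r E0 by (intro mult_right_mono) auto
    also have "\<dots> \<le> (2 * x powr (- \<alpha>)) * K"
      using elim(1) by (intro mult_left_mono) (auto simp: E_def)
    finally show ?case unfolding eq E_def[symmetric] by (simp add: mult_ac)
  qed
qed

text \<open>
  The pairs in \<open>B\<close> are coordinates that cannot be large together. A test function \<open>D\<close> that vanishes
  wherever no pair in \<open>B\<close> is jointly nonzero is negligible: it is controlled far out by the tail of
  \<open>Z\<close>, near the origin by the truncated second moment, and on the compact remainder either it is small
  or the continuous function \<open>\<rho>\<close>, which measures joint largeness, is bounded away from \<open>0\<close>.
\<close>
lemma (in prob_space) concentration_limit:
  fixes Z :: "'a \<Rightarrow> real ^ 'm::finite" and B :: "('m \<times> 'm) set"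
  assumes Z[measurable]: "Z \<in> borel_measurable M" and \<alpha>: "0 < \<alpha>" "\<alpha> < 2"
    and D: "D \<in> test_functions"
    and D0: "\<And>x. (\<And>i i'. (i, i') \<in> B \<Longrightarrow> x $ i = 0 \<or> x $ i' = 0) \<Longrightarrow> D x = 0"
    and bnd: "\<forall>\<^sub>F z in at_top. rate \<alpha> k z * expectation (\<lambda>\<omega>. trunc_sq (Z \<omega> /\<^sub>R z)) \<le> K"
    and negl: "\<And>i i'. (i, i') \<in> B \<Longrightarrow>
      ((\<lambda>z. rate \<alpha> k z * expectation (\<lambda>\<omega>. trunc_sq (sqrt \<bar>Z \<omega> $ i * Z \<omega> $ i'\<bar> / z))) \<longlongrightarrow> 0) at_top"
  shows "((\<lambda>z. rate \<alpha> k z * expectation (\<lambda>\<omega>. D (Z \<omega> /\<^sub>R z))) \<longlongrightarrow> 0) at_top"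
proof (rule tendstoI)
  fix \<epsilon> :: real assume \<epsilon>: "0 < \<epsilon>"
  note [measurable] = test_functionsD(2)[OF D]
  have [measurable]: "(\<lambda>\<omega>. Z \<omega> $ i) \<in> borel_measurable M" for i
    by (rule measurable_compose[OF Z borel_measurable_continuous_onI]) (intro continuous_intros)
  obtain C where C: "0 < C" "\<And>x. \<bar>D x\<bar> \<le> C * trunc_sq x"
    using test_functionsD(4)[OF D] by auto
  define K' where "K' = max K 1"
  have K': "0 < K'" by (simp add: K'_def)
  have bnd': "\<forall>\<^sub>F z in at_top. rate \<alpha> k z * expectation (\<lambda>\<omega>. trunc_sq (Z \<omega> /\<^sub>R z)) \<le> K'"
    using bnd by eventually_elim (simp add: K'_def)
  have DC: "\<bar>D x\<bar> \<le> C" for x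
    using C(2)[of x] mult_left_mono[OF trunc_sq_le_one[of x], of C] C(1) by linarith
  \<comment> \<open>\<open>R\<close> and \<open>\<delta>\<close> make the contributions from infinity and from the origin smaller than \<open>\<epsilon> / 4\<close>\<close>
  define A where "A = 2 * C * (2 * K')"
  have A: "0 < A" using C K' by (simp add: A_def)
  have "((\<lambda>R. A * R powr (- \<alpha>)) \<longlongrightarrow> 0) at_top" using A \<alpha> by real_asymp
  then have "\<forall>\<^sub>F R in at_top. A * R powr (- \<alpha>) < \<epsilon> / 4 \<and> 0 < R"
    using \<epsilon> by (intro eventually_conj eventually_gt_at_top order_tendstoD(2)) auto
  then obtain R where R: "A * R powr (- \<alpha>) < \<epsilon> / 4" "0 < R"
    by (auto dest: eventually_happens)
  define d where "d = 2 - \<alpha>"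
  have "0 < d" using \<alpha> by (simp add: d_def)
  then have "((\<lambda>\<delta>. A * \<delta> powr d) \<longlongrightarrow> 0) (at_right 0)" using A by real_asymp
  then have "\<forall>\<^sub>F \<delta> in at_right 0. A * \<delta> powr d < \<epsilon> / 4 \<and> 0 < \<delta>"
    using \<epsilon> by (intro eventually_conj order_tendstoD(2)) (auto simp: eventually_at_right_less)
  then obtain \<delta> where \<delta>': "A * \<delta> powr d < \<epsilon> / 4" and \<delta>0: "0 < \<delta>"
    by (auto dest: eventually_happens simp: trivial_limit_at_right_real)
  have "\<delta> powr d = \<delta>\<^sup>2 * \<delta> powr (- \<alpha>)" using \<delta>0 by (simp add: d_def powr_diff powr_minus powr_numeral divide_inverse)
  then have \<delta>: "A * (\<delta>\<^sup>2 * \<delta> powr (- \<alpha>)) < \<epsilon> / 4" using \<delta>' by simp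
  \<comment> \<open>the threshold depends on \<open>\<delta>\<close>: the mass outside the ball of radius \<open>\<delta>\<close> is of order \<open>\<delta>\<^sup>-\<^sup>\<alpha>\<close>\<close>
  define \<epsilon>' where "\<epsilon>' = \<epsilon> / (32 * K' * \<delta> powr (- \<alpha>))"
  have \<epsilon>': "0 < \<epsilon>'" "2 * \<epsilon>' * (2 * K' * \<delta> powr (- \<alpha>)) < \<epsilon> / 4"
    using \<epsilon> K' \<delta>0 by (simp_all add: \<epsilon>'_def field_simps)
  define \<rho> where "\<rho> x = (\<Sum>(i, i')\<in>B. trunc_sq (sqrt \<bar>x $ i * x $ i'\<bar>))" for x :: "real ^ 'm"
  have \<rho>0: "0 \<le> \<rho> x" for x by (auto simp: \<rho>_def intro!: sum_nonneg)
  define S where "S = {x :: real ^ 'm. norm x \<le> R \<and> \<epsilon>' \<le> \<bar>D x\<bar>}"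
  have "closed S"
  proof -
    have "S = {x. norm x \<le> R} \<inter> {x. \<epsilon>' \<le> \<bar>D x\<bar>}" by (auto simp: S_def)
    moreover have "closed {x. \<epsilon>' \<le> \<bar>D x\<bar>}"
      using test_functionsD(1)[OF D] by (intro closed_Collect_le continuous_intros)
    moreover have "closed {x :: real ^ 'm. norm x \<le> R}" by (intro closed_Collect_le continuous_intros)
    ultimately show ?thesis by (simp add: closed_Int)
  qed
  moreover have "bounded S" by (auto simp: S_def bounded_iff)
  ultimately have "compact S" by (simp add: compact_eq_bounded_closed)
  have \<rho>_pos: "0 < \<rho> x" if "x \<in> S" for x
  proof (rule ccontr)
    assume "\<not> 0 < \<rho> x"
    then have "\<rho> x = 0" using \<rho>0[of x] by simp
    then have "\<forall>p\<in>B. (case p of (i, i') \<Rightarrow> trunc_sq (sqrt \<bar>x $ i * x $ i'\<bar>)) = 0"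
      unfolding \<rho>_def by (subst (asm) sum_nonneg_eq_0_iff) auto
    then have "x $ i = 0 \<or> x $ i' = 0" if "(i, i') \<in> B" for i i'
      using that by (auto simp: trunc_sq_def add_nonneg_eq_0_iff)
    then have "D x = 0" by (rule D0)
    then show False using that \<epsilon>' by (simp add: S_def)
  qed
  have "\<exists>\<eta>>0. \<forall>x\<in>S. \<eta> \<le> \<rho> x"
  proof (cases "S = {}")
    case False
    have "continuous_on S \<rho>"
      unfolding \<rho>_def split_beta' by (intro continuous_intros)
    from continuous_attains_inf[OF \<open>compact S\<close> False this] \<rho>_pos show ?thesis by blast
  qed (auto intro: exI[of _ 1])
  then obtain \<eta> where \<eta>: "0 < \<eta>" "\<And>x. x \<in> S \<Longrightarrow> \<eta> \<le> \<rho> x" by blast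
  have pointwise: "\<bar>D x\<bar> \<le> 2 * C * trunc_sq (x /\<^sub>R R) + (2 * C * \<delta>\<^sup>2 + 2 * \<epsilon>') * trunc_sq (x /\<^sub>R \<delta>) + C / \<eta> * \<rho> x" for x
  proof -
    have t0: "0 \<le> 2 * C * trunc_sq (x /\<^sub>R R)" "0 \<le> 2 * C * \<delta>\<^sup>2 * trunc_sq (x /\<^sub>R \<delta>)"
        "0 \<le> 2 * \<epsilon>' * trunc_sq (x /\<^sub>R \<delta>)" "0 \<le> C / \<eta> * \<rho> x"
      using C \<epsilon>' \<eta> \<rho>0[of x] by auto
    consider "R \<le> norm x" | "norm x \<le> \<delta>" | "\<delta> \<le> norm x" "\<bar>D x\<bar> \<le> \<epsilon>'" | "norm x \<le> R" "\<epsilon>' \<le> \<bar>D x\<bar>"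
      by linarith
    then have "\<bar>D x\<bar> \<le> 2 * C * trunc_sq (x /\<^sub>R R) \<or> \<bar>D x\<bar> \<le> 2 * C * \<delta>\<^sup>2 * trunc_sq (x /\<^sub>R \<delta>)
        \<or> \<bar>D x\<bar> \<le> 2 * \<epsilon>' * trunc_sq (x /\<^sub>R \<delta>) \<or> \<bar>D x\<bar> \<le> C / \<eta> * \<rho> x"
    proof cases
      case 1
      then have "1 / 2 \<le> trunc_sq (x /\<^sub>R R)" using R by (intro trunc_sq_ge_half) (simp add: field_simps)
      then have "2 * C * (1 / 2) \<le> 2 * C * trunc_sq (x /\<^sub>R R)" using C by (intro mult_left_mono) auto
      then show ?thesis using DC[of x] by simp
    next
      case 2
      define t where "t = (norm x)\<^sup>2"
      have t: "0 \<le> t" "t \<le> \<delta>\<^sup>2" using 2 \<delta>0 by (auto simp: t_def intro: power_mono)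
      have "trunc_sq (x /\<^sub>R \<delta>) = t / (\<delta>\<^sup>2 + t)"
        using \<delta>0 by (simp add: trunc_sq_def t_def power_mult_distrib power_inverse field_simps)
      also have "t / (2 * \<delta>\<^sup>2) \<le> t / (\<delta>\<^sup>2 + t)" using t \<delta>0 by (intro divide_left_mono) (auto intro!: mult_pos_pos add_pos_nonneg)
      finally have "2 * C * \<delta>\<^sup>2 * (t / (2 * \<delta>\<^sup>2)) \<le> 2 * C * \<delta>\<^sup>2 * trunc_sq (x /\<^sub>R \<delta>)"
        using C by (intro mult_left_mono) auto
      moreover have "\<bar>D x\<bar> \<le> C * t"
        using C(2)[of x] mult_left_mono[OF trunc_sq_le_sq[of x], of C] C(1) unfolding t_def by linarith
      ultimately show ?thesis using \<delta>0 by simp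
    next
      case 3
      then have "1 / 2 \<le> trunc_sq (x /\<^sub>R \<delta>)" using \<delta>0 by (intro trunc_sq_ge_half) (simp add: field_simps)
      then have "2 * \<epsilon>' * (1 / 2) \<le> 2 * \<epsilon>' * trunc_sq (x /\<^sub>R \<delta>)" using \<epsilon>' by (intro mult_left_mono) auto
      then show ?thesis using 3 by simp
    next
      case 4
      then have "\<eta> \<le> \<rho> x" by (intro \<eta>) (simp add: S_def)
      then have "C / \<eta> * \<eta> \<le> C / \<eta> * \<rho> x" using C \<eta> by (intro mult_left_mono) auto
      then show ?thesis using DC[of x] \<eta>(1) by simp
    qed
    then show ?thesis using t0 unfolding distrib_right by linarith
  qed
  have int: "integrable M (\<lambda>\<omega>. trunc_sq (f \<omega>))" if "f \<in> borel_measurable M" for f :: "'a \<Rightarrow> 'c::euclidean_space"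
    by (rule integrable_test_function[OF trunc_sq_test_function that])
  define T where "T i i' z = rate \<alpha> k z * expectation (\<lambda>\<omega>. trunc_sq (sqrt \<bar>Z \<omega> $ i * Z \<omega> $ i'\<bar> / z))" for i i' z
  have sum0: "((\<lambda>z. C / \<eta> * (\<Sum>(i, i')\<in>B. T i i' z)) \<longlongrightarrow> 0) at_top"
  proof -
    have "((\<lambda>z. \<Sum>p\<in>B. T (fst p) (snd p) z) \<longlongrightarrow> (\<Sum>p\<in>B. 0)) at_top"
      unfolding T_def by (intro tendsto_sum negl) auto
    then show ?thesis by (intro tendsto_mult_right_zero) (simp add: split_beta')
  qed
  have ev: "\<forall>\<^sub>F z in at_top. C / \<eta> * (\<Sum>(i, i')\<in>B. T i i' z) < \<epsilon> / 4"
    by (rule order_tendstoD(2)[OF sum0]) (use \<epsilon> in simp)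
  show "\<forall>\<^sub>F z in at_top. dist (rate \<alpha> k z * expectation (\<lambda>\<omega>. D (Z \<omega> /\<^sub>R z))) 0 < \<epsilon>"
    using ev rescaled_moment_bound[OF bnd' R(2)] rescaled_moment_bound[OF bnd' \<delta>0] eventually_gt_at_top[of 0]
  proof eventually_elim
    case (elim z)
    define E1 where "E1 = expectation (\<lambda>\<omega>. trunc_sq ((Z \<omega> /\<^sub>R z) /\<^sub>R R))"
    define E2 where "E2 = expectation (\<lambda>\<omega>. trunc_sq ((Z \<omega> /\<^sub>R z) /\<^sub>R \<delta>))"
    define E3 where "E3 = (\<Sum>(i, i')\<in>B. expectation (\<lambda>\<omega>. trunc_sq (sqrt \<bar>Z \<omega> $ i * Z \<omega> $ i'\<bar> / z)))"
    have root: "sqrt \<bar>(Z \<omega> /\<^sub>R z) $ i * (Z \<omega> /\<^sub>R z) $ i'\<bar> = sqrt \<bar>Z \<omega> $ i * Z \<omega> $ i'\<bar> / z" for \<omega> i i'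
    proof -
      have "\<bar>(Z \<omega> /\<^sub>R z) $ i * (Z \<omega> /\<^sub>R z) $ i'\<bar> = \<bar>Z \<omega> $ i * Z \<omega> $ i'\<bar> / z\<^sup>2"
        using elim(4) by (simp add: abs_mult power2_eq_square field_simps)
      then show ?thesis using elim(4) by (simp add: real_sqrt_divide)
    qed
    have \<rho>Z: "\<rho> (Z \<omega> /\<^sub>R z) = (\<Sum>(i, i')\<in>B. trunc_sq (sqrt \<bar>Z \<omega> $ i * Z \<omega> $ i'\<bar> / z))" for \<omega>
      unfolding \<rho>_def root ..
    have int3: "integrable M (\<lambda>\<omega>. \<rho> (Z \<omega> /\<^sub>R z))"
      unfolding \<rho>Z split_beta' by (intro Bochner_Integration.integrable_sum int) measurable
    have E3: "expectation (\<lambda>\<omega>. \<rho> (Z \<omega> /\<^sub>R z)) = E3"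
      unfolding \<rho>Z split_beta' E3_def by (intro Bochner_Integration.integral_sum int) measurable
    have i1: "integrable M (\<lambda>\<omega>. trunc_sq ((Z \<omega> /\<^sub>R z) /\<^sub>R R))" "integrable M (\<lambda>\<omega>. trunc_sq ((Z \<omega> /\<^sub>R z) /\<^sub>R \<delta>))"
      by (rule int, measurable)+
    have "\<bar>expectation (\<lambda>\<omega>. D (Z \<omega> /\<^sub>R z))\<bar> \<le> expectation (\<lambda>\<omega>. \<bar>D (Z \<omega> /\<^sub>R z)\<bar>)"
      by (rule integral_abs_bound)
    also have "\<dots> \<le> expectation (\<lambda>\<omega>. 2 * C * trunc_sq ((Z \<omega> /\<^sub>R z) /\<^sub>R R)
        + (2 * C * \<delta>\<^sup>2 + 2 * \<epsilon>') * trunc_sq ((Z \<omega> /\<^sub>R z) /\<^sub>R \<delta>) + C / \<eta> * \<rho> (Z \<omega> /\<^sub>R z))"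
    proof (rule integral_mono)
      show "integrable M (\<lambda>\<omega>. \<bar>D (Z \<omega> /\<^sub>R z)\<bar>)"
        by (intro integrable_abs integrable_test_function[OF D]) measurable
      show "integrable M (\<lambda>\<omega>. 2 * C * trunc_sq ((Z \<omega> /\<^sub>R z) /\<^sub>R R)
        + (2 * C * \<delta>\<^sup>2 + 2 * \<epsilon>') * trunc_sq ((Z \<omega> /\<^sub>R z) /\<^sub>R \<delta>) + C / \<eta> * \<rho> (Z \<omega> /\<^sub>R z))"
        using i1 int3 by simp
    qed (rule pointwise)
    also have "\<dots> = 2 * C * E1 + (2 * C * \<delta>\<^sup>2 + 2 * \<epsilon>') * E2 + C / \<eta> * E3"
      using i1 int3 by (simp add: E3[symmetric] E1_def E2_def)
    finally have "rate \<alpha> k z * \<bar>expectation (\<lambda>\<omega>. D (Z \<omega> /\<^sub>R z))\<bar>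
        \<le> rate \<alpha> k z * (2 * C * E1 + (2 * C * \<delta>\<^sup>2 + 2 * \<epsilon>') * E2 + C / \<eta> * E3)"
      by (rule mult_left_mono) (rule rate_nonneg)
    also have "\<dots> = 2 * C * (rate \<alpha> k z * E1) + (2 * C * \<delta>\<^sup>2 + 2 * \<epsilon>') * (rate \<alpha> k z * E2) + C / \<eta> * (rate \<alpha> k z * E3)"
      by (simp add: algebra_simps)
    also have "\<dots> \<le> 2 * C * (2 * K' * R powr (- \<alpha>)) + (2 * C * \<delta>\<^sup>2 + 2 * \<epsilon>') * (2 * K' * \<delta> powr (- \<alpha>))
        + C / \<eta> * (rate \<alpha> k z * E3)"
      using elim(2,3) C \<epsilon>' unfolding E1_def[symmetric] E2_def[symmetric]
      by (intro add_mono mult_left_mono order_refl) auto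
    also have "rate \<alpha> k z * E3 = (\<Sum>(i, i')\<in>B. T i i' z)"
      by (simp add: E3_def T_def sum_distrib_left split_beta')
    also have "2 * C * (2 * K' * R powr (- \<alpha>)) + (2 * C * \<delta>\<^sup>2 + 2 * \<epsilon>') * (2 * K' * \<delta> powr (- \<alpha>))
        + C / \<eta> * (\<Sum>(i, i')\<in>B. T i i' z)
      = A * R powr (- \<alpha>) + A * (\<delta>\<^sup>2 * \<delta> powr (- \<alpha>)) + 2 * \<epsilon>' * (2 * K' * \<delta> powr (- \<alpha>)) + C / \<eta> * (\<Sum>(i, i')\<in>B. T i i' z)"
      by (simp add: A_def algebra_simps)
    also have "\<dots> < \<epsilon>" using R(1) \<delta> \<epsilon>'(2) elim(1) by linarith
    finally show ?case by (simp add: abs_mult rate_nonneg)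
  qed
qed

text \<open>
  The indicator of \<open>(1, \<infinity>)\<close> lies between the continuous function \<open>\<phi> \<epsilon>\<close> and its dilation by
  \<open>1 - \<epsilon>\<close>. As the rate is regularly varying, dilation multiplies the limit by \<open>(1 - \<epsilon>)\<^sup>\<alpha>\<close>, so upper and
  lower bound merge as \<open>\<epsilon>\<close> tends to \<open>0\<close>, and the limit never has to be computed.
\<close>
lemma (in prob_space) upper_tail_of_test_limits:
  fixes Y :: "'a \<Rightarrow> real"
  assumes Y[measurable]: "Y \<in> borel_measurable M" and \<alpha>: "0 < \<alpha>"
    and lim: "\<And>w :: real \<Rightarrow> real. w \<in> test_functions \<Longrightarrow>
       \<exists>L. ((\<lambda>z. rate \<alpha> k z * expectation (\<lambda>\<omega>. w (Y \<omega> / z))) \<longlongrightarrow> L) at_top"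
  shows "\<exists>c. upper_tail M Y \<alpha> k c"
proof -
  define f where "f z = rate \<alpha> k z * prob {\<omega>\<in>space M. Y \<omega> > z}" for z
  define \<phi> where "\<phi> \<epsilon> y = max 0 (min 1 ((y - (1 - \<epsilon>)) / \<epsilon>))" for \<epsilon> y :: real
  have \<phi>: "\<phi> \<epsilon> \<in> test_functions" if \<epsilon>: "0 < \<epsilon>" "\<epsilon> < 1" for \<epsilon>
  proof (rule test_functionsI)
    have t: "0 < trunc_sq (1 - \<epsilon>)" using \<epsilon> by (simp add: trunc_sq_def add_pos_nonneg)
    show "continuous_on UNIV (\<phi> \<epsilon>)" unfolding \<phi>_def by (intro continuous_intros) (use \<epsilon> in auto)
    show "\<bar>\<phi> \<epsilon> y\<bar> \<le> 1 / trunc_sq (1 - \<epsilon>) * trunc_sq y" for y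
    proof (cases "1 - \<epsilon> \<le> y")
      case True
      then have "trunc_sq (1 - \<epsilon>) \<le> trunc_sq y" using \<epsilon> by (intro trunc_sq_mono) auto
      then have "1 \<le> 1 / trunc_sq (1 - \<epsilon>) * trunc_sq y" using t by (simp add: field_simps)
      moreover have "\<bar>\<phi> \<epsilon> y\<bar> \<le> 1" by (simp add: \<phi>_def)
      ultimately show ?thesis by linarith
    next
      case False
      then have "(y - (1 - \<epsilon>)) / \<epsilon> \<le> 0" using \<epsilon> by (simp add: field_simps)
      then have "\<phi> \<epsilon> y = 0" by (simp add: \<phi>_def)
      then show ?thesis using t by simp
    qed
  qed
  have "\<exists>L. \<forall>\<epsilon>. 0 < \<epsilon> \<and> \<epsilon> < 1 \<longrightarrow> ((\<lambda>z. rate \<alpha> k z * expectation (\<lambda>\<omega>. \<phi> \<epsilon> (Y \<omega> / z))) \<longlongrightarrow> L \<epsilon>) at_top"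
    using lim[OF \<phi>] by (intro choice) blast
  then obtain L where L: "\<And>\<epsilon>. 0 < \<epsilon> \<Longrightarrow> \<epsilon> < 1 \<Longrightarrow> ((\<lambda>z. rate \<alpha> k z * expectation (\<lambda>\<omega>. \<phi> \<epsilon> (Y \<omega> / z))) \<longlongrightarrow> L \<epsilon>) at_top"
    by blast
  have pr: "prob {\<omega>\<in>space M. Y \<omega> > z} = expectation (\<lambda>\<omega>. indicator {\<omega>\<in>space M. Y \<omega> > z} \<omega>)" for z by simp
  have ind_int: "integrable M (\<lambda>\<omega>. indicator {\<omega>\<in>space M. Y \<omega> > z} \<omega> :: real)" for z
    by (rule integrable_const_bound[where B=1]) (auto simp: indicator_def)
  have upper: "\<forall>\<^sub>F z in at_top. f z \<le> rate \<alpha> k z * expectation (\<lambda>\<omega>. \<phi> \<epsilon> (Y \<omega> / z))" if \<epsilon>: "0 < \<epsilon>" "\<epsilon> < 1" for \<epsilon>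
    using eventually_gt_at_top[of 0]
  proof eventually_elim
    case (elim z)
    have "indicator {\<omega>\<in>space M. Y \<omega> > z} \<omega> \<le> \<phi> \<epsilon> (Y \<omega> / z)" for \<omega>
    proof (cases "Y \<omega> > z")
      case True
      then have "1 \<le> Y \<omega> / z" using elim by (simp add: field_simps)
      then have "1 \<le> (Y \<omega> / z - (1 - \<epsilon>)) / \<epsilon>" using \<epsilon> by (simp add: le_divide_eq)
      then show ?thesis by (simp add: \<phi>_def indicator_def)
    qed (simp add: \<phi>_def)
    then show ?case unfolding f_def pr
      by (intro mult_left_mono rate_nonneg integral_mono ind_int integrable_test_function[OF \<phi>[OF \<epsilon>]]) auto
  qed
  have lower: "\<forall>\<^sub>F z in at_top. rate \<alpha> k z * expectation (\<lambda>\<omega>. \<phi> \<epsilon> (Y \<omega> / (z * (1 / (1 - \<epsilon>))))) \<le> f z" if \<epsilon>: "0 < \<epsilon>" "\<epsilon> < 1" for \<epsilon>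
    using eventually_gt_at_top[of 0]
  proof eventually_elim
    case (elim z)
    have "\<phi> \<epsilon> (Y \<omega> / (z * (1 / (1 - \<epsilon>)))) \<le> indicator {\<omega>\<in>space M. Y \<omega> > z} \<omega>" if "\<omega> \<in> space M" for \<omega>
    proof (cases "Y \<omega> > z")
      case True
      then show ?thesis using that by (simp add: \<phi>_def)
    next
      case False
      have "Y \<omega> / (z * (1 / (1 - \<epsilon>))) = (1 - \<epsilon>) * (Y \<omega> / z)" by simp
      also have "\<dots> \<le> (1 - \<epsilon>) * 1" using False elim \<epsilon> by (intro mult_left_mono) auto
      finally have "(Y \<omega> / (z * (1 / (1 - \<epsilon>))) - (1 - \<epsilon>)) / \<epsilon> \<le> 0" using \<epsilon> by (intro divide_nonpos_pos) auto
      then show ?thesis by (simp add: \<phi>_def)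
    qed
    then show ?case unfolding f_def pr
      by (intro mult_left_mono rate_nonneg integral_mono ind_int integrable_test_function[OF \<phi>[OF \<epsilon>]]) auto
  qed
  have lower_lim: "((\<lambda>z. rate \<alpha> k z * expectation (\<lambda>\<omega>. \<phi> \<epsilon> (Y \<omega> / (z * (1 / (1 - \<epsilon>)))))) \<longlongrightarrow> (1 - \<epsilon>) powr \<alpha> * L \<epsilon>) at_top"
    if \<epsilon>: "0 < \<epsilon>" "\<epsilon> < 1" for \<epsilon>
  proof -
    define x where "x = 1 / (1 - \<epsilon>)"
    have x: "0 < x" using \<epsilon> by (simp add: x_def)
    have fl: "filterlim (\<lambda>z. z * x) at_top at_top" using x by real_asymp
    have "((\<lambda>z. (rate \<alpha> k z / rate \<alpha> k (z * x)) * (rate \<alpha> k (z * x) * expectation (\<lambda>\<omega>. \<phi> \<epsilon> (Y \<omega> / (z * x))))) \<longlongrightarrow> x powr (- \<alpha>) * L \<epsilon>) at_top"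
      by (intro tendsto_mult rate_scale x filterlim_compose[OF L[OF \<epsilon>] fl])
    moreover have "x powr (- \<alpha>) = (1 - \<epsilon>) powr \<alpha>" using \<epsilon> by (simp add: x_def powr_minus powr_divide)
    moreover have "\<forall>\<^sub>F z in at_top. (rate \<alpha> k z / rate \<alpha> k (z * x)) * (rate \<alpha> k (z * x) * expectation (\<lambda>\<omega>. \<phi> \<epsilon> (Y \<omega> / (z * x))))
        = rate \<alpha> k z * expectation (\<lambda>\<omega>. \<phi> \<epsilon> (Y \<omega> / (z * x)))"
      using eventually_gt_at_top[of 1] eventually_gt_at_top[of "1 / x"]
    proof eventually_elim
      case (elim z)
      then have "1 < z * x" using x by (simp add: field_simps)
      then have "rate \<alpha> k (z * x) \<noteq> 0" using rate_pos[of "z * x" \<alpha> k] by simp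
      then show ?case by simp
    qed
    ultimately show ?thesis unfolding x_def using Lim_transform_eventually by fastforce
  qed
  have cmp: "(1 - \<epsilon>) powr \<alpha> * L \<epsilon> \<le> L \<epsilon>'" if "0 < \<epsilon>" "\<epsilon> < 1" "0 < \<epsilon>'" "\<epsilon>' < 1" for \<epsilon> \<epsilon>'
  proof (rule tendsto_le[OF _ L[OF that(3,4)] lower_lim[OF that(1,2)]])
    show "\<forall>\<^sub>F z in at_top. rate \<alpha> k z * expectation (\<lambda>\<omega>. \<phi> \<epsilon> (Y \<omega> / (z * (1 / (1 - \<epsilon>)))))
        \<le> rate \<alpha> k z * expectation (\<lambda>\<omega>. \<phi> \<epsilon>' (Y \<omega> / z))"
      using lower[OF that(1,2)] upper[OF that(3,4)] by eventually_elim linarith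
  qed simp
  define c where "c = (INF \<epsilon>\<in>{0<..<1}. L \<epsilon>)"
  have bdd: "bdd_below (L ` {0<..<1})"
    by (rule bdd_belowI[of _ "(1 - 1 / 2) powr \<alpha> * L (1 / 2)"]) (use cmp[of "1 / 2"] in auto)
  have c_ge: "(1 - \<epsilon>) powr \<alpha> * L \<epsilon> \<le> c" if "0 < \<epsilon>" "\<epsilon> < 1" for \<epsilon>
    unfolding c_def using that cmp by (intro cINF_greatest) auto
  have c_le: "c \<le> L \<epsilon>" if "0 < \<epsilon>" "\<epsilon> < 1" for \<epsilon>
    unfolding c_def using that bdd by (intro cINF_lower) auto
  have "(f \<longlongrightarrow> c) at_top"
  proof (rule order_tendstoI)
    fix y assume "c < y"
    then obtain \<epsilon> where \<epsilon>: "0 < \<epsilon>" "\<epsilon> < 1" "L \<epsilon> < y"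
      unfolding c_def by (subst (asm) cINF_less_iff[OF _ bdd]) auto
    show "\<forall>\<^sub>F z in at_top. f z < y"
      using upper[OF \<epsilon>(1,2)] order_tendstoD(2)[OF L[OF \<epsilon>(1,2)] \<epsilon>(3)] by eventually_elim linarith
  next
    fix y assume y: "y < c"
    have "((\<lambda>\<epsilon>. (1 - \<epsilon>) powr \<alpha>) \<longlongrightarrow> 1) (at_right 0)" by real_asymp
    then have "((\<lambda>\<epsilon>. (1 - \<epsilon>) powr \<alpha> * c) \<longlongrightarrow> 1 * c) (at_right 0)" by (intro tendsto_intros)
    then have "\<forall>\<^sub>F \<epsilon> in at_right 0. y < (1 - \<epsilon>) powr \<alpha> * c" using y by (intro order_tendstoD(1)) auto
    moreover have "\<forall>\<^sub>F \<epsilon> in at_right (0::real). \<epsilon> < 1" by (rule eventually_at_rightI[of 0 1]) auto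
    moreover have "\<forall>\<^sub>F \<epsilon> in at_right (0::real). 0 < \<epsilon>" by (auto simp: eventually_at_right_less)
    ultimately have "\<forall>\<^sub>F \<epsilon> in at_right 0. y < (1 - \<epsilon>) powr \<alpha> * c \<and> \<epsilon> < 1 \<and> 0 < \<epsilon>" by eventually_elim auto
    then obtain \<epsilon> where \<epsilon>: "y < (1 - \<epsilon>) powr \<alpha> * c" "0 < \<epsilon>" "\<epsilon> < 1"
      by (auto dest: eventually_happens simp: trivial_limit_at_right_real)
    have "(1 - \<epsilon>) powr \<alpha> * c \<le> (1 - \<epsilon>) powr \<alpha> * L \<epsilon>" using c_le[OF \<epsilon>(2,3)] by (intro mult_left_mono) auto
    then have "y < (1 - \<epsilon>) powr \<alpha> * L \<epsilon>" using \<epsilon>(1) by linarith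
    from order_tendstoD(1)[OF lower_lim[OF \<epsilon>(2,3)] this]
    show "\<forall>\<^sub>F z in at_top. y < f z"
      using lower[OF \<epsilon>(2,3)] by eventually_elim linarith
  qed
  then show ?thesis unfolding upper_tail_def f_def by auto
qed

text \<open>
  The measure is the sum over \<open>i\<close> of the images under \<open>s i\<close> of the laws with density \<open>w i\<close>. The finite
  sum of measures is formed by one image of a measure on the product with a counting measure.
\<close>
lemma (in prob_space) sphere_measure_exists:
  fixes s :: "'i::finite \<Rightarrow> 'a \<Rightarrow> 'b::euclidean_space" and w :: "'i \<Rightarrow> 'a \<Rightarrow> real"
  assumes s[measurable]: "\<And>i. s i \<in> borel_measurable M" and sph: "\<And>i \<omega>. norm (s i \<omega>) = 1"
    and w: "\<And>i. integrable M (w i)" and w0: "\<And>i \<omega>. 0 \<le> w i \<omega>"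
  shows "\<exists>\<nu>. sets \<nu> = sets (restrict_space borel (sphere 0 1 :: 'b set)) \<and> finite_measure \<nu> \<and>
    (\<forall>A\<in>sets borel. A \<subseteq> sphere 0 1 \<longrightarrow> emeasure \<nu> A = (\<Sum>i\<in>UNIV. \<integral>\<^sup>+\<omega>. ennreal (w i \<omega>) * indicator A (s i \<omega>) \<partial>M)) \<and>
    (\<forall>f\<in>borel_measurable borel. \<forall>B. (\<forall>x\<in>sphere 0 1. \<bar>f x\<bar> \<le> B) \<longrightarrow>
      (LINT x|\<nu>. f x) = (\<Sum>i\<in>UNIV. expectation (\<lambda>\<omega>. w i \<omega> * f (s i \<omega>))))"
proof -
  have [measurable]: "w i \<in> borel_measurable M" for i using w by auto
  let ?C = "count_space (UNIV :: 'i set)"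
  let ?P = "?C \<Otimes>\<^sub>M M"
  let ?S = "restrict_space borel (sphere 0 1 :: 'b set)"
  interpret C: sigma_finite_measure ?C by (rule sigma_finite_measure_count_space_finite) simp
  interpret P: pair_sigma_finite ?C M ..
  have wm[measurable]: "(\<lambda>p. w (fst p) (snd p)) \<in> borel_measurable ?P"
    by (rule measurable_pair_measure_countable1) auto
  have sm[measurable]: "(\<lambda>p. s (fst p) (snd p)) \<in> borel_measurable ?P"
    by (rule measurable_pair_measure_countable1) auto
  have sm'[measurable]: "(\<lambda>p. s (fst p) (snd p)) \<in> measurable ?P ?S"
    by (rule measurable_restrict_space2) (use sph in auto)
  define N where "N = density ?P (\<lambda>p. ennreal (w (fst p) (snd p)))"
  define \<nu> where "\<nu> = distr N ?S (\<lambda>p. s (fst p) (snd p))"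
  have sN: "(\<lambda>p. s (fst p) (snd p)) \<in> measurable N ?S" unfolding N_def by simp
  have em: "emeasure \<nu> A = (\<Sum>i\<in>UNIV. \<integral>\<^sup>+\<omega>. ennreal (w i \<omega>) * indicator A (s i \<omega>) \<partial>M)"
    if A: "A \<in> sets borel" "A \<subseteq> sphere 0 1" for A
  proof -
    have A': "A \<in> sets ?S" using A by (simp add: sets_restrict_space_iff)
    have "emeasure \<nu> A = emeasure N ((\<lambda>p. s (fst p) (snd p)) -` A \<inter> space N)"
      unfolding \<nu>_def by (rule emeasure_distr[OF sN A'])
    also have "\<dots> = (\<integral>\<^sup>+p. ennreal (w (fst p) (snd p)) * indicator ((\<lambda>p. s (fst p) (snd p)) -` A \<inter> space N) p \<partial>?P)"
      unfolding N_def by (rule emeasure_density) (use measurable_sets[OF sN A'] in \<open>auto simp: N_def\<close>)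
    also have "\<dots> = (\<integral>\<^sup>+p. ennreal (w (fst p) (snd p)) * indicator A (s (fst p) (snd p)) \<partial>?P)"
      by (intro nn_integral_cong) (auto simp: N_def indicator_def)
    also have "\<dots> = (\<integral>\<^sup>+i. \<integral>\<^sup>+\<omega>. ennreal (w i \<omega>) * indicator A (s i \<omega>) \<partial>M \<partial>?C)"
      using A(1) by (subst nn_integral_fst[symmetric]) auto
    also have "\<dots> = (\<Sum>i\<in>UNIV. \<integral>\<^sup>+\<omega>. ennreal (w i \<omega>) * indicator A (s i \<omega>) \<partial>M)"
      by (simp add: nn_integral_count_space_finite)
    finally show ?thesis .
  qed
  have "emeasure \<nu> (space \<nu>) < \<infinity>"
  proof -
    have "emeasure \<nu> (sphere 0 1) = (\<Sum>i\<in>UNIV. \<integral>\<^sup>+\<omega>. ennreal (w i \<omega>) * indicator (sphere 0 1) (s i \<omega>) \<partial>M)"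
      by (rule em) auto
    also have "\<dots> = (\<Sum>i\<in>UNIV. \<integral>\<^sup>+\<omega>. ennreal (w i \<omega>) \<partial>M)"
      using sph by (intro sum.cong nn_integral_cong) auto
    also have "\<dots> = (\<Sum>i\<in>UNIV. ennreal (expectation (w i)))"
      using w w0 by (intro sum.cong nn_integral_eq_integral) auto
    also have "\<dots> < \<infinity>" by (simp add: sum_ennreal Bochner_Integration.integral_nonneg w0)
    finally show ?thesis by (simp add: \<nu>_def space_restrict_space)
  qed
  then have fin: "finite_measure \<nu>" by (intro finite_measureI) auto
  have li: "(LINT x|\<nu>. f x) = (\<Sum>i\<in>UNIV. expectation (\<lambda>\<omega>. w i \<omega> * f (s i \<omega>)))"
    if f[measurable]: "f \<in> borel_measurable borel" and B: "\<And>x. norm x = 1 \<Longrightarrow> \<bar>f x\<bar> \<le> B" for f :: "'b \<Rightarrow> real" and B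
  proof -
    have int_i: "integrable M (\<lambda>\<omega>. w i \<omega> * f (s i \<omega>))" for i
    proof (rule Bochner_Integration.integrable_bound)
      show "integrable M (\<lambda>\<omega>. w i \<omega> * B)" using w by simp
      show "AE \<omega> in M. norm (w i \<omega> * f (s i \<omega>)) \<le> norm (w i \<omega> * B)"
        using B[OF sph] w0 by (intro AE_I2) (auto simp: abs_mult intro!: mult_left_mono order_trans[OF B[OF sph]])
    qed measurable
    have int: "integrable ?P (\<lambda>(i, \<omega>). w i \<omega> * f (s i \<omega>))"
    proof (rule P.Fubini_integrable)
      show "(\<lambda>(i, \<omega>). w i \<omega> * f (s i \<omega>)) \<in> borel_measurable ?P" by (simp add: split_beta')
      show "integrable ?C (\<lambda>i. LINT \<omega>|M. norm (case (i, \<omega>) of (i, \<omega>) \<Rightarrow> w i \<omega> * f (s i \<omega>)))"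
        by (simp add: integrable_count_space)
      show "AE i in ?C. integrable M (\<lambda>\<omega>. case (i, \<omega>) of (i, \<omega>) \<Rightarrow> w i \<omega> * f (s i \<omega>))"
        using int_i by simp
    qed
    have "(LINT x|\<nu>. f x) = (LINT p|N. f (s (fst p) (snd p)))"
      unfolding \<nu>_def by (rule integral_distr[OF sN]) (simp add: measurable_restrict_space1)
    also have "\<dots> = (LINT p|?P. w (fst p) (snd p) * f (s (fst p) (snd p)))"
      unfolding N_def using w0 by (subst integral_density) auto
    also have "\<dots> = (LINT i|?C. LINT \<omega>|M. w i \<omega> * f (s i \<omega>))"
      using P.integral_fst[OF int] by (simp add: split_beta')
    also have "\<dots> = (\<Sum>i\<in>UNIV. expectation (\<lambda>\<omega>. w i \<omega> * f (s i \<omega>)))"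
      by (simp add: lebesgue_integral_count_space_finite)
    finally show ?thesis .
  qed
  have "sets \<nu> = sets ?S" by (simp add: \<nu>_def)
  moreover have "(LINT x|\<nu>. f x) = (\<Sum>i\<in>UNIV. expectation (\<lambda>\<omega>. w i \<omega> * f (s i \<omega>)))"
    if "f \<in> borel_measurable borel" "\<forall>x\<in>sphere 0 1. \<bar>f x\<bar> \<le> B" for f :: "'b \<Rightarrow> real" and B
    using that by (intro li[of f B]) auto
  ultimately show ?thesis using fin em by blast
qed

lemma radial_integral_bound:
  fixes W :: "'a::euclidean_space \<Rightarrow> real"
  assumes W: "W \<in> test_functions" and \<alpha>: "0 < \<alpha>" "\<alpha> < 2"
  obtains B where "\<And>s. norm s = 1 \<Longrightarrow> \<bar>radial_integral \<alpha> W s\<bar> \<le> B"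
proof -
  obtain C where C: "0 < C" "\<And>x. \<bar>W x\<bar> \<le> C * trunc_sq x"
    using test_functionsD(4)[OF W] by auto
  have "\<bar>radial_integral \<alpha> W s\<bar> \<le> (LINT r:{0<..}|lborel. C * (trunc_sq r / r powr (1 + \<alpha>)))" if s: "norm s = 1" for s :: 'a
    unfolding radial_integral_def set_lebesgue_integral_def real_norm_def[symmetric]
  proof (rule Bochner_Integration.integral_norm_bound_integral)
    show "integrable lborel (\<lambda>r. indicator {0<..} r *\<^sub>R (W (r *\<^sub>R s) / r powr (1 + \<alpha>)))"
      using test_function_set_integrable[OF test_functions_ray[OF W] \<alpha>] by (simp add: set_integrable_def)
    have "set_integrable lborel {0<..} (\<lambda>r. C * (trunc_sq r / r powr (1 + \<alpha>)))"
      by (intro set_integrable_mult_right test_function_set_integrable[OF trunc_sq_test_function \<alpha>])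
    then show "integrable lborel (\<lambda>r. indicator {0<..} r *\<^sub>R (C * (trunc_sq r / r powr (1 + \<alpha>))))"
      by (simp add: set_integrable_def)
    fix r :: real
    have "trunc_sq (r *\<^sub>R s) = trunc_sq r" using s by (simp add: trunc_sq_def)
    then have "\<bar>W (r *\<^sub>R s)\<bar> \<le> C * trunc_sq r" using C(2)[of "r *\<^sub>R s"] by simp
    then have "\<bar>W (r *\<^sub>R s)\<bar> / r powr (1 + \<alpha>) \<le> C * trunc_sq r / r powr (1 + \<alpha>)" by (rule divide_right_mono) simp
    then show "norm (indicator {0<..} r *\<^sub>R (W (r *\<^sub>R s) / r powr (1 + \<alpha>))) \<le> indicator {0<..} r *\<^sub>R (C * (trunc_sq r / r powr (1 + \<alpha>)))"
      by (simp add: indicator_def)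
  qed
  then show ?thesis by (rule that)
qed

text \<open>
  Interchange of the radial and the spherical integral; on the sphere a test function is dominated
  by a multiple of the radial function \<open>trunc_sq r\<close>.
\<close>
lemma polar_integral:
  fixes W :: "'a::euclidean_space \<Rightarrow> real"
  assumes W: "W \<in> test_functions" and \<alpha>: "0 < \<alpha>" "\<alpha> < 2"
    and \<nu>: "sets \<nu> = sets (restrict_space borel (sphere 0 1 :: 'a set))" "finite_measure \<nu>"
  shows "(LINT r:{0<..}|lborel. (LINT s|\<nu>. W (r *\<^sub>R s)) / r powr (1 + \<alpha>)) = (LINT s|\<nu>. radial_integral \<alpha> W s)"
proof -
  interpret \<nu>: finite_measure \<nu> by fact
  interpret P: pair_sigma_finite lborel \<nu> ..
  note [measurable] = test_functionsD(2)[OF W]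
  have sp: "space \<nu> = sphere 0 1" using sets_eq_imp_space_eq[OF \<nu>(1)] by (simp add: space_restrict_space)
  have id[measurable]: "(\<lambda>s. s) \<in> borel_measurable \<nu>"
    unfolding measurable_cong_sets[OF \<nu>(1) refl] by (simp add: measurable_restrict_space1)
  obtain C where C: "0 < C" "\<And>x. \<bar>W x\<bar> \<le> C * trunc_sq x"
    using test_functionsD(4)[OF W] by auto
  define g where "g r = indicator {0<..} r * (C * (trunc_sq r / r powr (1 + \<alpha>)))" for r :: real
  define f where "f r s = indicator {0<..} r * (W (r *\<^sub>R s) / r powr (1 + \<alpha>))" for r :: real and s :: 'a
  have "set_integrable lborel {0<..} (\<lambda>r. C * (trunc_sq r / r powr (1 + \<alpha>)))"
    by (intro set_integrable_mult_right test_function_set_integrable[OF trunc_sq_test_function \<alpha>])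
  then have g: "integrable lborel g" by (simp add: set_integrable_def g_def [abs_def])
  then have [measurable]: "g \<in> borel_measurable borel" by auto
  have g_int: "integrable (lborel \<Otimes>\<^sub>M \<nu>) (\<lambda>(r, s). g r)"
    by (rule P.Fubini_integrable) (use g in \<open>auto intro!: integrable_mult_left simp: integrable_norm\<close>)
  have fm[measurable]: "(\<lambda>(r, s). f r s) \<in> borel_measurable (lborel \<Otimes>\<^sub>M \<nu>)"
  proof -
    have [measurable]: "(\<lambda>p. snd p) \<in> borel_measurable (lborel \<Otimes>\<^sub>M \<nu>)"
      by (rule measurable_compose[OF measurable_snd id])
    have [measurable]: "(\<lambda>p. fst p) \<in> borel_measurable (lborel \<Otimes>\<^sub>M \<nu>)"
      using measurable_fst[of lborel \<nu>] by simp
    show ?thesis unfolding f_def split_beta' by measurable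
  qed
  have f_int: "integrable (lborel \<Otimes>\<^sub>M \<nu>) (\<lambda>(r, s). f r s)"
  proof (rule Bochner_Integration.integrable_bound[OF g_int fm])
    have "norm (f r s) \<le> norm (g r)" if "norm s = 1" for r s
    proof -
      have "trunc_sq (r *\<^sub>R s) = trunc_sq r" using that by (simp add: trunc_sq_def)
      then have "\<bar>W (r *\<^sub>R s)\<bar> \<le> C * trunc_sq r" using C(2)[of "r *\<^sub>R s"] by simp
      then have "\<bar>W (r *\<^sub>R s)\<bar> / r powr (1 + \<alpha>) \<le> C * trunc_sq r / r powr (1 + \<alpha>)" by (rule divide_right_mono) simp
      then show ?thesis using C(1) by (simp add: f_def g_def indicator_def)
    qed
    then show "AE p in lborel \<Otimes>\<^sub>M \<nu>. norm (case p of (r, s) \<Rightarrow> f r s) \<le> norm (case p of (r, s) \<Rightarrow> g r)"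
      by (intro AE_I2) (auto simp: space_pair_measure sp)
  qed
  have "(LINT r:{0<..}|lborel. (LINT s|\<nu>. W (r *\<^sub>R s)) / r powr (1 + \<alpha>)) = (LINT r|lborel. LINT s|\<nu>. f r s)"
    by (simp add: set_lebesgue_integral_def f_def)
  also have "\<dots> = (LINT s|\<nu>. LINT r|lborel. f r s)"
    by (rule P.Fubini_integral[OF f_int, symmetric])
  also have "\<dots> = (LINT s|\<nu>. radial_integral \<alpha> W s)"
    by (simp add: radial_integral_def set_lebesgue_integral_def f_def)
  finally show ?thesis .
qed

section \<open>The vector of monomials\<close>

lemma vec_measurableI:
  fixes f :: "'a \<Rightarrow> real ^ 'm::finite"
  assumes "\<And>i. (\<lambda>\<omega>. f \<omega> $ i) \<in> borel_measurable N"
  shows "f \<in> borel_measurable N"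
  unfolding borel_measurable_euclidean_space[of f]
  by (auto simp: Basis_vec_def inner_axis intro!: assms)

lemma norm_powr_le_sum:
  fixes x :: "real ^ 'm::finite"
  assumes p: "0 < p"
  shows "norm x powr p \<le> real CARD('m) powr p * (\<Sum>i\<in>UNIV. \<bar>x $ i\<bar> powr p)"
proof -
  obtain i0 where i0: "\<And>i. \<bar>x $ i\<bar> \<le> \<bar>x $ i0\<bar>"
  proof -
    have fin: "finite (range (\<lambda>i. \<bar>x $ i\<bar>))" "range (\<lambda>i. \<bar>x $ i\<bar>) \<noteq> {}" by auto
    obtain i0 where "Max (range (\<lambda>i. \<bar>x $ i\<bar>)) = \<bar>x $ i0\<bar>"
      using Max_in[OF fin] unfolding image_iff by blast
    then show ?thesis using Max_ge[OF fin(1)] that by (metis rangeI)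
  qed
  have "norm x \<le> (\<Sum>i\<in>UNIV. \<bar>x $ i\<bar>)" by (rule norm_le_l1_cart)
  also have "\<dots> \<le> (\<Sum>i::'m\<in>UNIV. \<bar>x $ i0\<bar>)" by (intro sum_mono i0)
  finally have "norm x \<le> real CARD('m) * \<bar>x $ i0\<bar>" by simp
  then have "norm x powr p \<le> (real CARD('m) * \<bar>x $ i0\<bar>) powr p" using p by (intro powr_mono2) auto
  also have "\<dots> = real CARD('m) powr p * \<bar>x $ i0\<bar> powr p" by (rule powr_mult)
  also have "\<bar>x $ i0\<bar> powr p \<le> (\<Sum>i\<in>UNIV. \<bar>x $ i\<bar> powr p)" by (rule member_le_sum) auto
  finally show ?thesis by (simp add: mult_left_mono)
qed

lemma trunc_sq_le_sum:
  fixes x :: "real ^ 'm::finite"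
  shows "trunc_sq x \<le> (\<Sum>i\<in>UNIV. trunc_sq (x $ i))"
proof -
  have sq: "(norm x)\<^sup>2 = (\<Sum>i\<in>UNIV. (x $ i)\<^sup>2)"
    by (simp add: norm_vec_def L2_set_def sum_nonneg)
  have "trunc_sq x = (\<Sum>i\<in>UNIV. (x $ i)\<^sup>2 / (1 + (norm x)\<^sup>2))"
    by (simp add: trunc_sq_def sq sum_divide_distrib)
  also have "\<dots> \<le> (\<Sum>i\<in>UNIV. (x $ i)\<^sup>2 / (1 + (x $ i)\<^sup>2))"
  proof (intro sum_mono divide_left_mono)
    fix i
    have "(x $ i)\<^sup>2 \<le> (norm x)\<^sup>2" using component_le_norm_cart[of x i] by (simp add: abs_le_square_iff[symmetric])
    then show "1 + (x $ i)\<^sup>2 \<le> 1 + (norm x)\<^sup>2" by simp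
    show "0 < (1 + (norm x)\<^sup>2) * (1 + (x $ i)\<^sup>2)" by (intro mult_pos_pos add_pos_nonneg) auto
  qed auto
  finally show ?thesis by (simp add: trunc_sq_def)
qed

lemma radial_integral_pos:
  fixes W :: "'a::euclidean_space \<Rightarrow> real"
  assumes W: "W \<in> test_functions" and \<alpha>: "0 < \<alpha>" "\<alpha> < 2"
    and W0: "\<And>r. 0 \<le> W (r *\<^sub>R s)" and pos: "\<And>r. 0 < r \<Longrightarrow> 0 < W (r *\<^sub>R s)"
  shows "0 < radial_integral \<alpha> W s"
proof -
  let ?f = "\<lambda>r. indicator {0<..} r *\<^sub>R (W (r *\<^sub>R s) / r powr (1 + \<alpha>))"
  have int: "integrable lborel ?f"
    using test_function_set_integrable[OF test_functions_ray[OF W] \<alpha>] by (simp add: set_integrable_def)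
  have nn: "0 \<le> ?f r" for r using W0 by simp
  have "radial_integral \<alpha> W s \<noteq> 0"
  proof
    assume "radial_integral \<alpha> W s = 0"
    then have "AE r in lborel. ?f r = 0"
      unfolding radial_integral_def set_lebesgue_integral_def
      by (subst (asm) integral_nonneg_eq_0_iff_AE[OF int]) (use nn in auto)
    then have "AE r in lborel. r \<notin> {0<..<1::real}"
    proof eventually_elim
      case (elim r)
      then show ?case using pos[of r] by (auto simp: indicator_def)
    qed
    moreover have "{u. \<not> u \<notin> {0<..<1::real}} = {0<..<1}" by auto
    ultimately have "emeasure lborel {0<..<1::real} = 0" by (subst (asm) AE_iff_measurable[OF _ refl]) auto
    then show False by simp
  qed
  moreover have "0 \<le> radial_integral \<alpha> W s"
    unfolding radial_integral_def set_lebesgue_integral_def by (rule Bochner_Integration.integral_nonneg[OF nn])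
  ultimately show ?thesis by simp
qed

text \<open>
  The exponents \<open>e\<close> enumerate \<open>\<Theta>\<close>, and \<open>K\<close> stands for \<open>k\<^sub>*\<close>. The assumptions say that no coordinate
  has a heavier tail than the rate with parameters \<open>\<alpha>s\<close> and \<open>K\<close>.
\<close>
locale monomial_vector = heavy_tails M X \<alpha> k c_plus c_minus \<alpha>s
  for M :: "'w measure" and X :: "'l::finite \<Rightarrow> 'w \<Rightarrow> real"
    and \<alpha> k c_plus c_minus :: "'l \<Rightarrow> real" and \<alpha>s :: real +
  fixes e :: "'m::finite \<Rightarrow> 'l \<Rightarrow> nat" and K :: real
  assumes e_inj: "inj e"
    and e_le: "\<And>i j. real (e i j) * \<alpha>s \<le> \<alpha> j"
    and K_nonneg: "0 \<le> K"
    and weight_le: "\<And>i. weight (crit (\<lambda>j. real (e i j))) \<le> K"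
begin

definition critical :: "'m \<Rightarrow> 'l set" where "critical i = crit (\<lambda>j. real (e i j))"

definition dominant :: "'m \<Rightarrow> bool" where "dominant i \<longleftrightarrow> weight (critical i) = K"

definition blocks :: "'l set set" where "blocks = critical ` {i. dominant i}"

text \<open>
  The exponent \<open>\<sigma>\<^sub>j = \<alpha>\<^sub>j / \<alpha>s\<close> of a critical factor is the same in all monomials. The floor recovers
  this natural number from the real quotient.
\<close>
definition n_exp :: "'l \<Rightarrow> nat" where "n_exp j = nat \<lfloor>\<alpha> j / \<alpha>s\<rfloor>"

definition U :: "'l set \<Rightarrow> 'w \<Rightarrow> real" where "U J \<omega> = (\<Prod>j\<in>J. X j \<omega> ^ n_exp j)"

definition cofactor :: "'l set \<Rightarrow> ('l \<Rightarrow> real) \<Rightarrow> real ^ 'm" where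
  "cofactor J x = (\<chi> i. if dominant i \<and> critical i = J then \<Prod>j\<in>-J. x j ^ e i j else 0)"

abbreviation V :: "'l set \<Rightarrow> 'w \<Rightarrow> real ^ 'm" where "V J \<omega> \<equiv> cofactor J (\<lambda>j. X j \<omega>)"

abbreviation Z :: "'w \<Rightarrow> real ^ 'm" where "Z \<omega> \<equiv> monomial_vec e (\<lambda>j. X j \<omega>)"

text \<open>
  The projection to the coordinates with critical set \<open>J\<close>; for them the heavy factor \<open>U J\<close> is a common
  one.
\<close>
definition block :: "'l set \<Rightarrow> real ^ 'm \<Rightarrow> real ^ 'm" where
  "block J x = (\<chi> i. if dominant i \<and> critical i = J then x $ i else 0)"

lemma cofactor_zero: "\<not> dominant i \<Longrightarrow> cofactor J x $ i = 0"
  by (simp add: cofactor_def)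

lemma crit_exponent: "j \<in> critical i \<Longrightarrow> e i j = n_exp j"
proof -
  assume "j \<in> critical i"
  then have "\<alpha> j / \<alpha>s = real (e i j)" using \<alpha>s by (simp add: critical_def crit_def field_simps)
  then show ?thesis by (simp add: n_exp_def)
qed

lemma n_exp_index: "J \<in> blocks \<Longrightarrow> j \<in> J \<Longrightarrow> real (n_exp j) * \<alpha>s = \<alpha> j \<and> 0 < n_exp j"
proof -
  assume "J \<in> blocks" "j \<in> J"
  then obtain i where i: "j \<in> critical i" by (auto simp: blocks_def)
  then have "real (n_exp j) * \<alpha>s = \<alpha> j" using crit_exponent[OF i] by (simp add: critical_def crit_def)
  moreover from this have "n_exp j \<noteq> 0" using \<alpha>_pos[of j] by (metis mult_zero_left of_nat_0 less_irrefl)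
  ultimately show ?thesis by blast
qed

lemma Z_measurable [measurable]: "Z \<in> borel_measurable M"
  by (rule vec_measurableI) (simp add: monomial_vec_def monomial_fun_def)

lemma V_measurable [measurable]: "V J \<in> borel_measurable M"
  by (rule vec_measurableI) (simp add: cofactor_def)

lemma block_Z: "block J (Z \<omega>) = U J \<omega> *\<^sub>R V J \<omega>"
proof (rule vec_eq_iff[THEN iffD2], rule allI)
  fix i
  show "block J (Z \<omega>) $ i = (U J \<omega> *\<^sub>R V J \<omega>) $ i"
  proof (cases "dominant i \<and> critical i = J")
    case True
    have "monomial_fun (e i) (\<lambda>j. X j \<omega>) = (\<Prod>j\<in>J. X j \<omega> ^ e i j) * (\<Prod>j\<in>-J. X j \<omega> ^ e i j)"
      unfolding monomial_fun_def by (subst prod.union_disjoint[symmetric]) (auto intro: prod.cong)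
    also have "(\<Prod>j\<in>J. X j \<omega> ^ e i j) = U J \<omega>"
      unfolding U_def using True crit_exponent by (intro prod.cong) auto
    finally show ?thesis using True by (simp add: block_def cofactor_def monomial_vec_def)
  qed (auto simp: block_def cofactor_def)
qed

lemma U_tails:
  "\<exists>a b. \<forall>J\<in>blocks. 0 < a J + b J \<and> upper_tail M (U J) \<alpha>s K (a J) \<and> upper_tail M (\<lambda>\<omega>. - U J \<omega>) \<alpha>s K (b J)"
proof -
  have "\<exists>a b. 0 < a + b \<and> upper_tail M (U J) \<alpha>s K a \<and> upper_tail M (\<lambda>\<omega>. - U J \<omega>) \<alpha>s K b" if J: "J \<in> blocks" for J
  proof -
    have w: "weight J = K" using J by (auto simp: blocks_def dominant_def)
    have ne: "J \<noteq> {}" using w K_nonneg by (auto simp: weight_def)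
    have "\<exists>a b. 0 < a + b \<and> upper_tail M (\<lambda>\<omega>. \<Prod>j\<in>J. X j \<omega> ^ n_exp j) \<alpha>s (real (card J) - 1 + (\<Sum>j\<in>J. k j)) a
      \<and> upper_tail M (\<lambda>\<omega>. - (\<Prod>j\<in>J. X j \<omega> ^ n_exp j)) \<alpha>s (real (card J) - 1 + (\<Sum>j\<in>J. k j)) b"
    proof (rule prod_two_sided_tail)
      show "indep_vars (\<lambda>_. borel) (\<lambda>j \<omega>. X j \<omega> ^ n_exp j) J"
        by (rule indep_vars_compose2[OF indep_vars_subset[OF indep]]) auto
      fix j assume "j \<in> J"
      from n_exp_index[OF J this]
      show "\<exists>a b. 0 < a + b \<and> upper_tail M (\<lambda>\<omega>. X j \<omega> ^ n_exp j) \<alpha>s (k j) a \<and> upper_tail M (\<lambda>\<omega>. - (X j \<omega> ^ n_exp j)) \<alpha>s (k j) b"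
        using tail_plus[of j] tail_minus[of j] c_pos[of j] by (intro power_tails) auto
    qed (use ne \<alpha>s k_nonneg in auto)
    then show ?thesis unfolding w[unfolded weight_def] U_def [abs_def] .
  qed
  then show ?thesis by metis
qed

lemma cofactor_joint:
  "distr M borel (U J) \<Otimes>\<^sub>M distr M borel (V J) = distr M (borel \<Otimes>\<^sub>M borel) (\<lambda>\<omega>. (U J \<omega>, V J \<omega>))"
  unfolding U_def [abs_def]
proof (rule block_independence[where f="\<lambda>x :: 'l \<Rightarrow> real. \<Prod>j\<in>J. x j ^ n_exp j" and V="cofactor J" and A=J and B="- J"])
  show "(\<lambda>x :: 'l \<Rightarrow> real. \<Prod>j\<in>J. x j ^ n_exp j) \<in> borel_measurable (PiM J (\<lambda>_. borel))"
    by (intro borel_measurable_prod borel_measurable_power measurable_component_singleton)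
  show "cofactor J \<in> borel_measurable (PiM (- J) (\<lambda>_. borel))"
  proof (rule vec_measurableI)
    fix i
    have "(\<lambda>x :: 'l \<Rightarrow> real. \<Prod>j\<in>-J. x j ^ e i j) \<in> borel_measurable (PiM (- J) (\<lambda>_. borel))"
      by (intro borel_measurable_prod borel_measurable_power measurable_component_singleton)
    then show "(\<lambda>x. cofactor J x $ i) \<in> borel_measurable (PiM (- J) (\<lambda>_. borel))"
      by (cases "dominant i \<and> critical i = J") (auto simp: cofactor_def)
  qed
qed (auto simp: cofactor_def intro!: prod.cong vec_eq_iff[THEN iffD2])

lemma V_integrable: "integrable M (\<lambda>\<omega>. norm (V J \<omega>) powr \<alpha>s)"
proof (rule Bochner_Integration.integrable_bound)
  have comp: "integrable M (\<lambda>\<omega>. \<bar>V J \<omega> $ i\<bar> powr \<alpha>s)" for i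
  proof (cases "dominant i \<and> critical i = J")
    case True
    have "integrable M (\<lambda>\<omega>. (\<Prod>j\<in>-J. abs_pow (X j \<omega>) (real (e i j))) powr \<alpha>s)"
    proof (rule abs_block_integrable)
      fix j assume "j \<in> - J"
      then have "real (e i j) * \<alpha>s \<noteq> \<alpha> j" using True by (auto simp: critical_def crit_def)
      then show "0 \<le> real (e i j) \<and> real (e i j) * \<alpha>s < \<alpha> j" using e_le[of i j] by auto
    qed
    moreover have "V J \<omega> $ i = (\<Prod>j\<in>-J. X j \<omega> ^ e i j)" for \<omega>
      unfolding cofactor_def using True by simp
    ultimately show ?thesis by (simp add: abs_prod abs_pow_of_nat power_abs)
  next
    case False
    have "V J \<omega> $ i = 0" for \<omega> unfolding cofactor_def vec_lambda_beta by (rule if_not_P[OF False])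
    then show ?thesis by simp
  qed
  show "integrable M (\<lambda>\<omega>. real CARD('m) powr \<alpha>s * (\<Sum>i\<in>UNIV. \<bar>V J \<omega> $ i\<bar> powr \<alpha>s))"
    by (intro integrable_mult_right Bochner_Integration.integrable_sum comp)
  show "AE \<omega> in M. norm (norm (V J \<omega>) powr \<alpha>s) \<le> norm (real CARD('m) powr \<alpha>s * (\<Sum>i\<in>UNIV. \<bar>V J \<omega> $ i\<bar> powr \<alpha>s))"
    using norm_powr_le_sum[OF \<alpha>s(1)] by (intro AE_I2) (simp add: sum_nonneg abs_of_nonneg)
qed measurable

lemma abs_Z: "\<bar>Z \<omega> $ i\<bar> = abs_monomial (\<lambda>j. real (e i j)) \<omega>"
  by (simp add: monomial_vec_def monomial_fun_def abs_monomial_def abs_prod abs_pow_of_nat power_abs)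

lemma Z_moment_bounded:
  "\<exists>B. \<forall>\<^sub>F z in at_top. rate \<alpha>s K z * expectation (\<lambda>\<omega>. trunc_sq (Z \<omega> /\<^sub>R z)) \<le> B"
proof -
  have "\<exists>B. \<forall>\<^sub>F z in at_top. rate \<alpha>s K z * expectation (\<lambda>\<omega>. trunc_sq (abs_monomial (\<lambda>j. real (e i j)) \<omega> / z)) \<le> B" for i
    using e_le K_nonneg weight_le by (intro abs_monomial_bounded) auto
  then obtain B where B: "\<And>i. \<forall>\<^sub>F z in at_top. rate \<alpha>s K z * expectation (\<lambda>\<omega>. trunc_sq (abs_monomial (\<lambda>j. real (e i j)) \<omega> / z)) \<le> B i"
    by metis
  have "\<forall>\<^sub>F z in at_top. \<forall>i\<in>UNIV. rate \<alpha>s K z * expectation (\<lambda>\<omega>. trunc_sq (abs_monomial (\<lambda>j. real (e i j)) \<omega> / z)) \<le> B i"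
    by (rule eventually_ball_finite) (use B in auto)
  then have "\<forall>\<^sub>F z in at_top. rate \<alpha>s K z * expectation (\<lambda>\<omega>. trunc_sq (Z \<omega> /\<^sub>R z)) \<le> (\<Sum>i\<in>UNIV. B i)"
    using eventually_gt_at_top[of 0]
  proof eventually_elim
    case (elim z)
    have int: "integrable M (\<lambda>\<omega>. trunc_sq (abs_monomial (\<lambda>j. real (e i j)) \<omega> / z))" for i
      by (rule integrable_test_function[OF trunc_sq_test_function]) measurable
    have comp: "trunc_sq ((Z \<omega> /\<^sub>R z) $ i) = trunc_sq (abs_monomial (\<lambda>j. real (e i j)) \<omega> / z)" for \<omega> i
    proof -
      have "norm ((Z \<omega> /\<^sub>R z) $ i) = norm (abs_monomial (\<lambda>j. real (e i j)) \<omega> / z)"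
        unfolding abs_Z[symmetric] using elim(2) by (simp add: abs_mult divide_inverse mult.commute)
      then show ?thesis by (metis trunc_sq_norm)
    qed
    have "expectation (\<lambda>\<omega>. trunc_sq (Z \<omega> /\<^sub>R z)) \<le> expectation (\<lambda>\<omega>. \<Sum>i\<in>UNIV. trunc_sq (abs_monomial (\<lambda>j. real (e i j)) \<omega> / z))"
    proof (intro integral_mono Bochner_Integration.integrable_sum int)
      show "integrable M (\<lambda>\<omega>. trunc_sq (Z \<omega> /\<^sub>R z))"
        by (rule integrable_test_function[OF trunc_sq_test_function]) measurable
      show "trunc_sq (Z \<omega> /\<^sub>R z) \<le> (\<Sum>i\<in>UNIV. trunc_sq (abs_monomial (\<lambda>j. real (e i j)) \<omega> / z))" for \<omega>
        using trunc_sq_le_sum[of "Z \<omega> /\<^sub>R z"] unfolding comp .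
    qed
    also have "\<dots> = (\<Sum>i\<in>UNIV. expectation (\<lambda>\<omega>. trunc_sq (abs_monomial (\<lambda>j. real (e i j)) \<omega> / z)))"
      by (rule Bochner_Integration.integral_sum) (rule int)
    finally have "rate \<alpha>s K z * expectation (\<lambda>\<omega>. trunc_sq (Z \<omega> /\<^sub>R z))
        \<le> rate \<alpha>s K z * (\<Sum>i\<in>UNIV. expectation (\<lambda>\<omega>. trunc_sq (abs_monomial (\<lambda>j. real (e i j)) \<omega> / z)))"
      by (rule mult_left_mono) (rule rate_nonneg)
    also have "\<dots> \<le> (\<Sum>i\<in>UNIV. B i)"
      unfolding sum_distrib_left using elim(1) by (intro sum_mono) auto
    finally show ?case .
  qed
  then show ?thesis by blast
qed

text \<open>
  The geometric mean of two monomials is a monomial with averaged exponents, and it is critical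
  exactly where both are.
\<close>
lemma joint_exceedance_negligible:
  assumes "weight (critical i \<inter> critical i') < K"
  shows "((\<lambda>z. rate \<alpha>s K z * expectation (\<lambda>\<omega>. trunc_sq (sqrt \<bar>Z \<omega> $ i * Z \<omega> $ i'\<bar> / z))) \<longlongrightarrow> 0) at_top"
proof -
  define \<tau> where "\<tau> j = (real (e i j) + real (e i' j)) / 2" for j
  have \<tau>: "0 \<le> \<tau> j \<and> \<tau> j * \<alpha>s \<le> \<alpha> j" for j
    using e_le[of i j] e_le[of i' j] by (simp add: \<tau>_def field_simps)
  have "\<tau> j * \<alpha>s = \<alpha> j \<longleftrightarrow> real (e i j) * \<alpha>s = \<alpha> j \<and> real (e i' j) * \<alpha>s = \<alpha> j" for j
  proof -
    have eq: "\<tau> j * \<alpha>s = (real (e i j) * \<alpha>s + real (e i' j) * \<alpha>s) / 2" by (simp add: \<tau>_def algebra_simps)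
    have mid: "(a + b) / 2 = c \<longleftrightarrow> a = c \<and> b = c" if "a \<le> c" "b \<le> c" for a b c :: real
      using that by auto
    show ?thesis unfolding eq by (rule mid[OF e_le e_le])
  qed
  then have "crit \<tau> = critical i \<inter> critical i'" by (auto simp: crit_def critical_def)
  then have lim: "((\<lambda>z. rate \<alpha>s K z * expectation (\<lambda>\<omega>. trunc_sq (abs_monomial \<tau> \<omega> / z))) \<longlongrightarrow> 0) at_top"
    using assms K_nonneg by (intro abs_monomial_negligible \<tau>) auto
  have "sqrt \<bar>Z \<omega> $ i * Z \<omega> $ i'\<bar> = abs_monomial \<tau> \<omega>" for \<omega>
  proof -
    have sq: "(abs_pow x (\<tau> j))\<^sup>2 = abs_pow x (real (e i j)) * abs_pow x (real (e i' j))" for x j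
    proof -
      have "\<tau> j + \<tau> j = real (e i j) + real (e i' j)" by (simp add: \<tau>_def)
      then show ?thesis unfolding power2_eq_square using \<tau>[of j] by (simp add: abs_pow_add)
    qed
    have "\<bar>Z \<omega> $ i * Z \<omega> $ i'\<bar> = (abs_monomial \<tau> \<omega>)\<^sup>2"
      unfolding abs_mult abs_Z abs_monomial_def prod.distrib[symmetric] prod_power_distrib sq ..
    then show ?thesis by simp
  qed
  then show ?thesis using lim by simp
qed

text \<open>
  If the critical sets of two coordinates meet in a set of full weight \<open>K\<close>, strict monotonicity of
  the weight forces them to coincide. So a vector without jointly nonzero bad pairs is supported in
  a single block.
\<close>
lemma test_function_block_sum:
  assumes W: "W \<in> test_functions"
    and x: "\<And>i i'. weight (critical i \<inter> critical i') < K \<Longrightarrow> x $ i = 0 \<or> x $ i' = 0"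
  shows "W x = (\<Sum>J\<in>blocks. W (block J x))"
proof (cases "x = 0")
  case True
  have "block J 0 = 0" for J by (simp add: block_def vec_eq_iff)
  then show ?thesis using True test_functionsD(3)[OF W] by simp
next
  case False
  then obtain i where i: "x $ i \<noteq> 0" by (auto simp: vec_eq_iff)
  have same: "dominant i' \<and> critical i' = critical i" if "x $ i' \<noteq> 0" for i'
  proof -
    have le: "weight (critical i) \<le> K" "weight (critical i') \<le> K" using weight_le by (auto simp: critical_def)
    have ge: "K \<le> weight (critical i \<inter> critical i')" using x[of i i'] i that by force
    have "\<not> critical i \<inter> critical i' \<subset> critical i" using weight_strict_mono[of "critical i \<inter> critical i'" "critical i"] le ge by linarith
    moreover have "\<not> critical i \<inter> critical i' \<subset> critical i'" using weight_strict_mono[of "critical i \<inter> critical i'" "critical i'"] le ge by linarith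
    ultimately have "critical i' = critical i" by blast
    moreover have "dominant i'"
      unfolding dominant_def using le ge \<open>critical i' = critical i\<close> by auto
    ultimately show ?thesis by blast
  qed
  have J0: "critical i \<in> blocks" using same[OF i] by (auto simp: blocks_def)
  have "block (critical i) x = x" using same by (auto simp: block_def vec_eq_iff)
  moreover have "block J x = 0" if "J \<noteq> critical i" for J using same that by (auto simp: block_def vec_eq_iff)
  then have "(\<Sum>J\<in>blocks - {critical i}. W (block J x)) = 0" using test_functionsD(3)[OF W] by (intro sum.neutral) auto
  ultimately show ?thesis using J0 by (subst sum.remove[of _ "critical i"]) auto
qed

lemma block_linear: "bounded_linear (block J)"
  by (rule linear_conv_bounded_linear[THEN iffD1], rule linearI) (auto simp: block_def vec_eq_iff)

text \<open>
  The difference between a test function and the sum of its values on the blocks vanishes off the bad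
  pairs, hence is negligible; on each block the limit is that of a product of a heavy variable and an
  independent vector.
\<close>
lemma monomial_limit:
  assumes ab: "\<And>J. J \<in> blocks \<Longrightarrow> upper_tail M (U J) \<alpha>s K (a J) \<and> upper_tail M (\<lambda>\<omega>. - U J \<omega>) \<alpha>s K (b J)"
    and W: "W \<in> test_functions"
  shows "((\<lambda>z. rate \<alpha>s K z * expectation (\<lambda>\<omega>. W (Z \<omega> /\<^sub>R z))) \<longlongrightarrow>
    (\<Sum>J\<in>blocks. expectation (\<lambda>\<omega>. norm (V J \<omega>) powr \<alpha>s * (a J * \<alpha>s * radial_integral \<alpha>s W (sgn (V J \<omega>))
      + b J * \<alpha>s * radial_integral \<alpha>s W (- sgn (V J \<omega>)))))) at_top"
proof -
  have Wb: "(\<lambda>x. W (block J x)) \<in> test_functions" for J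
    by (rule test_functions_bounded_linear[OF W block_linear])
  define D where "D x = W x - (\<Sum>J\<in>blocks. W (block J x))" for x
  have "D \<in> test_functions"
  proof -
    have "\<exists>C. \<forall>x. \<bar>W (block J x)\<bar> \<le> C * trunc_sq x" for J
      using test_functionsD(4)[OF Wb[of J]] by blast
    then obtain C where C: "\<And>J x. \<bar>W (block J x)\<bar> \<le> C J * trunc_sq x" by metis
    obtain C0 where C0: "\<And>x. \<bar>W x\<bar> \<le> C0 * trunc_sq x" using test_functionsD(4)[OF W] by blast
    show ?thesis
    proof (rule test_functionsI)
      show "continuous_on UNIV D"
        unfolding D_def by (intro continuous_intros test_functionsD(1)[OF W] test_functionsD(1)[OF Wb])
      fix x
      have "\<bar>D x\<bar> \<le> \<bar>W x\<bar> + \<bar>\<Sum>J\<in>blocks. W (block J x)\<bar>" unfolding D_def by (rule abs_triangle_ineq4)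
      also have "\<bar>\<Sum>J\<in>blocks. W (block J x)\<bar> \<le> (\<Sum>J\<in>blocks. \<bar>W (block J x)\<bar>)" by (rule sum_abs)
      also have "\<dots> \<le> (\<Sum>J\<in>blocks. C J * trunc_sq x)" by (intro sum_mono C)
      finally show "\<bar>D x\<bar> \<le> (C0 + (\<Sum>J\<in>blocks. C J)) * trunc_sq x"
        using C0[of x] by (simp add: distrib_right sum_distrib_right)
    qed
  qed
  obtain B where B: "\<forall>\<^sub>F z in at_top. rate \<alpha>s K z * expectation (\<lambda>\<omega>. trunc_sq (Z \<omega> /\<^sub>R z)) \<le> B"
    using Z_moment_bounded by blast
  have D: "((\<lambda>z. rate \<alpha>s K z * expectation (\<lambda>\<omega>. D (Z \<omega> /\<^sub>R z))) \<longlongrightarrow> 0) at_top"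
  proof (rule concentration_limit[where B="{(i, i'). weight (critical i \<inter> critical i') < K}",
        OF Z_measurable \<alpha>s \<open>D \<in> test_functions\<close> _ B])
    fix x :: "real ^ 'm" assume x: "\<And>i i'. (i, i') \<in> {(i, i'). weight (critical i \<inter> critical i') < K} \<Longrightarrow> x $ i = 0 \<or> x $ i' = 0"
    have "W x = (\<Sum>J\<in>blocks. W (block J x))" by (rule test_function_block_sum[OF W x]) simp
    then show "D x = 0" by (simp add: D_def)
  qed (use joint_exceedance_negligible in simp)
  have "((\<lambda>z. \<Sum>J\<in>blocks. rate \<alpha>s K z * expectation (\<lambda>\<omega>. W ((U J \<omega> *\<^sub>R V J \<omega>) /\<^sub>R z))) \<longlongrightarrow>
    (\<Sum>J\<in>blocks. expectation (\<lambda>\<omega>. norm (V J \<omega>) powr \<alpha>s * (a J * \<alpha>s * radial_integral \<alpha>s W (sgn (V J \<omega>))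
      + b J * \<alpha>s * radial_integral \<alpha>s W (- sgn (V J \<omega>)))))) at_top"
    using ab by (intro tendsto_sum breiman_limit \<alpha>s K_nonneg V_measurable cofactor_joint V_integrable W) auto
  from tendsto_add[OF D this]
  have "((\<lambda>z. rate \<alpha>s K z * expectation (\<lambda>\<omega>. D (Z \<omega> /\<^sub>R z))
      + (\<Sum>J\<in>blocks. rate \<alpha>s K z * expectation (\<lambda>\<omega>. W ((U J \<omega> *\<^sub>R V J \<omega>) /\<^sub>R z)))) \<longlongrightarrow>
    (\<Sum>J\<in>blocks. expectation (\<lambda>\<omega>. norm (V J \<omega>) powr \<alpha>s * (a J * \<alpha>s * radial_integral \<alpha>s W (sgn (V J \<omega>))
      + b J * \<alpha>s * radial_integral \<alpha>s W (- sgn (V J \<omega>)))))) at_top" by simp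
  moreover have "rate \<alpha>s K z * expectation (\<lambda>\<omega>. D (Z \<omega> /\<^sub>R z))
      + (\<Sum>J\<in>blocks. rate \<alpha>s K z * expectation (\<lambda>\<omega>. W ((U J \<omega> *\<^sub>R V J \<omega>) /\<^sub>R z)))
      = rate \<alpha>s K z * expectation (\<lambda>\<omega>. W (Z \<omega> /\<^sub>R z))" for z
  proof -
    have bl: "block J (Z \<omega> /\<^sub>R z) = (U J \<omega> *\<^sub>R V J \<omega>) /\<^sub>R z" for J \<omega>
      using linear_scale[OF bounded_linear.linear[OF block_linear], of J "inverse z" "Z \<omega>"] by (simp add: block_Z)
    have i1: "integrable M (\<lambda>\<omega>. W (Z \<omega> /\<^sub>R z))" by (rule integrable_test_function[OF W]) measurable
    have i2: "integrable M (\<lambda>\<omega>. W (block J (Z \<omega> /\<^sub>R z)))" for J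
      by (rule integrable_test_function[OF Wb]) measurable
    have eq: "expectation (\<lambda>\<omega>. D (Z \<omega> /\<^sub>R z))
        = expectation (\<lambda>\<omega>. W (Z \<omega> /\<^sub>R z)) - (\<Sum>J\<in>blocks. expectation (\<lambda>\<omega>. W (block J (Z \<omega> /\<^sub>R z))))"
      unfolding D_def using i1 i2 by simp
    show ?thesis
      unfolding sum_distrib_left[symmetric] eq[unfolded bl] by (simp only: right_diff_distrib diff_add_cancel)
  qed
  ultimately show ?thesis by simp
qed

text \<open>
  Within one block the exponents agree on \<open>J\<close>, so they still differ after these factors are removed,
  and the linear form is a polynomial with a nonzero coefficient.
\<close>
lemma cofactor_not_degenerate:
  assumes i: "dominant i" and y: "y $ i \<noteq> 0"
  shows "\<not> (AE \<omega> in M. y \<bullet> V (critical i) \<omega> = 0)"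
proof
  assume AE: "AE \<omega> in M. y \<bullet> V (critical i) \<omega> = 0"
  define J where "J = critical i"
  define I where "I = {i'. dominant i' \<and> critical i' = J}"
  \<comment> \<open>the multi-index of the cofactor\<close>
  define \<theta> where "\<theta> i' = (\<lambda>j. if j \<in> J then 0 else e i' j)" for i'
  have \<theta>_inj: "inj_on \<theta> I"
  proof (rule inj_onI)
    fix i1 i2 assume I: "i1 \<in> I" "i2 \<in> I" and eq: "\<theta> i1 = \<theta> i2"
    have "e i1 j = e i2 j" for j
    proof (cases "j \<in> J")
      case True then show ?thesis using I crit_exponent[of j i1] crit_exponent[of j i2] by (simp add: I_def)
    next
      case False then show ?thesis using fun_cong[OF eq, of j] by (simp add: \<theta>_def)
    qed
    then have "e i1 = e i2" by (rule ext)
    then show "i1 = i2" using e_inj by (simp add: inj_eq)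
  qed
  define c where "c t = y $ (the_inv_into I \<theta> t)" for t
  have c: "c (\<theta> i') = y $ i'" if "i' \<in> I" for i'
    using the_inv_into_f_f[OF \<theta>_inj that] by (simp add: c_def)
  have mono: "monomial_fun (\<theta> i') x = (\<Prod>j\<in>-J. x j ^ e i' j)" for x i'
    unfolding monomial_fun_def \<theta>_def
    by (rule prod.mono_neutral_cong_right) auto
  have "(\<Sum>t\<in>\<theta> ` I. c t * monomial_fun t (\<lambda>j. X j \<omega>)) = y \<bullet> V (critical i) \<omega>" for \<omega>
  proof -
    have "(\<Sum>t\<in>\<theta> ` I. c t * monomial_fun t (\<lambda>j. X j \<omega>)) = (\<Sum>i'\<in>I. y $ i' * (\<Prod>j\<in>-J. X j \<omega> ^ e i' j))"
      by (subst sum.reindex[OF \<theta>_inj]) (simp add: c mono)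
    also have "\<dots> = (\<Sum>i'\<in>UNIV. y $ i' * V J \<omega> $ i')"
      by (rule sum.mono_neutral_cong_left) (auto simp: I_def cofactor_def)
    finally show ?thesis by (simp add: inner_vec_def J_def)
  qed
  then have "AE \<omega> in M. (\<Sum>t\<in>\<theta> ` I. c t * monomial_fun t (\<lambda>j. X j \<omega>)) = 0" using AE by simp
  moreover have "i \<in> I" using i by (simp add: I_def J_def)
  ultimately have "c (\<theta> i) = 0" by (intro polynomial_AE_zero[of "\<theta> ` I"]) auto
  then show False using c[OF \<open>i \<in> I\<close>] y by simp
qed

text \<open>
  The even test function \<open>trunc_sq (y \<bullet> x)\<close> detects both directions \<open>V\<close> and \<open>- V\<close>, with total
  weight \<open>a + b > 0\<close>.
\<close>
lemma limit_positive:
  assumes ab: "\<And>J. J \<in> blocks \<Longrightarrow> 0 < a J + b J \<and> 0 \<le> a J \<and> 0 \<le> b J"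
    and i: "dominant i" and y: "y $ i \<noteq> 0"
  shows "0 < (\<Sum>J\<in>blocks. expectation (\<lambda>\<omega>. norm (V J \<omega>) powr \<alpha>s * (a J * \<alpha>s * radial_integral \<alpha>s (\<lambda>x. trunc_sq (y \<bullet> x)) (sgn (V J \<omega>))
      + b J * \<alpha>s * radial_integral \<alpha>s (\<lambda>x. trunc_sq (y \<bullet> x)) (- sgn (V J \<omega>)))))"
proof -
  define W where "W = (\<lambda>x :: real ^ 'm. trunc_sq (y \<bullet> x))"
  have W: "W \<in> test_functions"
    unfolding W_def by (rule test_functions_bounded_linear[OF trunc_sq_test_function bounded_linear_inner_right])
  note [measurable] = test_functionsD(2)[OF W]
  have sgn_meas[measurable]: "(sgn :: real ^ 'm \<Rightarrow> _) \<in> borel_measurable borel"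
    unfolding sgn_div_norm [abs_def] by measurable
  have R0: "0 \<le> radial_integral \<alpha>s W s" for s
    unfolding radial_integral_def set_lebesgue_integral_def W_def by (intro Bochner_Integration.integral_nonneg) simp
  have even: "radial_integral \<alpha>s W (- s) = radial_integral \<alpha>s W s" for s
    by (simp add: radial_integral_def W_def trunc_sq_def)
  have R_pos: "0 < radial_integral \<alpha>s W s" if "y \<bullet> s \<noteq> 0" for s
    by (rule radial_integral_pos[OF W \<alpha>s]) (use that in \<open>auto simp: W_def trunc_sq_def add_pos_nonneg intro!: divide_pos_pos\<close>)
  define g where "g J \<omega> = norm (V J \<omega>) powr \<alpha>s * ((a J + b J) * \<alpha>s * radial_integral \<alpha>s W (sgn (V J \<omega>)))" for J \<omega>
  have g_eq: "norm (V J \<omega>) powr \<alpha>s * (a J * \<alpha>s * radial_integral \<alpha>s W (sgn (V J \<omega>))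
      + b J * \<alpha>s * radial_integral \<alpha>s W (- sgn (V J \<omega>))) = g J \<omega>" for J \<omega>
    by (simp add: g_def even algebra_simps)
  have g0: "0 \<le> g J \<omega>" if "J \<in> blocks" for J \<omega>
    using ab[OF that] \<alpha>s R0 by (simp add: g_def)
  obtain B where B: "\<And>s. norm s = 1 \<Longrightarrow> \<bar>radial_integral \<alpha>s W s\<bar> \<le> B"
    using radial_integral_bound[OF W \<alpha>s] by blast
  have gm[measurable]: "g J \<in> borel_measurable M" for J
    unfolding g_def by measurable
  have g_int: "integrable M (g J)" if J: "J \<in> blocks" for J
  proof (rule Bochner_Integration.integrable_bound)
    show "integrable M (\<lambda>\<omega>. (a J + b J) * \<alpha>s * B * norm (V J \<omega>) powr \<alpha>s)"
      using V_integrable by simp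
    have "norm (g J \<omega>) \<le> norm ((a J + b J) * \<alpha>s * B * norm (V J \<omega>) powr \<alpha>s)" for \<omega>
    proof (cases "V J \<omega> = 0")
      case False
      then have "norm (sgn (V J \<omega>)) = 1" by (simp add: norm_sgn)
      then have "radial_integral \<alpha>s W (sgn (V J \<omega>)) \<le> B" using B by fastforce
      then have "g J \<omega> \<le> norm (V J \<omega>) powr \<alpha>s * ((a J + b J) * \<alpha>s * B)"
        unfolding g_def using ab[OF J] \<alpha>s by (intro mult_left_mono) auto
      then show ?thesis using g0[OF J, of \<omega>] by (simp add: mult_ac)
    qed (simp add: g_def)
    then show "AE \<omega> in M. norm (g J \<omega>) \<le> norm ((a J + b J) * \<alpha>s * B * norm (V J \<omega>) powr \<alpha>s)" by simp
  qed measurable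
  have J: "critical i \<in> blocks" using i by (auto simp: blocks_def)
  have E0: "0 \<le> expectation (g J)" if "J \<in> blocks" for J
    by (intro Bochner_Integration.integral_nonneg g0[OF that])
  have "expectation (g (critical i)) \<noteq> 0"
  proof
    assume "expectation (g (critical i)) = 0"
    then have "AE \<omega> in M. g (critical i) \<omega> = 0"
      by (subst (asm) integral_nonneg_eq_0_iff_AE[OF g_int[OF J]]) (use g0[OF J] in auto)
    then have "AE \<omega> in M. y \<bullet> V (critical i) \<omega> = 0"
    proof eventually_elim
      case (elim \<omega>)
      show ?case
      proof (rule ccontr)
        assume ne: "y \<bullet> V (critical i) \<omega> \<noteq> 0"
        then have V: "V (critical i) \<omega> \<noteq> 0" by auto
        then have "y \<bullet> sgn (V (critical i) \<omega>) \<noteq> 0" using ne by (simp add: sgn_div_norm)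
        then have "0 < g (critical i) \<omega>" unfolding g_def using V ab[OF J] \<alpha>s R_pos by simp
        then show False using elim by simp
      qed
    qed
    then show False using cofactor_not_degenerate[OF i y] by blast
  qed
  then have "0 < expectation (g (critical i))" using E0[OF J] by simp
  then have "0 < (\<Sum>J\<in>blocks. expectation (g J))"
    using J E0 by (intro sum_pos2[OF _ J]) (auto simp: blocks_def)
  then show ?thesis unfolding W_def[symmetric] g_eq .
qed

text \<open>
  A vector orthogonal to \<open>L\<close> gives a linear relation between the dominant monomials, which must be
  trivial. Hence \<open>L\<close> contains every vector supported on the dominant coordinates.
\<close>
lemma span_of_star_support:
  assumes L: "subspace L" and AE: "AE \<omega> in M. (\<chi> i. if dominant i then monomial_fun (e i) (\<lambda>j. X j \<omega>) else 0) \<in> L"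
    and x: "\<And>i. \<not> dominant i \<Longrightarrow> x $ i = 0"
  shows "x \<in> L"
proof -
  have "y \<bullet> x = 0" if y: "y \<in> L\<^sup>\<bottom>" for y
  proof -
    define G where "G = {i. dominant i}"
    define c where "c t = y $ (the_inv_into G e t)" for t
    have e_inj': "inj_on e G" using e_inj by (rule inj_on_subset) simp
    have c: "c (e i) = y $ i" if "i \<in> G" for i
      using the_inv_into_f_f[OF e_inj' that] by (simp add: c_def)
    have "AE \<omega> in M. (\<Sum>t\<in>e ` G. c t * monomial_fun t (\<lambda>j. X j \<omega>)) = 0"
      using AE
    proof eventually_elim
      case (elim \<omega>)
      have "(\<Sum>t\<in>e ` G. c t * monomial_fun t (\<lambda>j. X j \<omega>)) = (\<Sum>i\<in>G. y $ i * monomial_fun (e i) (\<lambda>j. X j \<omega>))"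
        by (subst sum.reindex[OF e_inj']) (simp add: c)
      also have "\<dots> = y \<bullet> (\<chi> i. if dominant i then monomial_fun (e i) (\<lambda>j. X j \<omega>) else 0)"
        unfolding inner_vec_def by (rule sum.mono_neutral_cong_left) (auto simp: G_def)
      also have "\<dots> = 0" using y elim by (auto simp: orthogonal_comp_def orthogonal_def inner_commute)
      finally show ?case .
    qed
    then have "c (e i) = 0" if "i \<in> G" for i using that by (intro polynomial_AE_zero[of "e ` G"]) auto
    then have "y $ i = 0" if "dominant i" for i using that c[of i] by (simp add: G_def)
    then have "y $ i * x $ i = 0" for i using x[of i] by (cases "dominant i") auto
    then show ?thesis unfolding inner_vec_def inner_real_def by (intro sum.neutral) blast
  qed
  then have "x \<in> L\<^sup>\<bottom>\<^sup>\<bottom>" by (auto simp: orthogonal_comp_def orthogonal_def)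
  then show ?thesis by (simp add: orthogonal_comp_self[OF L])
qed

end

section \<open>The limit theorem\<close>

lemma alpha_index_le: "alpha_index \<alpha> \<theta> \<le> tail_ratio \<alpha> \<theta> j"
  unfolding alpha_index_def by (rule Min_le) auto

lemma alpha_index_attained: "\<exists>j. tail_ratio \<alpha> \<theta> j = alpha_index \<alpha> \<theta>"
proof -
  have "alpha_index \<alpha> \<theta> \<in> range (tail_ratio \<alpha> \<theta>)" unfolding alpha_index_def by (rule Min_in) auto
  then show ?thesis by auto
qed

lemma alpha_star_le: "finite \<Theta> \<Longrightarrow> \<theta> \<in> \<Theta> \<Longrightarrow> alpha_star \<alpha> \<Theta> \<le> alpha_index \<alpha> \<theta>"
  unfolding alpha_star_def by (rule Min_le) auto

lemma alpha_star_attained: "finite \<Theta> \<Longrightarrow> \<Theta> \<noteq> {} \<Longrightarrow> \<exists>\<theta>\<in>\<Theta>. alpha_index \<alpha> \<theta> = alpha_star \<alpha> \<Theta>"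
proof -
  assume "finite \<Theta>" "\<Theta> \<noteq> {}"
  then have "alpha_star \<alpha> \<Theta> \<in> alpha_index \<alpha> ` \<Theta>" unfolding alpha_star_def by (intro Min_in) auto
  then show ?thesis by auto
qed

lemma alpha_star_real:
  assumes \<alpha>: "\<And>j. 0 < \<alpha> j \<and> \<alpha> j < 2" and \<Theta>: "finite \<Theta>" "\<exists>\<theta>\<in>\<Theta>. \<theta> \<noteq> (\<lambda>_. 0)"
  shows "alpha_star \<alpha> \<Theta> = ereal (real_of_ereal (alpha_star \<alpha> \<Theta>))"
    "0 < real_of_ereal (alpha_star \<alpha> \<Theta>)" "real_of_ereal (alpha_star \<alpha> \<Theta>) < 2"
proof -
  obtain \<theta>0 where \<theta>0: "\<theta>0 \<in> \<Theta>" "\<theta>0 \<noteq> (\<lambda>_. 0)" using \<Theta>(2) by blast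
  then obtain j0 where j0: "\<theta>0 j0 \<noteq> 0" by auto
  have "alpha_star \<alpha> \<Theta> \<le> tail_ratio \<alpha> \<theta>0 j0"
    using alpha_star_le[OF \<Theta>(1) \<theta>0(1)] alpha_index_le by (rule order_trans)
  then have fin: "alpha_star \<alpha> \<Theta> \<noteq> \<infinity>" using j0 by (auto simp: tail_ratio_def)
  obtain \<theta>1 j1 where 1: "\<theta>1 \<in> \<Theta>" "tail_ratio \<alpha> \<theta>1 j1 = alpha_star \<alpha> \<Theta>"
    using alpha_star_attained[OF \<Theta>(1)] \<theta>0(1) alpha_index_attained by (metis empty_iff)
  then have n: "\<theta>1 j1 \<noteq> 0" using fin by (metis tail_ratio_def)
  then have eq: "alpha_star \<alpha> \<Theta> = ereal (\<alpha> j1 / real (\<theta>1 j1))" using 1(2) by (simp add: tail_ratio_def)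
  then show "alpha_star \<alpha> \<Theta> = ereal (real_of_ereal (alpha_star \<alpha> \<Theta>))" by simp
  show "0 < real_of_ereal (alpha_star \<alpha> \<Theta>)" using n \<alpha>[of j1] by (simp add: eq)
  have "\<alpha> j1 / real (\<theta>1 j1) \<le> \<alpha> j1 / 1" using n \<alpha>[of j1] by (intro divide_left_mono) auto
  then show "real_of_ereal (alpha_star \<alpha> \<Theta>) < 2" using \<alpha>[of j1] by (simp add: eq)
qed

text \<open>
  By second countability the complement of the support is a null set.
\<close>
lemma AE_in_support:
  fixes L :: "'b::euclidean_space set"
  assumes f: "f \<in> borel_measurable M" and L: "closed L" "measure_support (distr M borel f) \<subseteq> L"
  shows "AE \<omega> in M. f \<omega> \<in> L"
proof -
  let ?\<mu> = "distr M borel f"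
  define \<U> where "\<U> = {U :: 'b set. open U \<and> emeasure ?\<mu> U = 0}"
  obtain \<U>' where \<U>': "\<U>' \<subseteq> \<U>" "countable \<U>'" "\<Union>\<U>' = \<Union>\<U>"
    using Lindelof[of \<U>] by (auto simp: \<U>_def)
  have "(\<Union>U\<in>\<U>'. U) \<in> null_sets ?\<mu>"
    using \<U>' by (intro null_sets_UN') (auto simp: \<U>_def null_sets_def)
  then have null: "\<Union>\<U> \<in> null_sets ?\<mu>" using \<U>'(3) by simp
  have sub: "- L \<subseteq> \<Union>\<U>"
  proof
    fix x assume "x \<in> - L"
    then have "x \<notin> measure_support ?\<mu>" using L(2) by auto
    then obtain U where "open U" "x \<in> U" "\<not> 0 < emeasure ?\<mu> U" by (auto simp: measure_support_def)
    then show "x \<in> \<Union>\<U>" by (auto simp: \<U>_def not_gr_zero)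
  qed
  have "AE x in ?\<mu>. x \<in> L"
    by (rule AE_I'[OF null]) (use sub in auto)
  then show ?thesis using f by (rule AE_distrD[rotated])
qed

theorem theorem2p1:
  fixes M :: "'w measure"
    and X :: "'l::finite \<Rightarrow> 'w \<Rightarrow> real"
    and \<alpha> k c_plus c_minus :: "'l \<Rightarrow> real"
    and \<Theta> :: "('l \<Rightarrow> nat) set"
    and h :: "('l \<Rightarrow> nat) \<Rightarrow> real"
    and e :: "'m::finite \<Rightarrow> 'l \<Rightarrow> nat"
  assumes "prob_space M"
    and "prob_space.indep_vars M (\<lambda>_. borel) X UNIV"
    and "\<And>j. 0 < \<alpha> j \<and> \<alpha> j < 2"
    and "\<And>j. k j \<ge> 0"
    and "\<And>j. c_plus j \<ge> 0 \<and> c_minus j \<ge> 0 \<and> c_plus j + c_minus j > 0"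
    and "\<And>j. ((\<lambda>z. z powr \<alpha> j * ln z powr (- k j) *
                 measure M {\<omega>\<in>space M. X j \<omega> > z}) \<longlongrightarrow> c_plus j) at_top"
    and "\<And>j. ((\<lambda>z. z powr \<alpha> j * ln z powr (- k j) *
                 measure M {\<omega>\<in>space M. - X j \<omega> > z}) \<longlongrightarrow> c_minus j) at_top"
    and "finite \<Theta>"
    and "\<exists>\<theta>\<in>\<Theta>. \<theta> \<noteq> (\<lambda>_. 0)"
    and "\<And>\<theta>. \<theta> \<in> \<Theta> \<Longrightarrow> h \<theta> \<noteq> 0"
    and "bij_betw e UNIV \<Theta>"
  defines "\<alpha>s \<equiv> real_of_ereal (alpha_star \<alpha> \<Theta>)"
    and "ks \<equiv> k_star \<alpha> k \<Theta>"
    and "\<Theta>s \<equiv> Theta_star \<alpha> k \<Theta>"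
    and "Z \<equiv> (\<lambda>\<omega>. monomial_vec e (\<lambda>j. X j \<omega>))"
    and "Zs \<equiv> (\<lambda>\<omega>. star_monomial_vec (Theta_star \<alpha> k \<Theta>) e (\<lambda>j. X j \<omega>))"
    and "Y \<equiv> (\<lambda>\<omega>. polynomial_fun \<Theta> h (\<lambda>j. X j \<omega>))"
  shows
    "(\<exists>\<nu> :: (real ^ 'm) measure.
        sets \<nu> = sets (restrict_space borel (sphere 0 1)) \<and>
        finite_measure \<nu> \<and>
        emeasure \<nu> (sphere 0 1) > 0 \<and>
        (\<forall>W\<in>test_functions.
           ((\<lambda>z. z powr \<alpha>s * ln z powr (- ks) * (LINT \<omega>|M. W (Z \<omega> /\<^sub>R z))) \<longlongrightarrow>
              (LINT r:{0<..}|lborel. (LINT s|\<nu>. W (r *\<^sub>R s)) / r powr (1 + \<alpha>s))) at_top) \<and>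
        (\<forall>L. subspace L \<longrightarrow> dim L = card \<Theta>s \<longrightarrow>
           measure_support (distr M borel Zs) \<subseteq> L \<longrightarrow>
           emeasure \<nu> (sphere 0 1 - (L \<inter> sphere 0 1)) = 0)) \<and>
     (\<exists>cF_plus cF_minus :: real.
        cF_plus \<ge> 0 \<and> cF_minus \<ge> 0 \<and> cF_plus + cF_minus > 0 \<and>
        ((\<lambda>z. z powr \<alpha>s * ln z powr (- ks) *
            measure M {\<omega>\<in>space M. Y \<omega> > z}) \<longlongrightarrow> cF_plus) at_top \<and>
        ((\<lambda>z. z powr \<alpha>s * ln z powr (- ks) *
            measure M {\<omega>\<in>space M. - Y \<omega> > z}) \<longlongrightarrow> cF_minus) at_top)"
proof -
  interpret prob_space M by fact
  have X_meas: "X j \<in> borel_measurable M" for j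
    using assms(2) unfolding indep_vars_def by auto
  have \<alpha>s: "alpha_star \<alpha> \<Theta> = ereal \<alpha>s" "0 < \<alpha>s" "\<alpha>s < 2"
    unfolding \<alpha>s_def using alpha_star_real[OF assms(3,8,9)] by auto
  interpret T: heavy_tails M X \<alpha> k c_plus c_minus \<alpha>s
  proof unfold_locales
    show "indep_vars (\<lambda>_. borel) X UNIV" by (rule assms(2))
    show "upper_tail M (X j) (\<alpha> j) (k j) (c_plus j)" for j
      using assms(6)[of j] X_meas by (simp add: upper_tail_def rate_def)
    show "upper_tail M (\<lambda>\<omega>. - X j \<omega>) (\<alpha> j) (k j) (c_minus j)" for j
      using assms(7)[of j] X_meas by (simp add: upper_tail_def rate_def)
  qed (use assms(3,4,5) \<alpha>s in auto)
  have e_in: "e i \<in> \<Theta>" for i using assms(11) by (auto simp: bij_betw_def)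
  have e_range: "range e = \<Theta>" using assms(11) by (simp add: bij_betw_def)
  define critical where "critical i = T.crit (\<lambda>j. real (e i j))" for i
  have ratio_ge: "ereal \<alpha>s \<le> tail_ratio \<alpha> (e i) j" for i j
    using alpha_star_le[OF assms(8) e_in[of i], of \<alpha>] alpha_index_le[of \<alpha> "e i" j] by (simp add: \<alpha>s(1))
  have e_le: "real (e i j) * \<alpha>s \<le> \<alpha> j" for i j
    using ratio_ge[of i j] assms(3)[of j] by (cases "e i j = 0") (auto simp: tail_ratio_def field_simps)
  have crit_iff: "j \<in> critical i \<longleftrightarrow> tail_ratio \<alpha> (e i) j = ereal \<alpha>s" for i j
    using assms(3)[of j] by (cases "e i j = 0") (auto simp: critical_def T.crit_def tail_ratio_def field_simps)
  have index_iff: "alpha_index \<alpha> (e i) = alpha_star \<alpha> \<Theta> \<longleftrightarrow> critical i \<noteq> {}" for i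
  proof
    assume "alpha_index \<alpha> (e i) = alpha_star \<alpha> \<Theta>"
    then show "critical i \<noteq> {}" using alpha_index_attained[of \<alpha> "e i"] crit_iff \<alpha>s(1) by fastforce
  next
    assume "critical i \<noteq> {}"
    then obtain j where "tail_ratio \<alpha> (e i) j = ereal \<alpha>s" using crit_iff by blast
    then have "alpha_index \<alpha> (e i) \<le> alpha_star \<alpha> \<Theta>" using alpha_index_le[of \<alpha> "e i" j] \<alpha>s(1) by simp
    then show "alpha_index \<alpha> (e i) = alpha_star \<alpha> \<Theta>"
      using alpha_star_le[OF assms(8) e_in[of i], of \<alpha>] by simp
  qed
  have weight_eq: "T.weight (critical i) = k_index \<alpha> k (e i)" if "critical i \<noteq> {}" for i
  proof -
    have "J_index \<alpha> (e i) = critical i" using index_iff[of i] that crit_iff \<alpha>s(1) by (auto simp: J_index_def)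
    then show ?thesis by (simp add: T.weight_def k_index_def p_index_def)
  qed
  let ?A = "{\<theta>\<in>\<Theta>. alpha_index \<alpha> \<theta> = alpha_star \<alpha> \<Theta>}"
  have A: "finite ?A" "?A \<noteq> {}" using assms(8,9) alpha_star_attained[of \<Theta> \<alpha>] by auto
  have k_le: "k_index \<alpha> k (e i) \<le> ks" if "critical i \<noteq> {}" for i
    unfolding ks_def k_star_def using A e_in index_iff that by (intro Max_ge) auto
  have "ks \<in> k_index \<alpha> k ` ?A" unfolding ks_def k_star_def using A by (intro Max_in) auto
  then obtain \<theta>1 where \<theta>1: "\<theta>1 \<in> \<Theta>" "alpha_index \<alpha> \<theta>1 = alpha_star \<alpha> \<Theta>" "ks = k_index \<alpha> k \<theta>1" by auto
  then obtain i1 where i1: "e i1 = \<theta>1" using e_range by auto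
  have critical1: "critical i1 \<noteq> {}" using \<theta>1(2) index_iff[of i1] unfolding i1 by blast
  have w1: "T.weight (critical i1) = ks" using weight_eq[OF critical1] \<theta>1 i1 by simp
  have ks0: "0 \<le> ks" using T.weight_nonneg[OF critical1] w1 by simp
  interpret V: monomial_vector M X \<alpha> k c_plus c_minus \<alpha>s e ks
  proof unfold_locales
    show "inj e" using assms(11) by (simp add: bij_betw_def)
    show "T.weight (T.crit (\<lambda>j. real (e i j))) \<le> ks" for i
    proof (cases "critical i = {}")
      case True then show ?thesis using ks0 by (simp add: critical_def T.weight_def)
    next
      case False then show ?thesis using k_le[OF False] weight_eq[OF False] by (simp add: critical_def)
    qed
  qed (use e_le ks0 in auto)
  have critical_eq: "V.critical = critical" by (simp add: fun_eq_iff V.critical_def critical_def)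
  have dominant_iff: "V.dominant i \<longleftrightarrow> e i \<in> Theta_star \<alpha> k \<Theta>" for i
  proof (cases "critical i = {}")
    case True
    then have "T.weight (critical i) \<noteq> ks" using ks0 by (simp add: T.weight_def)
    then show ?thesis using True index_iff[of i] by (simp add: V.dominant_def critical_eq Theta_star_def)
  next
    case False
    then have "e i \<in> Theta_star \<alpha> k \<Theta> \<longleftrightarrow> k_index \<alpha> k (e i) = ks"
      using index_iff[of i] e_in[of i] by (simp add: Theta_star_def ks_def)
    then show ?thesis unfolding V.dominant_def critical_eq weight_eq[OF False] by simp
  qed
  have dominant1: "V.dominant i1" using w1 by (simp add: V.dominant_def critical_eq)
  obtain a b where ab: "\<And>J. J \<in> V.blocks \<Longrightarrow> 0 < a J + b J \<and> upper_tail M (V.U J) \<alpha>s ks (a J) \<and> upper_tail M (\<lambda>\<omega>. - V.U J \<omega>) \<alpha>s ks (b J)"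
    using V.U_tails by blast
  have ab0: "0 \<le> a J \<and> 0 \<le> b J" if "J \<in> V.blocks" for J
    using ab[OF that] upper_tail_nonneg by blast
  define \<Lambda> where "\<Lambda> W = (\<Sum>J\<in>V.blocks. expectation (\<lambda>\<omega>. norm (V.V J \<omega>) powr \<alpha>s * (a J * \<alpha>s * radial_integral \<alpha>s W (sgn (V.V J \<omega>))
      + b J * \<alpha>s * radial_integral \<alpha>s W (- sgn (V.V J \<omega>)))))" for W
  have limit: "((\<lambda>z. rate \<alpha>s ks z * expectation (\<lambda>\<omega>. W (Z \<omega> /\<^sub>R z))) \<longlongrightarrow> \<Lambda> W) at_top" if "W \<in> test_functions" for W
    unfolding \<Lambda>_def Z_def by (rule V.monomial_limit) (use ab that in auto)
  have positive: "0 < \<Lambda> (\<lambda>x. trunc_sq (y \<bullet> x))" if "y $ i1 \<noteq> 0" for y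
    unfolding \<Lambda>_def by (rule V.limit_positive[OF _ dominant1 that]) (use ab ab0 in auto)
  \<comment> \<open>the coefficient vector of the polynomial, so that \<open>Y = y \<bullet> Z\<close>\<close>
  define y where "y = (\<chi> i. h (e i))"
  have y1: "y $ i1 \<noteq> 0" using assms(10)[OF e_in] by (simp add: y_def)

  define u where "u = (axis i1 1 :: real ^ 'm)"
  have u: "norm u = 1" by (simp add: u_def)
  \<comment> \<open>\<open>\<nu>\<close> puts mass \<open>\<alpha>s a\<^sub>J E (norm V)\<^sup>\<alpha>\<close> on the direction of \<open>V\<close> and \<open>\<alpha>s b\<^sub>J E (norm V)\<^sup>\<alpha>\<close> on the opposite one;
    where \<open>V = 0\<close> the density is \<open>0\<close> and the arbitrary direction \<open>u\<close> is used\<close>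
  define w where "w p \<omega> = (if fst p \<in> V.blocks then \<alpha>s * (if snd p then a (fst p) else b (fst p)) * norm (V.V (fst p) \<omega>) powr \<alpha>s else 0)"
    for p :: "'l set \<times> bool" and \<omega>
  define s where "s p \<omega> = (if V.V (fst p) \<omega> = 0 then u else if snd p then sgn (V.V (fst p) \<omega>) else - sgn (V.V (fst p) \<omega>))"
    for p :: "'l set \<times> bool" and \<omega>
  have sgn_meas[measurable]: "(sgn :: real ^ 'm \<Rightarrow> _) \<in> borel_measurable borel"
    unfolding sgn_div_norm [abs_def] by measurable
  have s_meas: "s p \<in> borel_measurable M" for p
    unfolding s_def by measurable
  have s_norm: "norm (s p \<omega>) = 1" for p \<omega> using u by (simp add: s_def norm_sgn)
  have w_int: "integrable M (w p)" for p
    unfolding w_def using V.V_integrable by (cases "fst p \<in> V.blocks") auto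
  have w_nonneg: "0 \<le> w p \<omega>" for p \<omega> using ab0 \<alpha>s by (simp add: w_def)
  from sphere_measure_exists[of s w, OF s_meas s_norm w_int w_nonneg]
  obtain \<nu> where \<nu>0: "sets \<nu> = sets (restrict_space borel (sphere 0 1 :: (real ^ 'm) set)) \<and> finite_measure \<nu> \<and>
    (\<forall>A\<in>sets borel. A \<subseteq> sphere 0 1 \<longrightarrow> emeasure \<nu> A = (\<Sum>p\<in>UNIV. \<integral>\<^sup>+\<omega>. ennreal (w p \<omega>) * indicator A (s p \<omega>) \<partial>M)) \<and>
    (\<forall>f\<in>borel_measurable borel. \<forall>B. (\<forall>x\<in>sphere 0 1. \<bar>f x\<bar> \<le> B) \<longrightarrow>
      (LINT x|\<nu>. f x) = (\<Sum>p\<in>UNIV. expectation (\<lambda>\<omega>. w p \<omega> * f (s p \<omega>))))"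
    by (rule exE)
  then have \<nu>: "sets \<nu> = sets (restrict_space borel (sphere 0 1 :: (real ^ 'm) set))" "finite_measure \<nu>"
    by simp_all
  have \<nu>_em: "emeasure \<nu> A = (\<Sum>p\<in>UNIV. \<integral>\<^sup>+\<omega>. ennreal (w p \<omega>) * indicator A (s p \<omega>) \<partial>M)"
    if "A \<in> sets borel" "A \<subseteq> sphere 0 1" for A
    using \<nu>0 that by simp
  have \<nu>_int: "(LINT x|\<nu>. f x) = (\<Sum>p\<in>UNIV. expectation (\<lambda>\<omega>. w p \<omega> * f (s p \<omega>)))"
    if "f \<in> borel_measurable borel" "\<forall>x\<in>sphere 0 1. \<bar>f x\<bar> \<le> B" for f B
    using \<nu>0[THEN conjunct2, THEN conjunct2, THEN conjunct2, rule_format, OF that(1), of B] that(2) by simp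
  interpret \<nu>: finite_measure \<nu> by (rule \<nu>(2))
  have \<nu>_space: "space \<nu> = sphere 0 1" using sets_eq_imp_space_eq[OF \<nu>(1)] by (simp add: space_restrict_space)
  have polar: "(LINT r:{0<..}|lborel. (LINT s|\<nu>. W (r *\<^sub>R s)) / r powr (1 + \<alpha>s)) = \<Lambda> W"
    "(LINT x|\<nu>. radial_integral \<alpha>s W x) = \<Lambda> W" if W: "W \<in> test_functions" for W
  proof -
    note [measurable] = test_functionsD(2)[OF W]
    define R where "R = radial_integral \<alpha>s W"
    have R_meas[measurable]: "R \<in> borel_measurable borel" unfolding R_def by measurable
    obtain B where B: "\<And>x. norm x = 1 \<Longrightarrow> \<bar>R x\<bar> \<le> B"
      using radial_integral_bound[OF W \<alpha>s(2,3)] unfolding R_def by blast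
    have wR: "integrable M (\<lambda>\<omega>. w p \<omega> * R (s p \<omega>))" for p
    proof (rule Bochner_Integration.integrable_bound)
      show "integrable M (\<lambda>\<omega>. w p \<omega> * B)" using w_int by simp
      show "AE \<omega> in M. norm (w p \<omega> * R (s p \<omega>)) \<le> norm (w p \<omega> * B)"
      proof (rule AE_I2)
        fix \<omega>
        show "norm (w p \<omega> * R (s p \<omega>)) \<le> norm (w p \<omega> * B)"
          using mult_left_mono[OF order_trans[OF B[OF s_norm] abs_ge_self] w_nonneg[of p \<omega>], of p \<omega>] w_nonneg[of p \<omega>]
          by (simp add: abs_mult)
      qed
      show "(\<lambda>\<omega>. w p \<omega> * R (s p \<omega>)) \<in> borel_measurable M"
        using s_meas[of p] w_int[of p] by measurable
    qed
    have "(LINT x|\<nu>. R x) = (\<Sum>p\<in>UNIV. expectation (\<lambda>\<omega>. w p \<omega> * R (s p \<omega>)))"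
      using R_meas B by (intro \<nu>_int[of R B]) auto
    also have "\<dots> = (\<Sum>J\<in>UNIV. \<Sum>c\<in>UNIV. expectation (\<lambda>\<omega>. w (J, c) \<omega> * R (s (J, c) \<omega>)))"
      unfolding UNIV_Times_UNIV[symmetric] by (rule sum.cartesian_product')
    also have "\<dots> = (\<Sum>J\<in>UNIV. expectation (\<lambda>\<omega>. w (J, True) \<omega> * R (s (J, True) \<omega>) + w (J, False) \<omega> * R (s (J, False) \<omega>)))"
      using wR by (simp add: UNIV_bool add.commute)
    also have "\<dots> = (\<Sum>J\<in>V.blocks. expectation (\<lambda>\<omega>. w (J, True) \<omega> * R (s (J, True) \<omega>) + w (J, False) \<omega> * R (s (J, False) \<omega>)))"
      by (rule sum.mono_neutral_right) (auto simp: w_def)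
    also have "\<dots> = \<Lambda> W"
      unfolding \<Lambda>_def R_def[symmetric]
    proof (intro sum.cong refl Bochner_Integration.integral_cong)
      fix J \<omega> assume "J \<in> V.blocks"
      then show "w (J, True) \<omega> * R (s (J, True) \<omega>) + w (J, False) \<omega> * R (s (J, False) \<omega>)
          = norm (V.V J \<omega>) powr \<alpha>s * (a J * \<alpha>s * R (sgn (V.V J \<omega>)) + b J * \<alpha>s * R (- sgn (V.V J \<omega>)))"
        by (cases "V.V J \<omega> = 0") (simp_all add: w_def s_def algebra_simps)
    qed
    finally show 2: "(LINT x|\<nu>. radial_integral \<alpha>s W x) = \<Lambda> W" unfolding R_def .
    show "(LINT r:{0<..}|lborel. (LINT s|\<nu>. W (r *\<^sub>R s)) / r powr (1 + \<alpha>s)) = \<Lambda> W"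
      using polar_integral[OF W \<alpha>s(2,3) \<nu>] 2 by simp
  qed
  have inner_test: "(\<lambda>x. f (y \<bullet> x)) \<in> test_functions" if "f \<in> test_functions" for f :: "real \<Rightarrow> real"
    by (rule test_functions_bounded_linear[OF that bounded_linear_inner_right])
  have \<nu>_pos: "emeasure \<nu> (sphere 0 1) > 0"
  proof (rule ccontr)
    assume "\<not> 0 < emeasure \<nu> (sphere 0 1)"
    then have "emeasure \<nu> (space \<nu>) = 0" using \<nu>_space by simp
    then have "space \<nu> \<in> null_sets \<nu>" by (simp add: null_sets_def)
    then have "AE x in \<nu>. radial_integral \<alpha>s (\<lambda>x. trunc_sq (y \<bullet> x)) x = 0" by (rule AE_I') auto
    then have "(LINT x|\<nu>. radial_integral \<alpha>s (\<lambda>x. trunc_sq (y \<bullet> x)) x) = 0" by (rule integral_eq_zero_AE)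
    then show False using polar(2)[OF inner_test[OF trunc_sq_test_function]] positive[OF y1] by simp
  qed
  have support: "emeasure \<nu> (sphere 0 1 - (L \<inter> sphere 0 1)) = 0"
    if L: "subspace L" "measure_support (distr M borel Zs) \<subseteq> L" for L
  proof -
    have Zs_eq: "Zs \<omega> = (\<chi> i. if V.dominant i then monomial_fun (e i) (\<lambda>j. X j \<omega>) else 0)" for \<omega>
      by (simp add: Zs_def star_monomial_vec_def dominant_iff)
    have "Zs \<in> borel_measurable M"
    proof (rule vec_measurableI)
      show "(\<lambda>\<omega>. Zs \<omega> $ i) \<in> borel_measurable M" for i
        by (cases "V.dominant i") (simp_all add: Zs_eq monomial_fun_def)
    qed
    then have "AE \<omega> in M. Zs \<omega> \<in> L" by (rule AE_in_support[OF _ closed_subspace[OF L(1)] L(2)])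
    then have AE_L: "AE \<omega> in M. (\<chi> i. if V.dominant i then monomial_fun (e i) (\<lambda>j. X j \<omega>) else 0) \<in> L"
      unfolding Zs_eq .
    have in_L: "x \<in> L" if "\<And>i. \<not> V.dominant i \<Longrightarrow> x $ i = 0" for x
      by (rule V.span_of_star_support[OF L(1) AE_L that])
    have s_L: "s p \<omega> \<in> L" if "V.V (fst p) \<omega> \<noteq> 0" for p \<omega>
      using that by (intro in_L) (auto simp: s_def sgn_div_norm V.cofactor_zero)
    have "emeasure \<nu> (sphere 0 1 - (L \<inter> sphere 0 1))
        = (\<Sum>p\<in>UNIV. \<integral>\<^sup>+\<omega>. ennreal (w p \<omega>) * indicator (sphere 0 1 - (L \<inter> sphere 0 1)) (s p \<omega>) \<partial>M)"
      using closed_subspace[OF L(1)] by (intro \<nu>_em) (auto intro!: sets.Diff sets.Int borel_closed)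
    also have "\<dots> = 0"
    proof (rule sum.neutral, rule ballI)
      fix p
      have zero: "ennreal (w p \<omega>) * indicator (sphere 0 1 - (L \<inter> sphere 0 1)) (s p \<omega>) = 0" for \<omega>
        using s_L[of p \<omega>] by (cases "V.V (fst p) \<omega> = 0") (auto simp: w_def)
      show "(\<integral>\<^sup>+\<omega>. ennreal (w p \<omega>) * indicator (sphere 0 1 - (L \<inter> sphere 0 1)) (s p \<omega>) \<partial>M) = 0"
        unfolding zero by simp
    qed
    finally show ?thesis .
  qed

  have Y_eq: "Y \<omega> = y \<bullet> Z \<omega>" for \<omega>
    unfolding Y_def polynomial_fun_def Z_def
    by (simp add: inner_vec_def y_def monomial_vec_def sum.reindex_bij_betw[OF assms(11), symmetric])
  have [measurable]: "Z \<in> borel_measurable M" unfolding Z_def by (rule V.Z_measurable)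
  have Y_meas[measurable]: "Y \<in> borel_measurable M" unfolding Y_eq [abs_def] by measurable
  have Y_lim: "((\<lambda>z. rate \<alpha>s ks z * expectation (\<lambda>\<omega>. f (Y \<omega> / z))) \<longlongrightarrow> \<Lambda> (\<lambda>x. f (y \<bullet> x))) at_top"
    if "f \<in> test_functions" for f :: "real \<Rightarrow> real"
    using limit[OF inner_test[OF that]] by (simp add: Y_eq divide_inverse mult.commute)
  have "\<exists>L. ((\<lambda>z. rate \<alpha>s ks z * expectation (\<lambda>\<omega>. f (- Y \<omega> / z))) \<longlongrightarrow> L) at_top"
    if "f \<in> test_functions" for f :: "real \<Rightarrow> real"
  proof -
    have "(\<lambda>x. f (- x)) \<in> test_functions"
      by (rule test_functions_compose[OF that]) (auto intro: continuous_intros)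
    from Y_lim[OF this] show ?thesis by auto
  qed
  then obtain c_minus' where minus: "upper_tail M (\<lambda>\<omega>. - Y \<omega>) \<alpha>s ks c_minus'"
    using upper_tail_of_test_limits[of "\<lambda>\<omega>. - Y \<omega>" \<alpha>s ks] \<alpha>s(2) by auto
  have "\<exists>c. upper_tail M Y \<alpha>s ks c"
    by (rule upper_tail_of_test_limits[OF Y_meas \<alpha>s(2)]) (use Y_lim in blast)
  then obtain c_plus' where plus: "upper_tail M Y \<alpha>s ks c_plus'" by blast
  have c0: "0 \<le> c_plus'" "0 \<le> c_minus'" using plus minus upper_tail_nonneg by blast+
  \<comment> \<open>if both constants were zero, the two-sided limit for \<open>trunc_sq\<close> would be zero as well\<close>
  have "c_plus' + c_minus' \<noteq> 0"
  proof
    assume "c_plus' + c_minus' = 0"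
    then have "c_plus' = 0" "c_minus' = 0" using c0 by auto
    then have "((\<lambda>z. rate \<alpha>s ks z * expectation (\<lambda>\<omega>. trunc_sq (Y \<omega> / z))) \<longlongrightarrow> 0) at_top"
      using two_sided_test_limit[OF plus minus \<alpha>s(2,3) ks0 trunc_sq_test_function] by simp
    from tendsto_unique[OF _ this Y_lim[OF trunc_sq_test_function]] positive[OF y1] show False by simp
  qed
  then have c_pos: "0 < c_plus' + c_minus'" using c0 by simp

  have "((\<lambda>z. z powr \<alpha>s * ln z powr (- ks) * (LINT \<omega>|M. W (Z \<omega> /\<^sub>R z))) \<longlongrightarrow>
      (LINT r:{0<..}|lborel. (LINT s|\<nu>. W (r *\<^sub>R s)) / r powr (1 + \<alpha>s))) at_top" if "W \<in> test_functions" for W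
    using limit[OF that] unfolding polar(1)[OF that] rate_def .
  then show ?thesis
    using \<nu> \<nu>_pos support c0 c_pos upper_tailD(2)[OF plus] upper_tailD(2)[OF minus]
    unfolding rate_def by (intro conjI exI[of _ \<nu>] exI[of _ c_plus'] exI[of _ c_minus']) blast+
qed

end
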